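(* In the setting of the main theorem (with $\alpha,\beta,\gamma>0$, $\gamma^2>\alpha\beta$, weights $(a_1,\dots,a_6)=(1,\gamma^2-\alpha\beta,\beta,\alpha,\gamma,\gamma)$ and $\mathbb{P}$ the infinite-volume limit measure), for every $v\in\mathbb{Z}^2$ and $t\in\{1,\dots,6\}$, $$\mathbb{P}(\tau_v(\sigma)=t)=\int_{(S^1)^4}\frac{dw_1}{2\pi i w_1}\frac{dw_2}{2\pi i w_2}\frac{d\tilde w_1}{2\pi i\tilde w_1}\frac{d\tilde w_2}{2\pi i\tilde w_2}\,\frac{f_t(\mathbf w)}{\Delta(w_1,w_2)\Delta(\tilde w_1,\tilde w_2)},$$ where, for $\mathbf w=(w_1,w_2,\tilde w_1,\tilde w_2)$, $f_1=(1+\beta w_2)(1+\alpha\tilde w_1)-\gamma^2w_1\tilde w_2$, $f_2=(\gamma^2-\alpha\beta)\big(\gamma^2\tilde w_1w_2-(1+\alpha\tilde w_1)(1+\beta w_2)\big)w_1\tilde w_2$, $f_3=\beta\tilde w_2\big((1+\beta w_2)(1+\alpha\tilde w_1)-\gamma^2w_1w_2\big)$, $f_4=\alpha w_1\big((1+\beta w_2)(1+\alpha\tilde w_1)-\gamma^2\tilde w_1\tilde w_2\big)$, $f_5=\gamma^2\tilde w_2(1+\beta w_2)(w_1-\tilde w_1)$, $f_6=\gamma^2w_1(1+\alpha\tilde w_1)(\tilde w_2-w_2)$.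
   Context: Six-vertex model: on $\mathbb{T}_n=(\mathbb{Z}/n\mathbb{Z})^2$, configurations are edge orientations with two incoming and two outgoing edges at each vertex. Local type at $v$: type 1: horizontal edges point right, vertical point up; type 2: horizontal left, vertical down; type 3: horizontal right, vertical down; type 4: horizontal left, vertical up; type 5: horizontal edges into $v$, vertical edges out of $v$; type 6: horizontal edges out of $v$, vertical into $v$. $\mathbb{P}_n(\sigma)\propto\prod_v a_{\tau_v(\sigma)}$; configurations on $\mathbb{T}_n$ are identified with $n$-periodic configurations on $\mathbb{Z}^2$, and $\mathbb{P}$ is the probability measure on six-vertex configurations of $\mathbb{Z}^2$ whose finite-dimensional vertex-type probabilities are the limits as $n\to\infty$ of those under $\mathbb{P}_n$. $\Delta(w_1,w_2)=(1+\alpha w_1)(1+\beta w_2)-\gamma^2w_1w_2$, and $S^1=\{|w|=1\}$. *)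

theory Defs
  imports "HOL-Analysis.Analysis"
begin

text \<open>Edge orientations of n-periodic configurations on Z^2.
  A configuration is a pair (hor, ver) of functions on Z^2:
  hor (i,j) is the orientation of the horizontal edge from (i,j) to (i+1,j)
  (True = points right), ver (i,j) that of the vertical edge from (i,j) to (i,j+1)
  (True = points up).  Configurations on the torus T_n are identified with
  n-periodic configurations on Z^2.\<close>

type_synonym orientation = "(int \<times> int \<Rightarrow> bool) \<times> (int \<times> int \<Rightarrow> bool)"

definition periodic_conf :: "nat \<Rightarrow> orientation \<Rightarrow> bool" where
  "periodic_conf n \<sigma> \<longleftrightarrow>
     (\<forall>i j. fst \<sigma> (i + int n, j) = fst \<sigma> (i, j) \<and> fst \<sigma> (i, j + int n) = fst \<sigma> (i, j)
          \<and> snd \<sigma> (i + int n, j) = snd \<sigma> (i, j) \<and> snd \<sigma> (i, j + int n) = snd \<sigma> (i, j))"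

definition in_degree :: "orientation \<Rightarrow> int \<times> int \<Rightarrow> nat" where
  "in_degree \<sigma> x = (case x of (i, j) \<Rightarrow>
      (if fst \<sigma> (i - 1, j) then 1 else 0) + (if \<not> fst \<sigma> (i, j) then 1 else 0)
    + (if snd \<sigma> (i, j - 1) then 1 else 0) + (if \<not> snd \<sigma> (i, j) then 1 else 0))"

definition six_vertex_configs :: "nat \<Rightarrow> orientation set" where
  "six_vertex_configs n = {\<sigma>. periodic_conf n \<sigma> \<and> (\<forall>x. in_degree \<sigma> x = 2)}"

text \<open>Local type tau_v(sigma) in {1..6} (0 if the ice rule fails at v).\<close>
definition vtype :: "orientation \<Rightarrow> int \<times> int \<Rightarrow> nat" where
  "vtype \<sigma> x = (case x of (i, j) \<Rightarrow>
     let l = fst \<sigma> (i - 1, j); r = fst \<sigma> (i, j); d = snd \<sigma> (i, j - 1); u = snd \<sigma> (i, j) in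
     if l \<and> r \<and> d \<and> u then 1
     else if \<not> l \<and> \<not> r \<and> \<not> d \<and> \<not> u then 2
     else if l \<and> r \<and> \<not> d \<and> \<not> u then 3
     else if \<not> l \<and> \<not> r \<and> d \<and> u then 4
     else if l \<and> \<not> r \<and> \<not> d \<and> u then 5
     else if \<not> l \<and> r \<and> d \<and> \<not> u then 6
     else 0)"

definition conf_weight :: "(nat \<Rightarrow> real) \<Rightarrow> nat \<Rightarrow> orientation \<Rightarrow> real" where
  "conf_weight a n \<sigma> = (\<Prod>x \<in> {0..<int n} \<times> {0..<int n}. a (vtype \<sigma> x))"

definition torus_type_prob :: "(nat \<Rightarrow> real) \<Rightarrow> nat \<Rightarrow> int \<times> int \<Rightarrow> nat \<Rightarrow> real" where
  "torus_type_prob a n v t =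
     (\<Sum>\<sigma> \<in> {\<sigma> \<in> six_vertex_configs n. vtype \<sigma> v = t}. conf_weight a n \<sigma>)
     / (\<Sum>\<sigma> \<in> six_vertex_configs n. conf_weight a n \<sigma>)"

definition sv_weights :: "real \<Rightarrow> real \<Rightarrow> real \<Rightarrow> nat \<Rightarrow> real" where
  "sv_weights \<alpha> \<beta> \<gamma> t =
     (if t = 1 then 1 else if t = 2 then \<gamma>\<^sup>2 - \<alpha> * \<beta> else if t = 3 then \<beta>
      else if t = 4 then \<alpha> else if t = 5 then \<gamma> else if t = 6 then \<gamma> else 0)"

definition Delta :: "real \<Rightarrow> real \<Rightarrow> real \<Rightarrow> complex \<Rightarrow> complex \<Rightarrow> complex" where
  "Delta \<alpha> \<beta> \<gamma> w1 w2 =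
     (1 + of_real \<alpha> * w1) * (1 + of_real \<beta> * w2) - (of_real \<gamma>)\<^sup>2 * w1 * w2"

text \<open>The numerators f_t(w1, w2, w1~, w2~); the arguments are w1 w2 v1 v2 with v = w~.\<close>
definition f_num :: "real \<Rightarrow> real \<Rightarrow> real \<Rightarrow> nat \<Rightarrow> complex \<Rightarrow> complex \<Rightarrow> complex \<Rightarrow> complex \<Rightarrow> complex" where
  "f_num \<alpha> \<beta> \<gamma> t w1 w2 v1 v2 =
    (let a = of_real \<alpha>; b = of_real \<beta>; g = of_real \<gamma> in
     if t = 1 then (1 + b * w2) * (1 + a * v1) - g\<^sup>2 * w1 * v2
     else if t = 2 then (g\<^sup>2 - a * b) * (g\<^sup>2 * v1 * w2 - (1 + a * v1) * (1 + b * w2)) * w1 * v2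
     else if t = 3 then b * v2 * ((1 + b * w2) * (1 + a * v1) - g\<^sup>2 * w1 * w2)
     else if t = 4 then a * w1 * ((1 + b * w2) * (1 + a * v1) - g\<^sup>2 * v1 * v2)
     else if t = 5 then g\<^sup>2 * v2 * (1 + b * w2) * (w1 - v1)
     else if t = 6 then g\<^sup>2 * w1 * (1 + a * v1) * (v2 - w2)
     else 0)"

text \<open>int_{(S^1)^4} prod_k dw_k/(2 pi i w_k) F(w), written out via the parametrisation
  w_k = exp(i theta_k), theta_k in [0, 2 pi], for which dw_k/(2 pi i w_k) = d theta_k/(2 pi);
  Lebesgue integral over the cube [0,2pi]^4.\<close>
definition torus4_integral :: "(complex \<Rightarrow> complex \<Rightarrow> complex \<Rightarrow> complex \<Rightarrow> complex) \<Rightarrow> complex" where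
  "torus4_integral F =
     (LINT \<theta>:cbox (0::real^4) (\<chi> k. 2 * pi)|lborel.
        complex_of_real (1 / (2 * pi) ^ 4) *
        F (cis (\<theta> $ 1)) (cis (\<theta> $ 2)) (cis (\<theta> $ 3)) (cis (\<theta> $ 4)))"

end

(*
  The lines formed by the left- and down-pointing edges turn a configuration into directed
  lattice paths.  Resolving doubly occupied vertices in both ways expands det (I - K), for the
  one-step operator K on the 2 n^2 edges, into the sum over configurations of their weight (this is
  where the free-fermion relation a_1 a_2 + a_3 a_4 = a_5 a_6 enters) times
  (-1)^(P + Q + P Q) u^P v^Q, where P and Q count the lines crossing a vertical and a horizontal
  cut.  Averaging over the four signs of (u, v) removes the sign, and by Fourier analysis and a rank
  two perturbation the type probabilities in each sector are bilinear in the Riemann sums of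
  1, w_1, w_2, w_1 w_2 over Delta.

  Delta may vanish on the torus, and grid points close to a zero spoil the Riemann sums.  Since P/n
  concentrates (the exponential moments of P are again partition functions, bounded below through
  the maximum principle in u), an additional twist u = e^(i tau) with tau = O(1/n) changes the
  expectations only by a phase and o(1).  Among boundedly many such twists one keeps all four grids
  away from the zeros, and for it the sums over w_1, which are explicit, converge.
*)

theory Submission
  imports Defs "HOL-Combinatorics.Permutations"
begin

section \<open>Determinants over finite index sets\<close>

text \<open>No sector determinant is bounded below, so the ratio N / D of a single sector is not
  controlled. What is used instead is linear: |N - I D| <= delta |D| <= delta Z, because a signed or
  twisted partition function never exceeds the positive one Z; four such bounds add up, and the
  twisted mean of u^P is never divided by either. The sum over w_1 leaves the denominator A^n - u
  B^n, where A = 1 + beta w_2 and B = alpha - (gamma^2 - alpha beta) w_2. Zeros of Delta lie where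
  |A| = |B|. On the unit circle |A|^2 - |B|^2 is affine in Re w_2, so there are at most two such
  points, conjugate and possibly merging at 1 or -1. The scale 1/n of the twist is forced from two
  sides. Rotating u by order R/n moves A^n - u B^n by a relative R/n near these points, after which
  each of the O(K) grid points there contributes O(1/R) to the mean. And tau P = tau n m + o(1) for
  tau = O(1/n) asks only for P = n m + o(n). The tails of P/n decay like exp(-c n^2), because exp(h
  n P) is itself a twist of modulus exp(h n); this outweighs the 2^n lost by bounding n factors
  crudely.\<close>

definition detS :: "'a set \<Rightarrow> ('a \<Rightarrow> 'a \<Rightarrow> complex) \<Rightarrow> complex" where
  "detS E M = (\<Sum>p | p permutes E. of_int (sign p) * (\<Prod>e\<in>E. M e (p e)))"

lemma detS_cong:
  assumes "\<And>e f. e \<in> E \<Longrightarrow> f \<in> E \<Longrightarrow> M e f = N e f"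
  shows "detS E M = detS E N"
  unfolding detS_def
proof (intro sum.cong refl arg_cong2[where f="(*)"] prod.cong)
  fix p e assume "p \<in> {p. p permutes E}" "e \<in> E"
  then show "M e (p e) = N e (p e)"
    using assms permutes_in_image[of p E e] by auto
qed

lemma detS_permute_rows:
  assumes E: "finite E" and q: "q permutes E"
  shows "detS E (\<lambda>e. M (q e)) = of_int (sign q) * detS E M"
proof -
  have "detS E (\<lambda>e. M (q e))
      = (\<Sum>p | p permutes E. of_int (sign (p \<circ> q)) * (\<Prod>e\<in>E. M (q e) ((p \<circ> q) e)))"
    unfolding detS_def
    by (rule sum_permutations_compose_right[OF q, of "\<lambda>p. of_int (sign p) * (\<Prod>e\<in>E. M (q e) (p e))"])
  also have "\<dots> = (\<Sum>p | p permutes E. of_int (sign q) * (of_int (sign p) * (\<Prod>e\<in>E. M e (p e))))"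
  proof (rule sum.cong[OF refl])
    fix p assume "p \<in> {p. p permutes E}"
    then have p: "p permutes E" by simp
    have "sign (p \<circ> q) = sign p * sign q"
      using p q E by (intro sign_compose permutes_imp_permutation)
    moreover have "(\<Prod>e\<in>E. M (q e) ((p \<circ> q) e)) = (\<Prod>e\<in>E. M e (p e))"
      using prod.permute[OF q, of "\<lambda>e. M e (p e)"] by (simp add: o_def)
    ultimately show "of_int (sign (p \<circ> q)) * (\<Prod>e\<in>E. M (q e) ((p \<circ> q) e))
        = of_int (sign q) * (of_int (sign p) * (\<Prod>e\<in>E. M e (p e)))"
      by simp
  qed
  finally show ?thesis by (simp add: detS_def sum_distrib_left)
qed

lemma detS_identical_rows:
  assumes E: "finite E" and ab: "a \<in> E" "b \<in> E" "a \<noteq> b" and eq: "M a = M b"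
  shows "detS E M = 0"
proof -
  have M': "(\<lambda>e. M (Transposition.transpose a b e)) = M"
  proof
    fix e show "M (Transposition.transpose a b e) = M e"
      using eq by (cases "e = a"; cases "e = b") simp_all
  qed
  have "detS E (\<lambda>e. M (Transposition.transpose a b e)) = of_int (sign (Transposition.transpose a b)) * detS E M"
    by (rule detS_permute_rows[OF E permutes_swap_id[OF ab(1,2)]])
  also have "\<dots> = - detS E M"
    using ab by (simp add: sign_swap_id)
  finally have "detS E M + detS E M = 0" unfolding M' by (metis add.right_inverse)
  then show ?thesis by (metis mult_2 mult_eq_0_iff zero_neq_numeral)
qed

text \<open>Expand every row of the product over functions f from E to E. A non-injective f repeats
  a row of \<open>N\<close> and contributes 0; an injective one is a permutation of the rows of
  \<open>N\<close> and contributes its sign.\<close>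

lemma detS_mult:
  assumes E: "finite E"
  shows "detS E (\<lambda>a c. \<Sum>b\<in>E. M a b * N b c) = detS E M * detS E N"
proof -
  have "detS E (\<lambda>a c. \<Sum>b\<in>E. M a b * N b c)
      = (\<Sum>p | p permutes E. \<Sum>f\<in>E \<rightarrow>\<^sub>E E. of_int (sign p) * (\<Prod>e\<in>E. M e (f e) * N (f e) (p e)))"
    unfolding detS_def by (simp add: prod_sum_PiE E sum_distrib_left)
  also have "\<dots> = (\<Sum>f\<in>E \<rightarrow>\<^sub>E E. (\<Prod>e\<in>E. M e (f e)) * detS E (\<lambda>e. N (f e)))"
    by (subst sum.swap) (simp add: detS_def prod.distrib sum_distrib_left mult_ac)
  also have "\<dots> = (\<Sum>f | f \<in> E \<rightarrow>\<^sub>E E \<and> inj_on f E. (\<Prod>e\<in>E. M e (f e)) * detS E (\<lambda>e. N (f e)))"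
  proof (rule sum.mono_neutral_right)
    show "\<forall>f\<in>(E \<rightarrow>\<^sub>E E) - {f \<in> E \<rightarrow>\<^sub>E E. inj_on f E}. (\<Prod>e\<in>E. M e (f e)) * detS E (\<lambda>e. N (f e)) = 0"
    proof
      fix f assume "f \<in> (E \<rightarrow>\<^sub>E E) - {f \<in> E \<rightarrow>\<^sub>E E. inj_on f E}"
      then obtain a b where "a \<in> E" "b \<in> E" "a \<noteq> b" "f a = f b" by (auto simp: inj_on_def)
      then have "detS E (\<lambda>e. N (f e)) = 0"
        using detS_identical_rows[OF E, of a b "\<lambda>e. N (f e)"] by simp
      then show "(\<Prod>e\<in>E. M e (f e)) * detS E (\<lambda>e. N (f e)) = 0" by simp
    qed
  qed (auto intro: finite_PiE E)
  also have "\<dots> = (\<Sum>q | q permutes E. of_int (sign q) * (\<Prod>e\<in>E. M e (q e)) * detS E N)"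
  \<comment> \<open>Extensional functions are undefined off E while permutations are the identity
    there; the two witnesses translate between these conventions.\<close>
  proof (rule sum.reindex_bij_witness[of _ "\<lambda>q. restrict q E" "\<lambda>f x. if x \<in> E then f x else x"])
    fix f assume f: "f \<in> {f \<in> E \<rightarrow>\<^sub>E E. inj_on f E}"
    let ?q = "\<lambda>x. if x \<in> E then f x else x"
    show "restrict ?q E = f" using f by (auto simp: fun_eq_iff PiE_def extensional_def)
    have q: "?q permutes E"
      using f E by (intro inj_imp_permutes) (auto simp: inj_on_def)
    then show "?q \<in> {q. q permutes E}" by simp
    have "detS E (\<lambda>e. N (f e)) = detS E (\<lambda>e. N (?q e))"
      by (rule detS_cong) auto
    also have "\<dots> = of_int (sign ?q) * detS E N" by (rule detS_permute_rows[OF E q])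
    finally show "of_int (sign ?q) * (\<Prod>e\<in>E. M e (?q e)) * detS E N = (\<Prod>e\<in>E. M e (f e)) * detS E (\<lambda>e. N (f e))"
      by simp
  next
    fix q assume "q \<in> {q. q permutes E}"
    then have q: "q permutes E" by simp
    show "(\<lambda>x. if x \<in> E then restrict q E x else x) = q"
      using q by (auto simp: fun_eq_iff permutes_not_in)
    show "restrict q E \<in> {f \<in> E \<rightarrow>\<^sub>E E. inj_on f E}"
      using permutes_inj_on[OF q, of E] q by (simp add: inj_on_def permutes_in_image)
  qed
  finally show ?thesis by (simp add: detS_def sum_distrib_right)
qed

text \<open>A permutation that moves some index outside {a, b} meets a zero of an identity row, so
  only the identity and the transposition of a and b survive. Changing the weights at one vertex
  alters exactly the rows of its two incoming edges, which is the use made of this.\<close>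

lemma detS_two_rows:
  assumes E: "finite E" and ab: "a \<in> E" "b \<in> E" "a \<noteq> b"
    and M: "\<And>e f. e \<in> E - {a, b} \<Longrightarrow> f \<in> E \<Longrightarrow> M e f = (if e = f then 1 else 0)"
  shows "detS E M = M a a * M b b - M a b * M b a"
proof -
  have split: "prod g E = g a * g b * prod g (E - {a} - {b})" for g :: "'a \<Rightarrow> complex"
    using prod.remove[OF E, of a g] prod.remove[of "E - {a}" b g] ab E by (simp add: mult.assoc)
  have sub: "{id, Transposition.transpose a b} \<subseteq> {p. p permutes E}"
    using ab by (auto simp: permutes_id permutes_swap_id)
  have "detS E M = (\<Sum>p\<in>{id, Transposition.transpose a b}. of_int (sign p) * (\<Prod>e\<in>E. M e (p e)))"
    unfolding detS_def
  proof (rule sum.mono_neutral_right)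
    show "\<forall>p\<in>{p. p permutes E} - {id, Transposition.transpose a b}. of_int (sign p) * (\<Prod>e\<in>E. M e (p e)) = 0"
    proof
      fix p assume p: "p \<in> {p. p permutes E} - {id, Transposition.transpose a b}"
      then have "\<not> p permutes {a, b}" by (simp add: permutes_doubleton_iff)
      moreover have pE: "p permutes E" using p by simp
      ultimately obtain e where e: "e \<in> E - {a, b}" "p e \<noteq> e"
        using permutes_superset[of p E "{a, b}"] by metis
      then have "M e (p e) = 0" using M[of e "p e"] permutes_in_image[OF pE, of e] by simp
      then have "(\<Prod>e\<in>E. M e (p e)) = 0"
        using e E by (intro prod_zero) auto
      then show "of_int (sign p) * (\<Prod>e\<in>E. M e (p e)) = 0" by simp
    qed
  qed (use sub in \<open>simp_all add: E finite_permutations\<close>)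
  also have "\<dots> = (\<Prod>e\<in>E. M e e) - (\<Prod>e\<in>E. M e (Transposition.transpose a b e))"
  proof -
    have "id a \<noteq> Transposition.transpose a b a" using ab by simp
    then have "id \<noteq> Transposition.transpose a b" by force
    then show ?thesis using ab by (simp add: sign_swap_id)
  qed
  also have "(\<Prod>e\<in>E. M e e) = M a a * M b b * (\<Prod>e\<in>E - {a} - {b}. M e e)"
    using split[of "\<lambda>e. M e e"] by simp
  also have "(\<Prod>e\<in>E - {a} - {b}. M e e) = 1"
    by (intro prod.neutral ballI) (use M in auto)
  also have "(\<Prod>e\<in>E. M e (Transposition.transpose a b e))
      = M a b * M b a * (\<Prod>e\<in>E - {a} - {b}. M e (Transposition.transpose a b e))"
    using split[of "\<lambda>e. M e (Transposition.transpose a b e)"] by simp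
  also have "(\<Prod>e\<in>E - {a} - {b}. M e (Transposition.transpose a b e)) = 1"
    by (intro prod.neutral ballI) (use M in auto)
  finally show ?thesis by simp
qed

lemma detS_one: 
  assumes E: "finite E"
  shows "detS E (\<lambda>e f. if e = f then 1 else 0) = 1"
proof -
  have "of_int (sign p) * (\<Prod>e\<in>E. if e = p e then 1 else 0) = (0::complex)" 
    if p: "p permutes E" "p \<noteq> id" for p
  proof -
    obtain e where e: "p e \<noteq> e" using p(2) by (meson eq_id_iff)
    have "e \<in> E" using permutes_not_in[OF p(1), of e] e by blast
    then have "\<exists>e\<in>E. (if e = p e then 1 else 0) = (0::complex)"
      using e by (intro bexI[of _ e]) simp_all
    then have "(\<Prod>e\<in>E. if e = p e then 1 else 0) = (0::complex)"
      by (rule prod_zero[OF E])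
    then show ?thesis by (simp only: mult_zero_right)
  qed
  then have "detS E (\<lambda>e f. if e = f then 1 else 0)
     = (\<Sum>p\<in>{id}. of_int (sign p) * (\<Prod>e\<in>E. if e = p e then 1 else 0))"
    unfolding detS_def
    by (intro sum.mono_neutral_right finite_permutations E) (auto simp only: permutes_id)
  then show ?thesis by simp
qed

text \<open>Induction on the set Y of blocks that are switched on: the matrix with blocks on
  \<open>insert y Y\<close> is the product of the one with the single block y and the one with
  blocks on Y, since these act on different indices.\<close>

lemma detS_block_diagonal:
  fixes m :: "'a \<Rightarrow> bool \<Rightarrow> bool \<Rightarrow> complex"
  assumes X: "finite X"
  shows "detS (X \<times> UNIV) (\<lambda>e f. if fst e = fst f then m (fst e) (snd e) (snd f) else 0)
       = (\<Prod>x\<in>X. m x True True * m x False False - m x True False * m x False True)"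
proof -
  define E :: "('a \<times> bool) set" where "E = X \<times> UNIV"
  have E: "finite E" using X by (simp add: E_def)
  define B where "B = (\<lambda>Y (e::'a \<times> bool) (f::'a \<times> bool).
     if fst e = fst f \<and> fst e \<in> Y then m (fst e) (snd e) (snd f) else if e = f then 1 else 0)"
  have "detS E (B Y) = (\<Prod>x\<in>Y. m x True True * m x False False - m x True False * m x False True)"
    if "finite Y" "Y \<subseteq> X" for Y
    using that
  proof (induction Y rule: finite_induct)
    case empty
    then show ?case using detS_one[OF E] by (simp add: B_def)
  next
    case (insert y Y)
    have "detS E (B (insert y Y)) = detS E (\<lambda>a c. \<Sum>b\<in>E. B {y} a b * B Y b c)"
    proof (rule detS_cong)
      fix e f assume ef: "e \<in> E" "f \<in> E"
      show "B (insert y Y) e f = (\<Sum>b\<in>E. B {y} e b * B Y b f)"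
      proof (cases "fst e = y")
        case True
        have "(\<Sum>b\<in>E. B {y} e b * B Y b f) = (\<Sum>b\<in>E. if b = f then B {y} e f else 0)"
          by (intro sum.cong refl) (use True insert.hyps in \<open>auto simp: B_def\<close>)
        also have "\<dots> = B (insert y Y) e f"
          using ef True E insert.hyps by (auto simp: B_def)
        finally show ?thesis by simp
      next
        case False
        have "(\<Sum>b\<in>E. B {y} e b * B Y b f) = (\<Sum>b\<in>E. if b = e then B Y e f else 0)"
          by (intro sum.cong refl) (use False in \<open>auto simp: B_def\<close>)
        also have "\<dots> = B (insert y Y) e f"
          using ef False E by (auto simp: B_def)
        finally show ?thesis by simp
      qed
    qed
    also have "\<dots> = detS E (B {y}) * detS E (B Y)" by (rule detS_mult[OF E])
    also have "detS E (B {y}) = m y True True * m y False False - m y True False * m y False True"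
      by (subst detS_two_rows[OF E, where a = "(y, True)" and b = "(y, False)"])
         (use insert.prems in \<open>auto simp: E_def B_def\<close>)
    finally show ?case using insert by simp
  qed
  from this[OF X] have "detS E (B X) = (\<Prod>x\<in>X. m x True True * m x False False - m x True False * m x False True)"
    by simp
  moreover have "detS E (B X) = detS E (\<lambda>e f. if fst e = fst f then m (fst e) (snd e) (snd f) else 0)"
    by (rule detS_cong) (auto simp: B_def E_def)
  ultimately show ?thesis by (simp add: E_def)
qed

text \<open>The product over pairs is multiplicative in p and equals -1 on transpositions, which
  characterises the sign. The injective \<open>key\<close> carries the order of the integers over to
  S, so that edges of the torus can be sorted in a convenient way.\<close>

lemma sign_eq_prod_inversions:
  fixes key :: "'a \<Rightarrow> int"
  assumes "finite S" "inj_on key S" "p permutes S"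
  shows "sign p = (\<Prod>(e, f) \<in> {(e, f). e \<in> S \<and> f \<in> S \<and> key e < key f}. if key (p e) < key (p f) then 1 else - 1)"
proof -
  note S = \<open>finite S\<close> note inj = \<open>inj_on key S\<close>
  define s where "s = (\<lambda>e f. if key e < key f then 1 else - 1 :: int)"
  define Prs where "Prs = {(e, f). e \<in> S \<and> f \<in> S \<and> key e < key f}"
  have fin: "finite Prs"
    by (rule finite_subset[of _ "S \<times> S"]) (auto simp: Prs_def S)
  define I where "I = (\<lambda>p. \<Prod>(e, f)\<in>Prs. s (p e) (p f))"
  have anti: "s e f = - s f e" if "e \<in> S" "f \<in> S" "e \<noteq> f" for e f
    using that inj by (auto simp: s_def inj_on_def)
  have s2: "s e f * s e f = 1" for e f by (simp add: s_def)
  have mult: "I (q \<circ> p) = I p * I q" if p: "p permutes S" and q: "q permutes S" for p q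
  proof -
    have pS: "p e \<in> S" if "e \<in> S" for e using that p by (simp add: permutes_in_image)
    have pinj: "p e \<noteq> p f" if "e \<noteq> f" for e f using that permutes_inj[OF p] by (auto dest: injD)
    \<comment> \<open>Insert the square of \<open>s (p e) (p f)\<close>. The product of the two
      signs at (p e, p f) no longer depends on the order within the pair, because each of them is
      antisymmetric; it can be reindexed along the action of p on unordered pairs.\<close>
    have "I (q \<circ> p) = (\<Prod>(e, f)\<in>Prs. s (p e) (p f) * (s (p e) (p f) * s (q (p e)) (q (p f))))"
      unfolding I_def by (intro prod.cong refl) (auto simp: mult.assoc[symmetric] s2)
    also have "\<dots> = I p * (\<Prod>(e, f)\<in>Prs. s (p e) (p f) * s (q (p e)) (q (p f)))"
      by (simp add: I_def case_prod_unfold prod.distrib)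
    also have "(\<Prod>(e, f)\<in>Prs. s (p e) (p f) * s (q (p e)) (q (p f))) = I q"
      unfolding I_def
    proof (rule prod.reindex_bij_witness[of _ 
          "\<lambda>(e, f). if key (inv p e) < key (inv p f) then (inv p e, inv p f) else (inv p f, inv p e)"
          "\<lambda>(e, f). if key (p e) < key (p f) then (p e, p f) else (p f, p e)"], goal_cases)
      case (1 a)
      then show ?case using permutes_inverses[OF p] by (auto simp: Prs_def)
    next
      case (2 a)
      obtain e f where a: "a = (e, f)" by force
      have "e \<noteq> f" "e \<in> S" "f \<in> S" using 2 a by (auto simp: Prs_def)
      then have "key (p e) \<noteq> key (p f)" using pS pinj inj by (meson inj_onD)
      then show ?case using 2 a pS by (auto simp: Prs_def)
    next
      case (3 b)
      then show ?case using permutes_inverses[OF p] by (auto simp: Prs_def)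
    next
      case (4 b)
      obtain e f where b: "b = (e, f)" by force
      have ip: "inv p permutes S" using p by (rule permutes_inv)
      have "inv p e \<in> S" "inv p f \<in> S" using 4 b ip by (auto simp: Prs_def permutes_in_image)
      moreover have "inv p e \<noteq> inv p f" using 4 b permutes_inj[OF ip] by (auto simp: Prs_def dest: injD)
      ultimately have "key (inv p e) \<noteq> key (inv p f)" using inj by (auto simp: inj_on_def)
      then show ?case using 4 b \<open>inv p e \<in> S\<close> \<open>inv p f \<in> S\<close> by (auto simp: Prs_def)
    next
      case (5 a)
      obtain e f where a: "a = (e, f)" by force
      have "e \<noteq> f" "e \<in> S" "f \<in> S" using 5 a by (auto simp: Prs_def)
      moreover have "q (p e) \<noteq> q (p f)" using \<open>e \<noteq> f\<close> pinj permutes_inj[OF q] by (auto dest: injD)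
      ultimately show ?case
        using a anti[of "q (p e)" "q (p f)"] anti[of "p e" "p f"] pS[of e] pS[of f] q
        by (auto simp: s_def permutes_in_image)
    qed
    finally show ?thesis .
  qed
  have sp: "I (Transposition.transpose a b) = - 1" if ab: "a \<in> S" "b \<in> S" "key a < key b" for a b
  proof -
    let ?t = "Transposition.transpose a b"
    have ne: "a \<noteq> b" using ab by auto
    \<comment> \<open>The inversions of the transposition are (a, b) and, for every c strictly
      between, the two pairs (a, c) and (c, b): an odd number.\<close>
    have neg: "{(e, f)\<in>Prs. s (?t e) (?t f) = - 1} = insert (a, b) ((\<lambda>c. (a, c)) ` {c\<in>S. key a < key c \<and> key c < key b}
        \<union> (\<lambda>c. (c, b)) ` {c\<in>S. key a < key c \<and> key c < key b})" (is "?L = ?R")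
    proof (intro set_eqI iffI)
      fix x assume "x \<in> ?L"
      then obtain e f where x: "x = (e, f)" "e \<in> S" "f \<in> S" "key e < key f" "\<not> key (?t e) < key (?t f)"
        by (auto simp: Prs_def s_def split: if_splits)
      moreover have "key e = key a \<longleftrightarrow> e = a" "key e = key b \<longleftrightarrow> e = b" "key f = key a \<longleftrightarrow> f = a" "key f = key b \<longleftrightarrow> f = b"
        using x ab inj by (auto simp: inj_on_def)
      ultimately show "x \<in> ?R"
        using ab by (auto simp: transpose_def image_iff split: if_splits)
    next
      fix x assume "x \<in> ?R"
      moreover have "?t c = c" if "key a < key c" "key c < key b" for c
        using that by (intro transpose_apply_other) auto
      ultimately show "x \<in> ?L" using ab by (auto simp: Prs_def s_def)
    qed
    let ?C = "{c\<in>S. key a < key c \<and> key c < key b}"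
    have "I ?t = (\<Prod>x\<in>{x\<in>Prs. (case x of (e, f) \<Rightarrow> s (?t e) (?t f) = - 1)}. - 1)"
      unfolding I_def by (subst prod.inter_filter[OF fin]) (auto intro!: prod.cong simp: s_def)
    also have "{x\<in>Prs. (case x of (e, f) \<Rightarrow> s (?t e) (?t f) = - 1)} = insert (a, b) ((\<lambda>c. (a, c)) ` ?C \<union> (\<lambda>c. (c, b)) ` ?C)"
      using neg by auto
    also have "(\<Prod>x\<in>\<dots>. - 1 :: int) = - 1"
    proof -
      have c: "card ((\<lambda>c. (a, c)) ` ?C \<union> (\<lambda>c. (c, b)) ` ?C) = card ?C + card ?C"
        using S by (subst card_Un_disjoint) (auto simp: card_image inj_on_def)
      have "(a, b) \<notin> (\<lambda>c. (a, c)) ` ?C \<union> (\<lambda>c. (c, b)) ` ?C" by auto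
      then show ?thesis using S c by (simp add: power_add[symmetric] mult_2[symmetric] del: power_add)
    qed
    finally show ?thesis .
  qed
  have comm: "I (Transposition.transpose a b) = - 1" if "a \<in> S" "b \<in> S" "a \<noteq> b" for a b
  proof -
    have "key a < key b \<or> key b < key a" using that inj by (meson inj_onD linorder_neqE)
    then show ?thesis using sp[of a b] sp[of b a] that by (auto simp: transpose_commute)
  qed
  have "sign p = I p"
    using \<open>p permutes S\<close> S
  proof (induction p rule: permutes_induct)
    case id
    have "I id = 1" unfolding I_def by (rule prod.neutral) (auto simp: Prs_def s_def)
    then show ?case by (simp add: id_def)
  next
    case (swap a b p)
    have "sign (Transposition.transpose a b \<circ> p) = - sign p"
      using swap S by (subst sign_compose)
        (auto simp: sign_swap_id permutes_imp_permutation permutation_swap_id)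
    also have "\<dots> = I (Transposition.transpose a b \<circ> p)"
      using swap mult[of p "Transposition.transpose a b"] comm[of a b] by (simp add: permutes_swap_id)
    finally show ?case .
  qed
  then show ?thesis by (simp add: I_def s_def Prs_def)
qed

section \<open>Lines on the torus and the expansion of the determinant\<close>

lemma prod_sign_eq_power:
  "finite A \<Longrightarrow> (\<Prod>x\<in>A. if P x then - 1 else 1 :: int) = (- 1) ^ card {x\<in>A. P x}"
  by (simp add: prod.If_cases Int_def)

lemma of_bool_sum_eqI:
  assumes "a \<and> b \<longrightarrow> c \<and> d" "c \<and> d \<longrightarrow> a \<and> b" "a \<or> b \<longrightarrow> c \<or> d" "c \<or> d \<longrightarrow> a \<or> b"
  shows "of_bool a + of_bool b = (of_bool c + of_bool d :: nat)"
proof -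
  have "a = c \<and> b = d \<or> a = d \<and> b = c" using assms by blast
  then show ?thesis by (elim disjE conjE) simp_all
qed

text \<open>With n = 1 a step would lead back to the same vertex. For n >= 2 a step always changes
  the vertex (\<open>outE_ne\<close>), so the support of a path permutation is exactly the set of
  occupied edges.\<close>

locale torus =
  fixes n :: nat
  assumes n2: "2 \<le> n"
begin

definition V :: "(int \<times> int) set" where "V = {0..<int n} \<times> {0..<int n}"

text \<open>The edge (x, s) leaves x to the right (s true) or upwards (s false). Lines run left and
  down, so (x, True) and (x, False) are the edges by which a line enters x, and
  \<open>outE x True\<close>, \<open>outE x False\<close> those by which it leaves.\<close>

definition E :: "((int \<times> int) \<times> bool) set" where "E = V \<times> UNIV"

definition outE :: "int \<times> int \<Rightarrow> bool \<Rightarrow> (int \<times> int) \<times> bool" where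
  "outE x s = ((if s then ((fst x - 1) mod int n, snd x) else (fst x, (snd x - 1) mod int n)), s)"

definition Kmat :: "(int \<times> int \<Rightarrow> bool \<Rightarrow> bool \<Rightarrow> complex) \<Rightarrow> (int \<times> int) \<times> bool \<Rightarrow> (int \<times> int) \<times> bool \<Rightarrow> complex" where
  "Kmat k e f = (if f = outE (fst e) (snd f) then k (fst e) (snd e) (snd f) else 0)"

definition lines :: "((int \<times> int) \<times> bool) set \<Rightarrow> bool" where
  "lines S \<longleftrightarrow> S \<subseteq> E \<and> (\<forall>x\<in>V. of_bool ((x, True) \<in> S) + of_bool ((x, False) \<in> S)
      = (of_bool (outE x True \<in> S) + of_bool (outE x False \<in> S) :: nat))"

text \<open>At a doubly occupied vertex the two paths may either both turn or cross. The crossing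
  term enters with a minus sign, and for the weights at hand the difference is gamma^2 - alpha beta,
  the weight of type 2.\<close>

definition wl :: "(int \<times> int \<Rightarrow> bool \<Rightarrow> bool \<Rightarrow> complex) \<Rightarrow> int \<times> int \<Rightarrow> ((int \<times> int) \<times> bool) set \<Rightarrow> complex" where
  "wl k x S =
     (if (x, True) \<in> S \<and> (x, False) \<in> S then k x True False * k x False True - k x True True * k x False False
      else if (x, True) \<in> S then k x True (outE x True \<in> S)
      else if (x, False) \<in> S then k x False (outE x True \<in> S) else 1)"

definition Pn :: "((int \<times> int) \<times> bool) set \<Rightarrow> nat" where
  "Pn S = card {j \<in> {0..<int n}. ((int n - 1, j), True) \<in> S}"

definition Qn :: "((int \<times> int) \<times> bool) set \<Rightarrow> nat" where
  "Qn S = card {i \<in> {0..<int n}. ((i, int n - 1), False) \<in> S}"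

text \<open>Antidiagonals. Every step, left or down, lowers the level by one modulo n, so the path
  permutation shifts this grading cyclically.\<close>

definition level :: "(int \<times> int) \<times> bool \<Rightarrow> int" where
  "level e = (fst (fst e) + snd (fst e)) mod int n"

definition doubles :: "((int \<times> int) \<times> bool) set \<Rightarrow> (int \<times> int) set" where
  "doubles S = {x\<in>V. (x, True) \<in> S \<and> (x, False) \<in> S}"

text \<open>\<open>C\<close> collects the doubly occupied vertices at which the two paths cross by
  going straight; at the others they turn. At a simply occupied vertex the one outgoing line edge
  decides.\<close>

definition dir :: "((int \<times> int) \<times> bool) set \<Rightarrow> (int \<times> int) set \<Rightarrow> (int \<times> int) \<times> bool \<Rightarrow> bool" where
  "dir S C e = (if fst e \<in> doubles S then (snd e \<longleftrightarrow> fst e \<in> C) else outE (fst e) True \<in> S)"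

definition perm :: "((int \<times> int) \<times> bool) set \<Rightarrow> (int \<times> int) set \<Rightarrow> (int \<times> int) \<times> bool \<Rightarrow> (int \<times> int) \<times> bool" where
  "perm S C e = (if e \<in> S then outE (fst e) (dir S C e) else e)"

lemma finite_V [simp]: "finite V" and finite_E [simp]: "finite E"
  by (simp_all add: V_def E_def)

lemma outE_in_E [simp]: "x \<in> V \<Longrightarrow> outE x s \<in> E"
  using n2 by (auto simp: V_def E_def outE_def)

lemma snd_outE [simp]: "snd (outE x s) = s"
  by (simp add: outE_def)

lemma mod_pred: "0 \<le> i \<Longrightarrow> i < int n \<Longrightarrow> (i - 1) mod int n = (if i = 0 then int n - 1 else i - 1)"
  using n2 by (auto simp: zmod_minus1)

lemma outE_inj: "x \<in> V \<Longrightarrow> y \<in> V \<Longrightarrow> outE x s = outE y t \<longleftrightarrow> x = y \<and> s = t"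
  by (cases x; cases y) (auto simp: outE_def V_def mod_pred split: if_splits)

lemma outE_ne: "x \<in> V \<Longrightarrow> fst (outE x s) \<noteq> x"
  using n2 by (cases x) (auto simp: outE_def V_def mod_pred split: if_splits)

lemma bij_outE: "bij_betw (\<lambda>e. outE (fst e) (snd e)) E E"
proof -
  have "inj_on (\<lambda>e. outE (fst e) (snd e)) E"
    by (auto simp: inj_on_def outE_inj E_def)
  moreover have "(\<lambda>e. outE (fst e) (snd e)) ` E \<subseteq> E"
    by (intro image_subsetI outE_in_E) (auto simp: E_def)
  ultimately show ?thesis
    using endo_inj_surj[OF finite_E] by (auto simp: bij_betw_def)
qed

lemma outE_surj:
  assumes "f \<in> E"
  obtains x where "x \<in> V" "f = outE x (snd f)"
proof -
  have "f \<in> (\<lambda>e. outE (fst e) (snd e)) ` E" using bij_outE assms by (auto simp: bij_betw_def)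
  then obtain e where "e \<in> E" "f = outE (fst e) (snd e)" by blast
  then show ?thesis using that[of "fst e"] by (auto simp: E_def)
qed

lemma level_outE:
  "level (outE x s) = (fst x + snd x - 1) mod int n"
  by (cases s) (auto simp: level_def outE_def mod_simps algebra_simps)

lemma level_outE': "level (outE (fst e) s) = (if level e = 0 then int n - 1 else level e - 1)"
proof -
  have "level (outE (fst e) s) = (level e - 1) mod int n"
    unfolding level_outE by (simp add: level_def mod_simps)
  also have "0 \<le> level e \<and> level e < int n" using n2 by (simp add: level_def)
  then have "(level e - 1) mod int n = (if level e = 0 then int n - 1 else level e - 1)"
    by (simp add: mod_pred)
  finally show ?thesis .
qed

lemma level_outE'': "level (outE x s) = (if level (x, True) = 0 then int n - 1 else level (x, True) - 1)"
  using level_outE'[of "(x, True)" s] by simp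

lemma level_range: "0 \<le> level e" "level e < int n"
  using n2 by (simp_all add: level_def)

lemma linesD:
  assumes "lines S"
  shows "S \<subseteq> E" "finite S" "e \<in> S \<Longrightarrow> fst e \<in> V"
proof -
  show "S \<subseteq> E" using assms by (simp add: lines_def)
  then show "finite S" by (rule finite_subset) simp
  show "e \<in> S \<Longrightarrow> fst e \<in> V" using \<open>S \<subseteq> E\<close> by (auto simp: E_def)
qed

lemma lines_ice:
  assumes "lines S" "x \<in> V"
  shows "(x, True) \<in> S \<and> (x, False) \<in> S \<longleftrightarrow> outE x True \<in> S \<and> outE x False \<in> S"
    and "(x, True) \<in> S \<or> (x, False) \<in> S \<longleftrightarrow> outE x True \<in> S \<or> outE x False \<in> S"
proof -
  have "of_bool ((x, True) \<in> S) + of_bool ((x, False) \<in> S)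
      = (of_bool (outE x True \<in> S) + of_bool (outE x False \<in> S) :: nat)"
    using assms unfolding lines_def by blast
  then show "(x, True) \<in> S \<and> (x, False) \<in> S \<longleftrightarrow> outE x True \<in> S \<and> outE x False \<in> S"
    and "(x, True) \<in> S \<or> (x, False) \<in> S \<longleftrightarrow> outE x True \<in> S \<or> outE x False \<in> S"
    by (simp_all only: of_bool_def split: if_splits) simp_all
qed

lemma mem_split: "e \<in> S \<longleftrightarrow> (if snd e then (fst e, True) \<in> S else (fst e, False) \<in> S)"
  by (cases e) simp

lemma lines_double: "lines S \<Longrightarrow> x \<in> doubles S \<Longrightarrow> outE x s \<in> S"
  using lines_ice(1)[of S x] by (cases s) (auto simp: doubles_def)

lemma lines_simple:
  assumes "lines S" "e \<in> S" "fst e \<notin> doubles S"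
  shows "outE (fst e) s \<in> S \<longleftrightarrow> s = (outE (fst e) True \<in> S)"
proof -
  have "(fst e, True) \<in> S \<or> (fst e, False) \<in> S" using assms(2) mem_split[of e S] by (auto split: if_splits)
  moreover have "\<not> ((fst e, True) \<in> S \<and> (fst e, False) \<in> S)"
    using assms(3) linesD(3)[OF assms(1,2)] by (simp add: doubles_def)
  ultimately show ?thesis
    using lines_ice[OF assms(1) linesD(3)[OF assms(1,2)]] by (cases s) auto
qed

lemma perm_in:
  assumes S: "lines S" and e: "e \<in> S"
  shows "perm S C e \<in> S"
proof -
  have "fst e \<in> V" using S e by (auto simp: lines_def E_def)
  then show ?thesis
    using lines_double[OF S, of "fst e" "dir S C e"] lines_simple[OF S e, of "dir S C e"] e
    by (auto simp: perm_def dir_def)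
qed

lemma perm_inj:
  assumes S: "lines S" and e: "e \<in> S" "f \<in> S" "perm S C e = perm S C f"
  shows "e = f"
proof -
  have V: "fst e \<in> V" "fst f \<in> V" using S e by (auto simp: lines_def E_def)
  have x: "fst e = fst f" "dir S C e = dir S C f"
    using e V by (auto simp: perm_def outE_inj)
  show ?thesis
  proof (cases "fst e \<in> doubles S")
    case True
    then have "snd e = snd f" using x by (auto simp: dir_def)
    then show ?thesis using x by (simp add: prod_eq_iff)
  next
    case False
    show ?thesis
    proof (rule ccontr)
      assume "e \<noteq> f"
      then have "snd e \<noteq> snd f" using x by (simp add: prod_eq_iff)
      then have "(fst e, True) \<in> S \<and> (fst e, False) \<in> S"
        using e(1,2) x(1) mem_split[of e S] mem_split[of f S] by (cases "snd e"; simp)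
      then show False using False V by (simp add: doubles_def)
    qed
  qed
qed

lemma perm_permutes_S:
  assumes "lines S"
  shows "perm S C permutes S"
proof (rule inj_imp_permutes)
  show "finite S" by (rule linesD[OF assms])
  show "inj_on (perm S C) S" by (intro inj_onI) (rule perm_inj[OF assms])
  show "perm S C x \<in> S" if "x \<in> S" for x using assms that by (rule perm_in)
  show "perm S C x = x" if "x \<notin> S" for x using that by (simp add: perm_def)
qed

lemma perm_permutes: "lines S \<Longrightarrow> perm S C permutes E"
  by (rule permutes_subset[OF perm_permutes_S linesD(1)])

text \<open>Edges are sorted by antidiagonal, then by column, the vertical edge of a vertex before
  its horizontal one. Within a level a step takes position 2 i + [horizontal] to 2 i - [goes left],
  which preserves the order except for wrapping around the torus and for crossings.\<close>

definition key :: "(int \<times> int) \<times> bool \<Rightarrow> int" where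
  "key e = level e * (2 * int n) + 2 * fst (fst e) + of_bool (snd e)"

lemma key_less:
  assumes "e \<in> E" "f \<in> E"
  shows "key e < key f \<longleftrightarrow> level e < level f \<or>
    level e = level f \<and> 2 * fst (fst e) + of_bool (snd e) < 2 * fst (fst f) + (of_bool (snd f) :: int)"
proof -
  have pos: "0 \<le> 2 * fst (fst e) + of_bool (snd e)" "2 * fst (fst e) + of_bool (snd e) < 2 * int n"
    if "e \<in> E" for e using that by (auto simp: E_def V_def of_bool_def)
  have lt: "key e < key f" if "level e < level f" "e \<in> E" "f \<in> E" for e f
  proof -
    have "(level e + 1) * (2 * int n) \<le> level f * (2 * int n)"
      using that by (intro mult_right_mono) auto
    then show ?thesis using pos(1)[OF that(3)] pos(2)[OF that(2)] unfolding key_def by (simp add: algebra_simps)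
  qed
  show ?thesis
    using lt[of e f] lt[of f e] assms by (cases "level e" "level f" rule: linorder_cases) (auto simp: key_def)
qed

lemma same_level_column:
  assumes "e \<in> E" "f \<in> E" "level e = level f" "fst (fst e) = fst (fst f)"
  shows "fst e = fst f"
proof -
  have "snd (fst e) mod int n = snd (fst f) mod int n"
    using assms(3,4) by (simp add: level_def mod_add_left_eq) (metis add_diff_cancel_left' mod_diff_left_eq)
  then show ?thesis using assms by (auto simp: E_def V_def prod_eq_iff)
qed

lemma inj_key: "inj_on key E"
proof (rule inj_onI)
  fix e f assume ef: "e \<in> E" "f \<in> E" "key e = key f"
  then have l: "level e = level f"
    and p: "2 * fst (fst e) + of_bool (snd e) = 2 * fst (fst f) + (of_bool (snd f) :: int)"
    using key_less[of e f] key_less[of f e] by (auto simp: neq_iff)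
  have "fst (fst e) = fst (fst f) \<and> snd e = snd f"
    using p by (cases "snd e"; cases "snd f"; simp; presburger)
  then show "e = f" using same_level_column[OF ef(1,2) l] by (simp add: prod_eq_iff)
qed

section \<open>Conservation of lines through antidiagonals, columns and rows\<close>

definition lev_card :: "((int \<times> int) \<times> bool) set \<Rightarrow> int \<Rightarrow> nat" where
  "lev_card S d = card {e\<in>S. level e = d}"

definition col_card :: "((int \<times> int) \<times> bool) set \<Rightarrow> int \<Rightarrow> nat" where
  "col_card S i = card {e\<in>S. snd e \<and> fst (fst e) = i}"

definition row_card :: "((int \<times> int) \<times> bool) set \<Rightarrow> int \<Rightarrow> nat" where
  "row_card S j = card {e\<in>S. \<not> snd e \<and> snd (fst e) = j}"

lemma Pn_col: 
  assumes "lines S"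
  shows "Pn S = col_card S (int n - 1)"
  unfolding Pn_def col_card_def
  using linesD(1)[OF assms]
  by (intro bij_betw_same_card[of "\<lambda>j. ((int n - 1, j), True)"] bij_betwI[where g = "\<lambda>e. snd (fst e)"])
     (auto simp: E_def V_def)

lemma Qn_row: 
  assumes "lines S"
  shows "Qn S = row_card S (int n - 1)"
  unfolding Qn_def row_card_def
  using linesD(1)[OF assms]
  by (intro bij_betw_same_card[of "\<lambda>i. ((i, int n - 1), False)"] bij_betwI[where g = "\<lambda>e. fst (fst e)"])
     (auto simp: E_def V_def)

text \<open>The permutation carries the lines through a set of vertices from its incoming to its outgoing edges.\<close>

lemma card_flow:
  assumes S: "lines S"
  shows "card {e\<in>S. A (fst e)} = card {f\<in>S. \<exists>x\<in>V. A x \<and> f = outE x (snd f)}"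
proof (rule bij_betw_same_card)
  note p = perm_permutes_S[OF S, of "{}"]
  show "bij_betw (perm S {}) {e\<in>S. A (fst e)} {f\<in>S. \<exists>x\<in>V. A x \<and> f = outE x (snd f)}"
  proof (rule bij_betw_imageI)
    show "inj_on (perm S {}) {e \<in> S. A (fst e)}"
      using permutes_inj[OF p] by (rule inj_on_subset) simp
    have "perm S {} e \<in> {f\<in>S. \<exists>x\<in>V. A x \<and> f = outE x (snd f)}" if "e \<in> S" "A (fst e)" for e
      using that perm_in[OF S that(1)] linesD(3)[OF S that(1)] by (auto simp: perm_def)
    moreover have "f \<in> perm S {} ` {e\<in>S. A (fst e)}" if f: "f \<in> S" "x \<in> V" "A x" "f = outE x (snd f)" for f x
    proof -
      have "f \<in> perm S {} ` S" using permutes_image[OF p] f by simp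
      then obtain e where e: "e \<in> S" "f = perm S {} e" by auto
      then have "fst e = x" using f linesD(3)[OF S e(1)] by (metis outE_inj perm_def)
      then show ?thesis using e f by auto
    qed
    ultimately show "perm S {} ` {e \<in> S. A (fst e)} = {f\<in>S. \<exists>x\<in>V. A x \<and> f = outE x (snd f)}"
      by auto
  qed
qed

text \<open>Flow through the vertices of level d: they are entered by the edges of level d and left
  by those of level d - 1.\<close>

lemma lev_card_const:
  assumes S: "lines S" and d: "0 \<le> d" "d < int n"
  shows "lev_card S d = lev_card S 0"
proof -
  have step: "lev_card S d = lev_card S (d - 1)" if d: "0 < d" "d < int n" for d
  proof -
    have "{f\<in>S. \<exists>x\<in>V. level (x, True) = d \<and> f = outE x (snd f)} = {f\<in>S. level f = d - 1}" (is "?L = ?R")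
    proof (intro set_eqI iffI)
      fix f assume "f \<in> ?L"
      then obtain x where "f \<in> S" "level (x, True) = d" "f = outE x (snd f)" by auto
      then show "f \<in> ?R" using level_outE''[of x "snd f"] d by auto
    next
      fix f assume f: "f \<in> ?R"
      then obtain x where x: "x \<in> V" "f = outE x (snd f)" using linesD(1)[OF S] outE_surj[of f] by auto
      then have "level f = (if level (x, True) = 0 then int n - 1 else level (x, True) - 1)"
        using level_outE''[of x "snd f"] by simp
      then have "level (x, True) = d" using f d by (auto split: if_splits)
      then show "f \<in> ?L" using f x by auto
    qed
    moreover have "{e\<in>S. level e = d} = {e\<in>S. level (fst e, True) = d}" by (simp add: level_def)
    ultimately show ?thesis using card_flow[OF S, of "\<lambda>x. level (x, True) = d"] by (simp add: lev_card_def)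
  qed
  show ?thesis using d
  proof (induction "nat d" arbitrary: d)
    case (Suc m)
    then show ?case using step[of d] by simp
  qed simp
qed

text \<open>Flow through the vertices of column i: the vertical edges of the column occur both among
  the entering and among the leaving ones, so the horizontal edges on its two sides are equally
  many.\<close>

lemma col_card_const:
  assumes S: "lines S" and i: "0 \<le> i" "i < int n"
  shows "col_card S i = Pn S"
proof -
  note SE = linesD(1)[OF S] note fin = linesD(2)[OF S]
  have step: "col_card S i = col_card S (i - 1)" if i: "0 < i" "i < int n" for i
  proof -
    have "{f\<in>S. \<exists>x\<in>V. fst x = i \<and> f = outE x (snd f)}
        = {f\<in>S. snd f \<and> fst (fst f) = i - 1} \<union> {f\<in>S. \<not> snd f \<and> fst (fst f) = i}" (is "?L = ?R")
    proof (intro set_eqI iffI)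
      fix f assume "f \<in> ?L"
      then obtain x where "f \<in> S" "fst x = i" "f = outE x (snd f)" by auto
      then show "f \<in> ?R" using i mod_pred[of i] by (cases "snd f") (auto simp: outE_def)
    next
      fix f assume f: "f \<in> ?R"
      then obtain x where x: "x \<in> V" "f = outE x (snd f)" using SE outE_surj[of f] by auto
      have "fst (fst f) = (if snd f then (fst x - 1) mod int n else fst x)"
        by (subst x(2)) (simp add: outE_def)
      then have "fst x = i" using f i x(1) mod_pred[of "fst x"] by (auto simp: V_def split: if_splits)
      then show "f \<in> ?L" using f x by auto
    qed
    then have "card {e\<in>S. fst (fst e) = i}
        = card ({f\<in>S. snd f \<and> fst (fst f) = i - 1} \<union> {f\<in>S. \<not> snd f \<and> fst (fst f) = i})"
      using card_flow[OF S, of "\<lambda>x. fst x = i"] by simp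
    also have "{e\<in>S. fst (fst e) = i} = {f\<in>S. snd f \<and> fst (fst f) = i} \<union> {f\<in>S. \<not> snd f \<and> fst (fst f) = i}"
      by auto
    finally show ?thesis
      using fin by (subst (asm) (1 2) card_Un_disjoint) (auto simp: col_card_def)
  qed
  have "col_card S i = col_card S 0" if "0 \<le> i" "i < int n" for i using that
  proof (induction "nat i" arbitrary: i)
    case (Suc m)
    then show ?case using step[of i] by simp
  qed simp
  from this[of i] this[of "int n - 1"] show ?thesis using i n2 Pn_col[OF S] by simp
qed

lemma row_card_const:
  assumes S: "lines S" and j: "0 \<le> j" "j < int n"
  shows "row_card S j = Qn S"
proof -
  note SE = linesD(1)[OF S] note fin = linesD(2)[OF S]
  have step: "row_card S j = row_card S (j - 1)" if j: "0 < j" "j < int n" for j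
  proof -
    have "{f\<in>S. \<exists>x\<in>V. snd x = j \<and> f = outE x (snd f)}
        = {f\<in>S. \<not> snd f \<and> snd (fst f) = j - 1} \<union> {f\<in>S. snd f \<and> snd (fst f) = j}" (is "?L = ?R")
    proof (intro set_eqI iffI)
      fix f assume "f \<in> ?L"
      then obtain x where "f \<in> S" "snd x = j" "f = outE x (snd f)" by auto
      then show "f \<in> ?R" using j mod_pred[of j] by (cases "snd f") (auto simp: outE_def)
    next
      fix f assume f: "f \<in> ?R"
      then obtain x where x: "x \<in> V" "f = outE x (snd f)" using SE outE_surj[of f] by auto
      have "snd (fst f) = (if snd f then snd x else (snd x - 1) mod int n)"
        by (subst x(2)) (simp add: outE_def)
      then have "snd x = j" using f j x(1) mod_pred[of "snd x"] by (auto simp: V_def split: if_splits)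
      then show "f \<in> ?L" using f x by auto
    qed
    then have "card {e\<in>S. snd (fst e) = j}
        = card ({f\<in>S. \<not> snd f \<and> snd (fst f) = j - 1} \<union> {f\<in>S. snd f \<and> snd (fst f) = j})"
      using card_flow[OF S, of "\<lambda>x. snd x = j"] by simp
    also have "{e\<in>S. snd (fst e) = j} = {f\<in>S. \<not> snd f \<and> snd (fst f) = j} \<union> {f\<in>S. snd f \<and> snd (fst f) = j}"
      by auto
    finally show ?thesis
      using fin by (subst (asm) (1 2) card_Un_disjoint) (auto simp: row_card_def)
  qed
  have "row_card S j = row_card S 0" if "0 \<le> j" "j < int n" for j using that
  proof (induction "nat j" arbitrary: j)
    case (Suc m)
    then show ?case using step[of j] by simp
  qed simp
  from this[of j] this[of "int n - 1"] show ?thesis using j n2 Qn_row[OF S] by simp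
qed

lemma card_eq_sum_fibres:
  assumes "finite S" "\<And>e. e \<in> S \<Longrightarrow> 0 \<le> g e \<and> g e < int n"
  shows "card S = (\<Sum>d\<in>{0..<int n}. card {e\<in>S. g e = d})"
  using sum.group[of S "{0..<int n}" g "\<lambda>_. 1 :: nat"] assms by (auto simp: image_subset_iff)

lemma card_horizontal: 
  assumes S: "lines S"
  shows "card {e\<in>S. snd e} = n * Pn S"
proof -
  have "card {e\<in>S. snd e} = (\<Sum>d\<in>{0..<int n}. card {e\<in>{e\<in>S. snd e}. fst (fst e) = d})"
    using linesD(2,3)[OF S] by (intro card_eq_sum_fibres) (auto simp: V_def)
  also have "\<dots> = (\<Sum>d\<in>{0..<int n}. Pn S)"
    using col_card_const[OF S] by (intro sum.cong refl) (simp add: col_card_def conj_assoc)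
  finally show ?thesis by simp
qed

lemma card_vertical:
  assumes S: "lines S"
  shows "card {e\<in>S. \<not> snd e} = n * Qn S"
proof -
  have "card {e\<in>S. \<not> snd e} = (\<Sum>d\<in>{0..<int n}. card {e\<in>{e\<in>S. \<not> snd e}. snd (fst e) = d})"
    using linesD(2,3)[OF S] by (intro card_eq_sum_fibres) (auto simp: V_def)
  also have "\<dots> = (\<Sum>d\<in>{0..<int n}. Qn S)"
    using row_card_const[OF S] by (intro sum.cong refl) (simp add: row_card_def conj_assoc)
  finally show ?thesis by simp
qed

lemma card_lines:
  assumes S: "lines S"
  shows "card S = n * (Pn S + Qn S)"
proof -
  have "S = {e\<in>S. snd e} \<union> {e\<in>S. \<not> snd e}" by auto
  then have "card S = card {e\<in>S. snd e} + card {e\<in>S. \<not> snd e}"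
    using linesD(2)[OF S] by (metis (no_types, lifting) card_Un_disjoint disjoint_iff finite_Un mem_Collect_eq)
  then show ?thesis by (simp add: card_horizontal card_vertical S algebra_simps)
qed

text \<open>The columns contain n P horizontal and the rows n Q vertical edges altogether, and the n
  levels share these n (P + Q) edges equally.\<close>

lemma lev_card_eq:
  assumes S: "lines S" and d: "0 \<le> d" "d < int n"
  shows "lev_card S d = Pn S + Qn S"
proof -
  have "card S = (\<Sum>d\<in>{0..<int n}. lev_card S d)"
    unfolding lev_card_def using linesD(2)[OF S] level_range by (intro card_eq_sum_fibres) auto
  also have "\<dots> = (\<Sum>d\<in>{0..<int n}. lev_card S 0)"
    by (intro sum.cong refl lev_card_const[OF S]) auto
  finally have "n * (Pn S + Qn S) = n * lev_card S 0" using card_lines[OF S] by simp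
  then show ?thesis using n2 lev_card_const[OF S d] by simp
qed

section \<open>Sign of the path permutation by counting inversions\<close>

definition wraps :: "((int \<times> int) \<times> bool) set \<Rightarrow> (int \<times> int) set \<Rightarrow> (int \<times> int) \<times> bool \<Rightarrow> bool" where
  "wraps S C e \<longleftrightarrow> dir S C e \<and> fst (fst e) = 0"

text \<open>The permutation maps the wrapping edges bijectively onto the occupied horizontal edges
  of column n - 1. The count therefore does not depend on \<open>C\<close>.\<close>

lemma card_wraps:
  assumes S: "lines S"
  shows "card {e\<in>S. wraps S C e} = Pn S"
proof -
  have iff: "wraps S C e \<longleftrightarrow> snd (perm S C e) \<and> fst (fst (perm S C e)) = int n - 1" if "e \<in> S" for e
    using linesD(3)[OF S that] mod_pred[of "fst (fst e)"] that
    by (auto simp: wraps_def perm_def outE_def V_def split: if_splits)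
  have "bij_betw (perm S C) {e\<in>S. wraps S C e} {f\<in>S. snd f \<and> fst (fst f) = int n - 1}"
  proof (rule bij_betw_imageI)
    show "inj_on (perm S C) {e\<in>S. wraps S C e}"
      using permutes_inj[OF perm_permutes_S[OF S]] by (rule inj_on_subset) simp
    show "perm S C ` {e\<in>S. wraps S C e} = {f\<in>S. snd f \<and> fst (fst f) = int n - 1}"
    proof (intro equalityI subsetI)
      fix f assume "f \<in> perm S C ` {e\<in>S. wraps S C e}"
      then show "f \<in> {f\<in>S. snd f \<and> fst (fst f) = int n - 1}" using iff perm_in[OF S] by auto
    next
      fix f assume f: "f \<in> {f\<in>S. snd f \<and> fst (fst f) = int n - 1}"
      then have "f \<in> perm S C ` S" using permutes_image[OF perm_permutes_S[OF S, of C]] by simp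
      then obtain e where "e \<in> S" "f = perm S C e" by auto
      then show "f \<in> perm S C ` {e\<in>S. wraps S C e}" using iff[of e] f by auto
    qed
  qed
  from bij_betw_same_card[OF this] show ?thesis by (simp add: Pn_col[OF S] col_card_def)
qed

text \<open>One factor for each cause of an inversion: passing from level 0 to level n - 1, passing
  from column 0 to column n - 1 within a level, and crossing. The wrap factor of the larger edge f
  is active only when e and f share a vertex of column 0; there a crossing sends f around the torus,
  which undoes the inversion of the crossing.\<close>

lemma key_perm_less:
  assumes S: "lines S" and e: "e \<in> S" and f: "f \<in> S" and less: "key e < key f" and C: "C \<subseteq> doubles S"
  shows "(if key (perm S C e) < key (perm S C f) then 1 else - 1 :: int)
    = (if level e = 0 \<and> level f \<noteq> 0 then - 1 else 1)
      * ((if level e = level f \<and> wraps S C e then - 1 else 1) * (if level e = level f \<and> wraps S C f then - 1 else 1))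
      * (if fst e = fst f \<and> fst e \<in> C then - 1 else 1)"
proof -
  have E: "e \<in> E" "f \<in> E" "perm S C e \<in> E" "perm S C f \<in> E"
    using linesD(1)[OF S] e f perm_in[OF S e, of C] perm_in[OF S f, of C] by auto
  have lev: "level (perm S C e) = (if level e = 0 then int n - 1 else level e - 1)"
    "level (perm S C f) = (if level f = 0 then int n - 1 else level f - 1)"
    using e f by (simp_all add: perm_def level_outE')
  show ?thesis
  proof (cases "level e = level f")
    case False
    then have "level e < level f" using less key_less[OF E(1,2)] by auto
    moreover have "fst e \<noteq> fst f" using False by (auto simp: level_def)
    moreover have "level f < int n" "0 \<le> level e" by (rule level_range)+
    ultimately show ?thesis using False key_less[OF E(3,4)] lev by (auto simp: if_split)
  next
    case True
    define i j where "i = fst (fst e)" and "j = fst (fst f)"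
    have ij: "0 \<le> i" "i < int n" "0 \<le> j" "j < int n"
      using E by (auto simp: E_def V_def i_def j_def)
    have pos: "2 * i + of_bool (snd e) < 2 * j + (of_bool (snd f) :: int)"
      using less key_less[OF E(1,2)] True by (simp add: i_def j_def)
    have pe: "2 * fst (fst (perm S C e)) + of_bool (snd (perm S C e))
        = 2 * i - of_bool (dir S C e) + 2 * int n * (of_bool (wraps S C e) :: int)"
      using e ij mod_pred[of i] by (auto simp: perm_def outE_def wraps_def i_def)
    have pf: "2 * fst (fst (perm S C f)) + of_bool (snd (perm S C f))
        = 2 * j - of_bool (dir S C f) + 2 * int n * (of_bool (wraps S C f) :: int)"
      using f ij mod_pred[of j] by (auto simp: perm_def outE_def wraps_def j_def)
    have "key (perm S C e) < key (perm S C f) \<longleftrightarrow>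
       2 * i - of_bool (dir S C e) + 2 * int n * (of_bool (wraps S C e) :: int)
       < 2 * j - of_bool (dir S C f) + 2 * int n * of_bool (wraps S C f)"
      using key_less[OF E(3,4)] lev True pe pf by simp
    moreover have "level e = 0 \<and> level f \<noteq> 0 \<longleftrightarrow> False" using True by simp
    moreover consider (column) "i = j" "\<not> snd e" "snd f" | (left) "i < j"
      using pos by (cases "snd e"; cases "snd f"; force simp: order_le_less)
    then have "(if 2 * i - of_bool (dir S C e) + 2 * int n * (of_bool (wraps S C e) :: int)
       < 2 * j - of_bool (dir S C f) + 2 * int n * of_bool (wraps S C f) then 1 else - 1 :: int)
       = (if wraps S C e then - 1 else 1) * (if wraps S C f then - 1 else 1) * (if fst e = fst f \<and> fst e \<in> C then - 1 else 1)"
    proof cases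
      case column
      have x: "fst e = fst f" using same_level_column[OF E(1,2) True] column by (simp add: i_def j_def)
      have "fst e \<in> doubles S"
        using e f x column linesD(3)[OF S e] mem_split[of e S] mem_split[of f S] by (simp add: doubles_def)
      then have d: "dir S C e \<longleftrightarrow> fst e \<notin> C" "dir S C f \<longleftrightarrow> fst e \<in> C"
        using column x by (auto simp: dir_def)
      show ?thesis using column x d ij n2 by (auto simp: wraps_def i_def j_def)
    next
      case left
      have "fst e \<noteq> fst f" using left by (auto simp: i_def j_def)
      moreover have "\<not> wraps S C f" using left ij by (auto simp: wraps_def j_def)
      moreover have "2 * i - of_bool (dir S C e) < 2 * j - (of_bool (dir S C f) :: int)"
        using left by (cases "dir S C e"; cases "dir S C f") auto
      moreover have "i = 0 \<and> dir S C e" if "wraps S C e" using that by (auto simp: wraps_def i_def)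
      moreover have "\<not> 2 * i - of_bool (dir S C e) + 2 * int n < 2 * j - (of_bool (dir S C f) :: int)"
        if "i = 0" "dir S C e" using that ij by (simp add: of_bool_def)
      ultimately show ?thesis by (cases "wraps S C e") simp_all
    qed
    ultimately show ?thesis using True by simp
  qed
qed

text \<open>Each level carries N = P + Q edges. The passage from level 0 gives N (|S| - N)
  inversions, the wrapping in the columns has the parity of P (N - 1), and each crossing adds
  one.\<close>

lemma sign_perm:
  assumes S: "lines S" and C: "C \<subseteq> doubles S"
  shows "sign (perm S C) = (- 1) ^ ((Pn S + Qn S) * (card S - (Pn S + Qn S)) + Pn S * (Pn S + Qn S - 1) + card C)"
proof -
  let ?N = "Pn S + Qn S"
  note fin = linesD(2)[OF S]
  define Prs where "Prs = {(e, f). e \<in> S \<and> f \<in> S \<and> key e < key f}"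
  have fP: "finite Prs" by (rule finite_subset[of _ "S \<times> S"]) (auto simp: Prs_def fin)
  have injS: "inj_on key S" using inj_key linesD(1)[OF S] by (rule inj_on_subset)
  have "sign (perm S C) = (\<Prod>(e, f)\<in>Prs. if key (perm S C e) < key (perm S C f) then 1 else - 1)"
    unfolding Prs_def by (rule sign_eq_prod_inversions[OF fin injS perm_permutes_S[OF S]])
  also have "\<dots> = (\<Prod>(e, f)\<in>Prs. (if level e = 0 \<and> level f \<noteq> 0 then - 1 else 1)
      * ((if level e = level f \<and> wraps S C e then - 1 else 1) * (if level e = level f \<and> wraps S C f then - 1 else 1))
      * (if fst e = fst f \<and> fst e \<in> C then - 1 else 1))"
    by (intro prod.cong refl) (auto simp: Prs_def key_perm_less[OF S _ _ _ C])
  also have "\<dots> = (\<Prod>(e, f)\<in>Prs. if level e = 0 \<and> level f \<noteq> 0 then - 1 else 1)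
      * (\<Prod>(e, f)\<in>Prs. (if level e = level f \<and> wraps S C e then - 1 else 1) * (if level e = level f \<and> wraps S C f then - 1 else 1))
      * (\<Prod>(e, f)\<in>Prs. if fst e = fst f \<and> fst e \<in> C then - 1 else 1)"
    by (simp only: case_prod_unfold prod.distrib)
  also have "(\<Prod>(e, f)\<in>Prs. if level e = 0 \<and> level f \<noteq> 0 then - 1 else 1 :: int) = (- 1) ^ (?N * (card S - ?N))"
  proof -
    have "{x\<in>Prs. case x of (e, f) \<Rightarrow> level e = 0 \<and> level f \<noteq> 0} = {e\<in>S. level e = 0} \<times> (S - {e\<in>S. level e = 0})"
    proof -
      have "key e < key f" if "e \<in> S" "f \<in> S" "level e = 0" "level f \<noteq> 0" for e f
        using that key_less[of e f] linesD(1)[OF S] level_range(1)[of f] by auto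
      then show ?thesis by (auto simp: Prs_def)
    qed
    moreover have "card {e\<in>S. level e = 0} = ?N" using lev_card_eq[OF S, of 0] n2 by (simp add: lev_card_def)
    ultimately have "card {x\<in>Prs. case x of (e, f) \<Rightarrow> level e = 0 \<and> level f \<noteq> 0} = ?N * (card S - ?N)"
      using fin by (simp add: card_cartesian_product card_Diff_subset)
    then show ?thesis
      using prod_sign_eq_power[OF fP, of "\<lambda>x. case x of (e, f) \<Rightarrow> level e = 0 \<and> level f \<noteq> 0"]
      by (simp add: case_prod_unfold)
  qed
  also have "(\<Prod>(e, f)\<in>Prs. (if level e = level f \<and> wraps S C e then - 1 else 1) * (if level e = level f \<and> wraps S C f then - 1 else 1 :: int))
      = (- 1) ^ (Pn S * (?N - 1))"
  proof -
    \<comment> \<open>The two wrap factors of a pair e < f combine to one factor for each ordered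
      pair of distinct edges; a wrapping edge then meets the N - 1 other edges of its level.\<close>
    define b where "b = (\<lambda>e f. if level e = level f \<and> wraps S C e then - 1 else 1 :: int)"
    have "(\<Prod>(e, f)\<in>Prs. b e f * b f e) = (\<Prod>(e, f)\<in>Prs. b e f) * (\<Prod>(e, f)\<in>Prs. b f e)"
      by (simp add: case_prod_unfold prod.distrib)
    also have "(\<Prod>(e, f)\<in>Prs. b f e) = (\<Prod>(e, f)\<in>prod.swap ` Prs. b e f)"
      by (subst prod.reindex) (auto simp: case_prod_unfold inj_on_def)
    also have "(\<Prod>(e, f)\<in>Prs. b e f) * \<dots> = (\<Prod>(e, f)\<in>Prs \<union> prod.swap ` Prs. b e f)"
      using fP by (subst prod.union_disjoint) (auto simp: Prs_def)
    also have "Prs \<union> prod.swap ` Prs = (SIGMA e:S. S - {e})"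
    proof -
      have "key e < key f \<or> key f < key e" if "e \<in> S" "f \<in> S" "e \<noteq> f" for e f
        using that injS by (meson inj_onD linorder_neqE)
      then have "(e, f) \<in> Prs \<or> (f, e) \<in> Prs \<longleftrightarrow> e \<in> S \<and> f \<in> S \<and> f \<noteq> e" for e f
        unfolding Prs_def by blast
      moreover have "(e, f) \<in> prod.swap ` Prs \<longleftrightarrow> (f, e) \<in> Prs" for e f by (force simp: image_iff)
      ultimately show ?thesis by (intro set_eqI) (simp add: split_paired_all)
    qed
    also have "(\<Prod>(e, f)\<in>\<dots>. b e f) = (\<Prod>e\<in>S. \<Prod>f\<in>S - {e}. b e f)"
      using fin by (subst prod.Sigma) auto
    also have "\<dots> = (\<Prod>e\<in>S. if wraps S C e then (- 1) ^ (?N - 1) else 1)"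
    proof (intro prod.cong refl)
      fix e assume e: "e \<in> S"
      have "card {f\<in>S - {e}. level e = level f} = card ({f\<in>S. level f = level e} - {e})"
        by (rule arg_cong[of _ _ card]) auto
      also have "\<dots> = ?N - 1"
        using e lev_card_eq[OF S level_range, of e] by (simp add: lev_card_def)
      finally have c: "card {f\<in>S - {e}. level e = level f} = ?N - 1" .
      show "(\<Prod>f\<in>S - {e}. b e f) = (if wraps S C e then (- 1) ^ (?N - 1) else 1)"
        using prod_sign_eq_power[of "S - {e}" "\<lambda>f. level e = level f"] c fin by (simp add: b_def)
    qed
    also have "\<dots> = ((- 1) ^ (?N - 1)) ^ card {e\<in>S. wraps S C e}"
      using fin by (simp add: prod.If_cases Int_def)
    also have "\<dots> = (- 1) ^ (Pn S * (?N - 1))"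
      by (simp only: card_wraps[OF S] power_mult[symmetric] mult.commute)
    finally have "(\<Prod>(e, f)\<in>Prs. b e f * b f e) = (- 1) ^ (Pn S * (?N - 1))" .
    then show ?thesis unfolding b_def by (simp only: eq_commute)
  qed
  also have "(\<Prod>(e, f)\<in>Prs. if fst e = fst f \<and> fst e \<in> C then - 1 else 1 :: int) = (- 1) ^ card C"
  proof -
    have "{x\<in>Prs. case x of (e, f) \<Rightarrow> fst e = fst f \<and> fst e \<in> C} = (\<lambda>x. ((x, False), (x, True))) ` C"
    proof -
      have k: "key (x, s) < key (x, t) \<longleftrightarrow> \<not> s \<and> t" for x s t
        by (cases s; cases t) (simp_all add: key_def level_def)
      have "((x, s), (x, t)) \<in> Prs \<longleftrightarrow> \<not> s \<and> t" if "x \<in> C" for x s t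
        using C that by (cases s; cases t) (auto simp: Prs_def k doubles_def)
      then show ?thesis by (fastforce simp: image_iff)
    qed
    then have "card {x\<in>Prs. case x of (e, f) \<Rightarrow> fst e = fst f \<and> fst e \<in> C} = card C"
      by (simp add: card_image inj_on_def)
    then show ?thesis
      using prod_sign_eq_power[OF fP, of "\<lambda>x. case x of (e, f) \<Rightarrow> fst e = fst f \<and> fst e \<in> C"]
      by (simp add: case_prod_unfold)
  qed
  finally show ?thesis by (simp add: power_add)
qed

definition line_sign :: "((int \<times> int) \<times> bool) set \<Rightarrow> int" where
  "line_sign S = (- 1) ^ (Pn S + Qn S + Pn S * Qn S)"

text \<open>With |S| = n N the parity of n cancels: n N + N (n N - N) + P (N - 1) is congruent to P
  + Q + P Q modulo 2. The factor (-1)^|S| is the one produced by the entries of -K.\<close>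

lemma sign_perm': 
  assumes S: "lines S" and C: "C \<subseteq> doubles S"
  shows "(- 1) ^ card S * sign (perm S C) = line_sign S * (- 1) ^ card C"
proof -
  obtain m where m: "n = Suc m" using n2 by (cases n) auto
  have "(- 1 :: int) ^ (n * (Pn S + Qn S)) * (- 1) ^ ((Pn S + Qn S) * (n * (Pn S + Qn S) - (Pn S + Qn S)) + Pn S * (Pn S + Qn S - 1))
    = (- 1) ^ (Pn S + Qn S + Pn S * Qn S)"
  \<comment> \<open>The exponent contains the truncated difference N - 1, so N = 0 is treated
    apart.\<close>
  proof (cases "Pn S + Qn S = 0")
    case False
    then obtain l where l: "Pn S + Qn S = Suc l" by (cases "Pn S + Qn S") auto
    then have "even (Pn S) \<longleftrightarrow> (even (Qn S) \<longleftrightarrow> odd l)" by presburger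
    then show ?thesis unfolding l m by (auto simp: minus_one_power_iff power_add[symmetric] simp del: power_add)
  qed simp
  then show ?thesis by (simp add: sign_perm[OF assms] line_sign_def card_lines[OF S] power_add mult.assoc[symmetric])
qed

lemma prod_perm:
  assumes S: "lines S" and C: "C \<subseteq> doubles S"
  shows "(\<Prod>e\<in>E. of_bool (e = perm S C e) - Kmat k e (perm S C e))
    = (- 1) ^ card S * (\<Prod>x\<in>V - doubles S. wl k x S)
      * ((\<Prod>x\<in>C. k x True True * k x False False) * (\<Prod>x\<in>doubles S - C. k x True False * k x False True))"
proof -
  define h where "h = (\<lambda>e. if e \<in> S then k (fst e) (snd e) (dir S C e) else 1)"
  note fin = linesD(2)[OF S]
  have dV: "doubles S \<subseteq> V" by (auto simp: doubles_def)
  have "(\<Prod>e\<in>E. of_bool (e = perm S C e) - Kmat k e (perm S C e)) = (\<Prod>e\<in>E. (if e \<in> S then - 1 else 1) * h e)"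
  proof (intro prod.cong refl)
    fix e assume e: "e \<in> E"
    have V: "fst e \<in> V" using e by (auto simp: E_def)
    show "of_bool (e = perm S C e) - Kmat k e (perm S C e) = (if e \<in> S then - 1 else 1) * h e"
    proof (cases "e \<in> S")
      case True
      have "perm S C e \<noteq> e" using outE_ne[OF V, of "dir S C e"] True by (auto simp: perm_def)
      then show ?thesis using True by (auto simp: perm_def Kmat_def h_def)
    next
      case False
      have "e \<noteq> outE (fst e) (snd e)" using outE_ne[OF V, of "snd e"] by metis
      then show ?thesis using False by (auto simp: perm_def Kmat_def h_def)
    qed
  qed
  also have "\<dots> = (\<Prod>e\<in>E. if e \<in> S then - 1 else 1) * (\<Prod>e\<in>E. h e)" by (rule prod.distrib)
  also have "(\<Prod>e\<in>E. if e \<in> S then - 1 else 1 :: complex) = (- 1) ^ card S"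
    using linesD(1)[OF S] by (simp add: prod.If_cases Int_absorb1 Int_def[symmetric] flip: Collect_mem_eq)
  also have "(\<Prod>e\<in>E. h e) = (\<Prod>x\<in>V. h (x, True) * h (x, False))"
    unfolding E_def by (subst prod.cartesian_product') (simp add: UNIV_bool mult.commute)
  also have "\<dots> = (\<Prod>x\<in>V - doubles S. h (x, True) * h (x, False)) * (\<Prod>x\<in>doubles S. h (x, True) * h (x, False))"
    by (rule prod.subset_diff[OF dV finite_V])
  also have "(\<Prod>x\<in>V - doubles S. h (x, True) * h (x, False)) = (\<Prod>x\<in>V - doubles S. wl k x S)"
    by (intro prod.cong refl) (auto simp: h_def wl_def doubles_def dir_def)
  also have "(\<Prod>x\<in>doubles S. h (x, True) * h (x, False))
      = (\<Prod>x\<in>doubles S - C. h (x, True) * h (x, False)) * (\<Prod>x\<in>C. h (x, True) * h (x, False))"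
    using finite_subset[OF dV] by (intro prod.subset_diff[OF C]) simp
  also have "(\<Prod>x\<in>doubles S - C. h (x, True) * h (x, False)) = (\<Prod>x\<in>doubles S - C. k x True False * k x False True)"
    by (intro prod.cong refl) (auto simp: h_def doubles_def dir_def)
  also have "(\<Prod>x\<in>C. h (x, True) * h (x, False)) = (\<Prod>x\<in>C. k x True True * k x False False)"
    using C by (intro prod.cong refl) (auto simp: h_def doubles_def dir_def)
  finally show ?thesis by (simp add: mult_ac)
qed

text \<open>A permutation with a nonzero term moves every edge of its support S by one step.
  Injectivity and surjectivity of p balance incoming and outgoing edges at each vertex, so S is a
  line configuration; C is read off from where the horizontal edge goes at the doubly occupied
  vertices.\<close>

lemma perm_exhaust:
  assumes p: "p permutes E" and nz: "\<And>e. e \<in> E \<Longrightarrow> p e \<noteq> e \<Longrightarrow> p e = outE (fst e) (snd (p e))"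
  obtains S C where "lines S" "C \<subseteq> doubles S" "p = perm S C"
proof -
  define S where "S = {e\<in>E. p e \<noteq> e}"
  define C where "C = {x\<in>doubles S. snd (p (x, True))}"
  have pinj: "p e = p f \<longleftrightarrow> e = f" for e f using permutes_inj[OF p] by (auto dest: injD)
  have outI: "p e \<in> S \<and> p e = outE (fst e) (snd (p e))" if "e \<in> S" for e
    using that nz pinj permutes_in_image[OF p] by (auto simp: S_def)
  have outD: "\<exists>t. (x, t) \<in> S \<and> p (x, t) = outE x s" if "x \<in> V" "outE x s \<in> S" for x s
  proof -
    obtain e where e: "p e = outE x s" using permutes_surj[OF p] by (metis surjD)
    then have "e \<in> S" using that(2) permutes_in_image[OF p, of e] pinj by (auto simp: S_def)
    moreover have "fst e = x"
      using outI[OF \<open>e \<in> S\<close>] e that(1) \<open>e \<in> S\<close> by (metis (no_types, lifting) E_def SigmaE S_def fst_conv mem_Collect_eq outE_inj)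
    ultimately show ?thesis using e by (metis prod.collapse)
  qed
  have S: "lines S"
    unfolding lines_def
  proof (intro conjI ballI)
    show "S \<subseteq> E" by (auto simp: S_def)
    fix x assume x: "x \<in> V"
    have "(x, True) \<in> S \<and> (x, False) \<in> S \<longrightarrow> outE x True \<in> S \<and> outE x False \<in> S"
    proof
      assume a: "(x, True) \<in> S \<and> (x, False) \<in> S"
      define r r' where "r = snd (p (x, True))" and "r' = snd (p (x, False))"
      have r: "outE x r \<in> S" "p (x, True) = outE x r" "outE x r' \<in> S" "p (x, False) = outE x r'"
        using a outI[of "(x, True)"] outI[of "(x, False)"] by (simp_all add: r_def r'_def)
      have "outE x r \<noteq> outE x r'" using pinj[of "(x, True)" "(x, False)"] r by simp
      then have "r \<noteq> r'" by (rule contrapos_nn) simp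
      then have "r = (\<not> r')" by simp
      then show "outE x True \<in> S \<and> outE x False \<in> S" using r by (cases r') simp_all
    qed
    moreover have "outE x True \<in> S \<and> outE x False \<in> S \<longrightarrow> (x, True) \<in> S \<and> (x, False) \<in> S"
    proof
      assume "outE x True \<in> S \<and> outE x False \<in> S"
      then obtain t t' where t: "(x, t) \<in> S" "p (x, t) = outE x True" "(x, t') \<in> S" "p (x, t') = outE x False"
        using outD[OF x, of True] outD[OF x, of False] by auto
      have "outE x True \<noteq> outE x False" using x by (simp add: outE_inj)
      then have "t \<noteq> t'" using t by metis
      then have "t = (\<not> t')" by simp
      then show "(x, True) \<in> S \<and> (x, False) \<in> S" using t by (cases t') simp_all
    qed
    moreover have "(x, True) \<in> S \<or> (x, False) \<in> S \<longrightarrow> outE x True \<in> S \<or> outE x False \<in> S"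
    proof
      assume "(x, True) \<in> S \<or> (x, False) \<in> S"
      then obtain s where "(x, s) \<in> S" by auto
      then have "outE x (snd (p (x, s))) \<in> S" using outI[of "(x, s)"] by simp
      then show "outE x True \<in> S \<or> outE x False \<in> S" by (cases "snd (p (x, s))") simp_all
    qed
    moreover have "outE x True \<in> S \<or> outE x False \<in> S \<longrightarrow> (x, True) \<in> S \<or> (x, False) \<in> S"
    proof
      assume "outE x True \<in> S \<or> outE x False \<in> S"
      then obtain t where "(x, t) \<in> S" using outD[OF x] by blast
      then show "(x, True) \<in> S \<or> (x, False) \<in> S" by (cases t) simp_all
    qed
    ultimately show "of_bool ((x, True) \<in> S) + of_bool ((x, False) \<in> S)
      = (of_bool (outE x True \<in> S) + of_bool (outE x False \<in> S) :: nat)"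
      by (rule of_bool_sum_eqI)
  qed
  have "p e = perm S C e" for e
  proof (cases "e \<in> S")
    case False
    then have "p e = e" using permutes_not_in[OF p] by (cases "e \<in> E") (auto simp: S_def)
    then show ?thesis using False by (simp add: perm_def)
  next
    case True
    have "snd (p e) = dir S C e"
    proof (cases "fst e \<in> doubles S")
      case d: True
      show ?thesis
      proof (cases "snd e")
        case s: True
        then obtain x where x: "e = (x, True)" by (cases e) auto
        show ?thesis using d unfolding x by (simp add: C_def dir_def)
      next
        case s: False
        then have "e \<noteq> (fst e, True)" by (metis snd_conv)
        then have "p e \<noteq> p (fst e, True)" using pinj by blast
        moreover have "(fst e, True) \<in> S" using d by (simp add: doubles_def)
        ultimately have "snd (p e) \<noteq> snd (p (fst e, True))"
          using outI[OF True] outI[of "(fst e, True)"] by (metis fst_conv)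
        then show ?thesis using d s by (auto simp: dir_def C_def)
      qed
    next
      case False
      then show ?thesis using lines_simple[OF S True False, of "snd (p e)"] outI[OF True] by (simp add: dir_def)
    qed
    then show ?thesis using outI[OF True] True by (simp add: perm_def)
  qed
  then have p_eq: "p = perm S C" by (rule ext)
  have "C \<subseteq> doubles S" unfolding C_def by blast
  then show ?thesis by (rule that[OF S _ p_eq])
qed

text \<open>S is recovered as the support, as steps have no fixed points, and C from the images of
  the horizontal edges at the doubly occupied vertices.\<close>

lemma perm_eqD:
  assumes S: "lines S" "C \<subseteq> doubles S" and S': "lines S'" "C' \<subseteq> doubles S'" and eq: "perm S C = perm S' C'"
  shows "S = S' \<and> C = C'"
proof -
  have supp: "S = {e. perm S C e \<noteq> e}" if "lines S" for S C
  proof -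
    have "perm S C e \<noteq> e" if "e \<in> S" for e
      using that outE_ne[OF linesD(3)[OF \<open>lines S\<close> that], of "dir S C e"] by (auto simp: perm_def)
    moreover have "perm S C e = e" if "e \<notin> S" for e using that by (simp add: perm_def)
    ultimately have "e \<in> S \<longleftrightarrow> perm S C e \<noteq> e" for e by blast
    then show ?thesis by blast
  qed
  have "S = S'" using supp[OF S(1), of C] supp[OF S'(1), of C'] eq by simp
  have C: "C = {x\<in>doubles S. snd (perm S C (x, True))}" if "C \<subseteq> doubles S" for S C
  proof -
    have "snd (perm S C (x, True)) \<longleftrightarrow> x \<in> C" if "x \<in> doubles S" for x
      using that by (simp add: perm_def doubles_def dir_def)
    then show ?thesis using that by blast
  qed
  have "C = C'"
    using C[OF S(2)] C[OF S'(2)] eq \<open>S = S'\<close> by (metis (no_types))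
  with \<open>S = S'\<close> show ?thesis by simp
qed

text \<open>Only the permutations \<open>perm S C\<close> contribute to the Leibniz sum. For fixed S
  the sum over C is a product over the doubly occupied vertices of turning minus crossing, which is
  \<open>wl\<close> there.\<close>

lemma det_expansion:
  "detS E (\<lambda>e f. of_bool (e = f) - Kmat k e f) = (\<Sum>S | lines S. of_int (line_sign S) * (\<Prod>x\<in>V. wl k x S))"
proof -
  define M where "M = (\<lambda>e f. of_bool (e = f) - Kmat k e f)"
  define Sg where "Sg = (SIGMA S:{S. lines S}. Pow (doubles S))"
  have finL: "finite {S. lines S}"
    by (rule finite_subset[of _ "Pow E"]) (auto simp: lines_def)
  have finD: "finite (doubles S)" for S
    by (rule finite_subset[of _ V]) (auto simp: doubles_def)
  have inj: "inj_on (\<lambda>(S, C). perm S C) Sg"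
    using perm_eqD by (auto simp: inj_on_def Sg_def)
  have "detS E M = (\<Sum>p\<in>(\<lambda>(S, C). perm S C) ` Sg. of_int (sign p) * (\<Prod>e\<in>E. M e (p e)))"
    unfolding detS_def
  proof (rule sum.mono_neutral_right)
    show "(\<lambda>(S, C). perm S C) ` Sg \<subseteq> {p. p permutes E}" using perm_permutes by (auto simp: Sg_def)
    show "\<forall>p\<in>{p. p permutes E} - (\<lambda>(S, C). perm S C) ` Sg. of_int (sign p) * (\<Prod>e\<in>E. M e (p e)) = 0"
    proof (intro ballI, rule ccontr)
      fix p assume p: "p \<in> {p. p permutes E} - (\<lambda>(S, C). perm S C) ` Sg"
        and nz: "of_int (sign p) * (\<Prod>e\<in>E. M e (p e)) \<noteq> 0"
      have "p e = outE (fst e) (snd (p e))" if "e \<in> E" "p e \<noteq> e" for e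
        using nz that by (auto simp: M_def Kmat_def split: if_splits)
      then obtain S C where "lines S" "C \<subseteq> doubles S" "p = perm S C" using perm_exhaust[of p] p by blast
      then show False using p by (auto simp: Sg_def)
    qed
  qed (simp add: finite_permutations)
  also have "\<dots> = (\<Sum>(S, C)\<in>Sg. of_int (sign (perm S C)) * (\<Prod>e\<in>E. M e (perm S C e)))"
    by (subst sum.reindex[OF inj]) (simp add: case_prod_unfold)
  also have "\<dots> = (\<Sum>S | lines S. \<Sum>C\<in>Pow (doubles S). of_int (sign (perm S C)) * (\<Prod>e\<in>E. M e (perm S C e)))"
    unfolding Sg_def by (subst sum.Sigma) (auto simp: finL finD)
  also have "\<dots> = (\<Sum>S | lines S. of_int (line_sign S) * (\<Prod>x\<in>V. wl k x S))"
  proof (intro sum.cong refl)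
    fix S assume "S \<in> {S. lines S}"
    then have S: "lines S" by simp
    define a where "a = (\<lambda>x. - (k x True True * k x False False))"
    define b where "b = (\<lambda>x. k x True False * k x False True)"
    have "of_int (sign (perm S C)) * (\<Prod>e\<in>E. M e (perm S C e))
        = of_int (line_sign S) * (\<Prod>x\<in>V - doubles S. wl k x S) * (prod a C * prod b (doubles S - C))"
      if "C \<in> Pow (doubles S)" for C
    proof -
      have C: "C \<subseteq> doubles S" using that by simp
      have fC: "finite C" using finite_subset[OF C finD] .
      have "of_int (sign (perm S C)) * (\<Prod>e\<in>E. M e (perm S C e))
         = of_int ((- 1) ^ card S * sign (perm S C)) * (\<Prod>x\<in>V - doubles S. wl k x S)
           * ((\<Prod>x\<in>C. k x True True * k x False False) * prod b (doubles S - C))"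
        unfolding M_def prod_perm[OF S C] by (simp add: b_def)
      also have "\<dots> = of_int (line_sign S) * (\<Prod>x\<in>V - doubles S. wl k x S)
           * ((- 1) ^ card C * (\<Prod>x\<in>C. k x True True * k x False False) * prod b (doubles S - C))"
        unfolding sign_perm'[OF S C] by simp
      also have "(- 1) ^ card C * (\<Prod>x\<in>C. k x True True * k x False False) = prod a C"
        by (simp add: a_def prod_uminus)
      finally show ?thesis .
    qed
    then have "(\<Sum>C\<in>Pow (doubles S). of_int (sign (perm S C)) * (\<Prod>e\<in>E. M e (perm S C e)))
        = of_int (line_sign S) * (\<Prod>x\<in>V - doubles S. wl k x S) * (\<Sum>C\<in>Pow (doubles S). prod a C * prod b (doubles S - C))"
      by (simp add: sum_distrib_left)
    also have "(\<Sum>C\<in>Pow (doubles S). prod a C * prod b (doubles S - C)) = (\<Prod>x\<in>doubles S. a x + b x)"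
      by (rule prod_add[OF finD, symmetric])
    also have "\<dots> = (\<Prod>x\<in>doubles S. wl k x S)"
      by (intro prod.cong refl) (auto simp: a_def b_def wl_def doubles_def)
    also have "of_int (line_sign S) * (\<Prod>x\<in>V - doubles S. wl k x S) * (\<Prod>x\<in>doubles S. wl k x S)
        = of_int (line_sign S) * (\<Prod>x\<in>V. wl k x S)"
      using prod.subset_diff[of "doubles S" V "\<lambda>x. wl k x S"] by (auto simp: doubles_def mult.assoc)
    finally show "(\<Sum>C\<in>Pow (doubles S). of_int (sign (perm S C)) * (\<Prod>e\<in>E. M e (perm S C e)))
        = of_int (line_sign S) * (\<Prod>x\<in>V. wl k x S)" .
  qed
  finally show ?thesis by (simp add: M_def)
qed

end

section \<open>Fourier analysis of the one-step operator\<close>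

context torus
begin

definition ee :: "int \<Rightarrow> complex" where "ee m = cis (2 * pi * of_int m / of_nat n)"

lemma ee_add: "ee (a + b) = ee a * ee b"
  by (simp add: ee_def cis_mult distrib_left add_divide_distrib)

lemma ee_0 [simp]: "ee 0 = 1" by (simp add: ee_def)

lemma ee_nonzero [simp]: "ee m \<noteq> 0" by (simp add: ee_def)

lemma ee_eq_1_iff: "ee m = 1 \<longleftrightarrow> int n dvd m"
proof
  assume "ee m = 1"
  then obtain k :: int where "2 * pi * of_int m / of_nat n = 2 * pi * of_int k"
    by (auto simp: ee_def complex_eq_iff cos_one_2pi_int mult_ac)
  then have "of_int m = (of_int (k * int n) :: real)" using n2 by (simp add: field_simps)
  then have "m = k * int n" by (simp only: of_int_eq_iff)
  then show "int n dvd m" by simp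
next
  assume "int n dvd m"
  then obtain k where "m = int n * k" by auto
  then have "ee m = cis (2 * pi * of_int k)" using n2 by (simp add: ee_def mult_ac)
  then show "ee m = 1" by (simp add: complex_eq_iff)
qed

lemma ee_mod: "ee (m mod int n) = ee m"
proof -
  have "ee m = ee (m mod int n) * ee (int n * (m div int n))"
    by (simp flip: ee_add)
  moreover have "ee (int n * (m div int n)) = 1" by (simp add: ee_eq_1_iff)
  ultimately show ?thesis by simp
qed

lemma ee_power: "ee m ^ k = ee (int k * m)"
  by (induction k) (simp_all add: ee_add distrib_right)

lemma sum_ee: "(\<Sum>a\<in>{0..<int n}. ee (a * d)) = (if int n dvd d then of_nat n else 0)"
proof -
  have "(\<Sum>a\<in>{0..<int n}. ee (a * d)) = (\<Sum>k<n. ee d ^ k)"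
    by (rule sum.reindex_bij_witness[of _ int nat]) (auto simp: ee_power)
  also have "\<dots> = (if int n dvd d then of_nat n else 0)"
  proof (cases "int n dvd d")
    case True
    then have "ee d = 1" by (simp add: ee_eq_1_iff)
    then show ?thesis using True by simp
  next
    case False
    then have "ee d \<noteq> 1" by (simp add: ee_eq_1_iff)
    moreover have "ee d ^ n = 1" by (simp add: ee_power ee_eq_1_iff)
    ultimately show ?thesis using False by (simp add: geometric_sum)
  qed
  finally show ?thesis .
qed

text \<open>With the minus sign in the exponent a step left or down multiplies the character by the
  positive frequency factor \<open>zf\<close>.\<close>

definition chi :: "int \<times> int \<Rightarrow> int \<times> int \<Rightarrow> complex" where
  "chi z x = ee (- (fst z * fst x + snd z * snd x))"

definition zf :: "int \<times> int \<Rightarrow> bool \<Rightarrow> complex" where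
  "zf z s = (if s then ee (fst z) else ee (snd z))"

lemma chi_outE: "chi z (fst (outE x s)) = chi z x * zf z s"
proof -
  have "ee (- (c * (m mod int n))) = ee (- (c * m))" for c m
  proof -
    have "ee (- (c * (m mod int n))) = ee ((- (c * (m mod int n))) mod int n)" by (simp add: ee_mod)
    also have "(- (c * (m mod int n))) mod int n = (- (c * m)) mod int n"
      by (simp only: minus_mult_left mod_mult_right_eq)
    finally show ?thesis by (simp add: ee_mod)
  qed
  note m = this
  have "ee (- (c * ((m - 1) mod int n))) = ee (- (c * m)) * ee c" for c m
    unfolding m by (simp add: right_diff_distrib flip: ee_add)
  moreover have "chi z x = ee (- (fst z * fst x)) * ee (- (snd z * snd x))" for x
    unfolding chi_def by (simp flip: ee_add)
  ultimately show ?thesis by (cases s) (simp_all add: outE_def zf_def)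
qed

lemma chi_orthogonal:
  assumes "x \<in> V" "y \<in> V"
  shows "(\<Sum>z\<in>V. chi z x / chi z y) = (if x = y then of_nat n ^ 2 else 0)"
proof -
  have "chi z x / chi z y = ee (fst z * (fst y - fst x)) * ee (snd z * (snd y - snd x))" for z
  proof -
    have "ee (fst z * (fst y - fst x)) * ee (snd z * (snd y - snd x)) * chi z y = chi z x"
      unfolding chi_def by (simp add: algebra_simps flip: ee_add)
    then show ?thesis by (simp add: chi_def field_simps)
  qed
  then have "(\<Sum>z\<in>V. chi z x / chi z y)
     = (\<Sum>a\<in>{0..<int n}. ee (a * (fst y - fst x))) * (\<Sum>b\<in>{0..<int n}. ee (b * (snd y - snd x)))"
    unfolding V_def by (simp add: sum_product sum.cartesian_product')
  moreover have "int n dvd a - b \<longleftrightarrow> a = b" if "0 \<le> a" "a < int n" "0 \<le> b" "b < int n" for a b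
    using that by (auto simp: mod_eq_dvd_iff[symmetric])
  ultimately show ?thesis
    using assms by (auto simp: sum_ee V_def power2_eq_square prod_eq_iff)
qed

lemma sum_E: "(\<Sum>e\<in>E. h e) = (\<Sum>x\<in>V. h (x, True) + h (x, False))"
  unfolding E_def by (subst sum.cartesian_product') (simp add: UNIV_bool add.commute)

lemma row_action:
  assumes "e \<in> E"
  shows "(\<Sum>f\<in>E. (of_bool (e = f) - Kmat k e f) * h f)
    = h e - (k (fst e) (snd e) True * h (outE (fst e) True) + k (fst e) (snd e) False * h (outE (fst e) False))"
proof -
  have V: "fst e \<in> V" using assms by (auto simp: E_def)
  have "(\<Sum>f\<in>E. Kmat k e f * h f) = (\<Sum>f\<in>{outE (fst e) True, outE (fst e) False}. Kmat k e f * h f)"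
  proof (rule sum.mono_neutral_right)
    show "\<forall>f\<in>E - {outE (fst e) True, outE (fst e) False}. Kmat k e f * h f = 0"
    proof
      fix f assume "f \<in> E - {outE (fst e) True, outE (fst e) False}"
      then show "Kmat k e f * h f = 0" by (cases "snd f") (auto simp: Kmat_def)
    qed
  qed (use V in auto)
  moreover have "outE (fst e) True \<noteq> outE (fst e) False" using V by (simp add: outE_inj)
  moreover have "(\<Sum>f\<in>E. of_bool (e = f) * h f) = h e"
    using assms by (simp add: of_bool_def if_distrib[of "\<lambda>x. x * _"] cong: if_cong)
  ultimately show ?thesis
    by (simp add: left_diff_distrib sum_subtractf Kmat_def)
qed

definition Fm :: "(int \<times> int) \<times> bool \<Rightarrow> (int \<times> int) \<times> bool \<Rightarrow> complex" where
  "Fm e f = (if snd e = snd f then chi (fst f) (fst e) else 0)"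

definition Fi :: "(int \<times> int) \<times> bool \<Rightarrow> (int \<times> int) \<times> bool \<Rightarrow> complex" where
  "Fi e f = (if snd e = snd f then 1 / (of_nat n ^ 2 * chi (fst e) (fst f)) else 0)"

lemma Fm_Fi:
  assumes "e \<in> E" "f \<in> E"
  shows "(\<Sum>g\<in>E. Fm e g * Fi g f) = (if e = f then 1 else 0)"
proof -
  have "(\<Sum>g\<in>E. Fm e g * Fi g f) = (if snd e = snd f then (\<Sum>z\<in>V. chi z (fst e) / chi z (fst f)) / of_nat n ^ 2 else 0)"
    unfolding sum_E
    by (cases "snd e"; cases "snd f") (auto simp: Fm_def Fi_def sum_divide_distrib intro!: sum.cong)
  also have "\<dots> = (if e = f then 1 else 0)"
    using chi_orthogonal[of "fst e" "fst f"] assms n2 by (auto simp: mem_Times_iff E_def prod_eq_iff)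
  finally show ?thesis .
qed

lemma detS_Fm: "detS E Fm * detS E Fi = 1"
proof -
  have "detS E Fm * detS E Fi = detS E (\<lambda>e f. \<Sum>g\<in>E. Fm e g * Fi g f)" by (simp add: detS_mult)
  also have "\<dots> = detS E (\<lambda>e f. if e = f then 1 else 0)" by (rule detS_cong) (simp add: Fm_Fi)
  finally show ?thesis by (simp add: detS_one)
qed

text \<open>In the Fourier basis I - K splits into one 2 x 2 block for each frequency z, indexed by
  the two directions. The determinant of the Fourier matrix cancels because it is invertible
  (\<open>detS_Fm\<close>).\<close>

lemma det_uniform:
  "detS E (\<lambda>e f. of_bool (e = f) - Kmat (\<lambda>_. k) e f)
    = (\<Prod>z\<in>V. (1 - k True True * zf z True) * (1 - k False False * zf z False)
        - k True False * zf z False * (k False True * zf z True))"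
proof -
  define B where "B = (\<lambda>e f :: (int \<times> int) \<times> bool. if fst e = fst f then of_bool (snd e = snd f) - k (snd e) (snd f) * zf (fst e) (snd f) else 0)"
  have "detS E (\<lambda>e f. of_bool (e = f) - Kmat (\<lambda>_. k) e f) * detS E Fm
      = detS E (\<lambda>e f. \<Sum>g\<in>E. (of_bool (e = g) - Kmat (\<lambda>_. k) e g) * Fm g f)"
    by (simp add: detS_mult)
  also have "\<dots> = detS E (\<lambda>e f. \<Sum>g\<in>E. Fm e g * B g f)"
  proof (rule detS_cong)
    fix e f assume ef: "e \<in> E" "f \<in> E"
    have "(\<Sum>g\<in>E. Fm e g * B g f) = (\<Sum>x\<in>V. if x = fst f then Fm e (x, True) * B (x, True) f + Fm e (x, False) * B (x, False) f else 0)"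
      unfolding sum_E by (intro sum.cong refl) (simp add: B_def)
    also have "\<dots> = Fm e (fst f, True) * B (fst f, True) f + Fm e (fst f, False) * B (fst f, False) f"
      using ef by (auto simp: E_def)
    also have "\<dots> = chi (fst f) (fst e) * (of_bool (snd e = snd f) - k (snd e) (snd f) * zf (fst f) (snd f))"
      by (cases "snd e") (auto simp: Fm_def B_def)
    also have "\<dots> = (\<Sum>g\<in>E. (of_bool (e = g) - Kmat (\<lambda>_. k) e g) * Fm g f)"
      unfolding row_action[OF ef(1)] by (cases "snd f") (simp_all add: Fm_def chi_outE of_bool_def algebra_simps)
    finally show "(\<Sum>g\<in>E. (of_bool (e = g) - Kmat (\<lambda>_. k) e g) * Fm g f) = (\<Sum>g\<in>E. Fm e g * B g f)"
      by simp
  qed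
  also have "\<dots> = detS E Fm * detS E B" by (simp add: detS_mult)
  finally have "detS E (\<lambda>e f. of_bool (e = f) - Kmat (\<lambda>_. k) e f) = detS E B"
    using detS_Fm by (auto simp: mult.commute[of "detS E Fm"])
  also have "\<dots> = (\<Prod>z\<in>V. (1 - k True True * zf z True) * (1 - k False False * zf z False)
        - k True False * zf z False * (k False True * zf z True))"
    unfolding B_def E_def
    using detS_block_diagonal[of V "\<lambda>z s t. of_bool (s = t) - k s t * zf z t"] by simp
  finally show ?thesis .
qed

text \<open>\<open>Gam z\<close> inverts the block of I - K at frequency z, so its Fourier transform
  \<open>G\<close> is the Green function. New weights at v change only the two rows of edges
  entering v; hence (I - K') G is the identity in all other rows, and its determinant is that of the
  2 x 2 block at v. \<open>P\<close> is the Green function at coinciding vertices and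
  \<open>Q\<close> the one after one step.\<close>

lemma det_vertex_perturbation:
  assumes v: "v \<in> V"
    and inv: "\<And>z s t. z \<in> V \<Longrightarrow> Gam z s t - (k s True * zf z True * Gam z True t + k s False * zf z False * Gam z False t) = of_bool (s = t)"
  defines "P \<equiv> \<lambda>s t. (\<Sum>z\<in>V. Gam z s t) / of_nat n ^ 2"
    and "Q \<equiv> \<lambda>s t. (\<Sum>z\<in>V. zf z s * Gam z s t) / of_nat n ^ 2"
  defines "W \<equiv> \<lambda>k' s t. P s t - (k' s True * Q True t + k' s False * Q False t)"
  shows "detS E (\<lambda>e f. of_bool (e = f) - Kmat (\<lambda>x. if x = v then k' else k) e f)
    = detS E (\<lambda>e f. of_bool (e = f) - Kmat (\<lambda>_. k) e f)
      * (W k' True True * W k' False False - W k' True False * W k' False True)"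
proof -
  define G where "G = (\<lambda>e f :: (int \<times> int) \<times> bool. (\<Sum>z\<in>V. chi z (fst e) / chi z (fst f) * Gam z (snd e) (snd f)) / of_nat n ^ 2)"
  have row: "(\<Sum>g\<in>E. (of_bool (e = g) - Kmat kk e g) * G g f)
      = (\<Sum>z\<in>V. chi z (fst e) / chi z (fst f) * (Gam z (snd e) (snd f)
          - (kk (fst e) (snd e) True * zf z True * Gam z True (snd f) + kk (fst e) (snd e) False * zf z False * Gam z False (snd f)))) / of_nat n ^ 2"
    if "e \<in> E" for e f kk
    unfolding row_action[OF that] G_def
    by (simp add: chi_outE sum_distrib_left sum.distrib sum_subtractf algebra_simps add_divide_distrib diff_divide_distrib sum_divide_distrib)
  have row1: "(\<Sum>g\<in>E. (of_bool (e = g) - Kmat kk e g) * G g f) = (if e = f then 1 else 0)"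
    if "e \<in> E" "f \<in> E" "kk (fst e) = k" for e f kk
  proof -
    have "(\<Sum>g\<in>E. (of_bool (e = g) - Kmat kk e g) * G g f)
       = (\<Sum>z\<in>V. chi z (fst e) / chi z (fst f) * of_bool (snd e = snd f)) / of_nat n ^ 2"
      unfolding row[OF that(1)] that(3) by (simp add: inv)
    also have "\<dots> = (\<Sum>z\<in>V. chi z (fst e) / chi z (fst f)) * of_bool (snd e = snd f) / of_nat n ^ 2"
      by (simp only: sum_distrib_right)
    also have "\<dots> = (if e = f then 1 else 0)"
      using that n2 by (subst chi_orthogonal) (auto simp: E_def)
    finally show ?thesis .
  qed
  have "detS E (\<lambda>e f. of_bool (e = f) - Kmat (\<lambda>_. k) e f) * detS E G
      = detS E (\<lambda>e f. \<Sum>g\<in>E. (of_bool (e = g) - Kmat (\<lambda>_. k) e g) * G g f)" by (simp add: detS_mult)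
  also have "\<dots> = detS E (\<lambda>e f. if e = f then 1 else 0)" by (rule detS_cong) (simp add: row1)
  finally have one: "detS E (\<lambda>e f. of_bool (e = f) - Kmat (\<lambda>_. k) e f) * detS E G = 1" by (simp add: detS_one)
  let ?k = "\<lambda>x. if x = v then k' else k"
  define H where "H = (\<lambda>e f. \<Sum>g\<in>E. (of_bool (e = g) - Kmat ?k e g) * G g f)"
  have HW: "H (v, s) (v, t) = W k' s t" for s t
  proof -
    have vs: "(v, s) \<in> E" using v by (simp add: E_def)
    have "chi z v \<noteq> 0" for z by (simp add: chi_def)
    then show ?thesis unfolding H_def row[OF vs] W_def P_def Q_def
      by (simp add: sum_subtractf sum.distrib sum_distrib_left mult.assoc add_divide_distrib diff_divide_distrib)
  qed
  have "detS E H = H (v, True) (v, True) * H (v, False) (v, False) - H (v, True) (v, False) * H (v, False) (v, True)"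
  proof (rule detS_two_rows)
    fix e f assume ef: "e \<in> E - {(v, True), (v, False)}" "f \<in> E"
    then have "fst e \<noteq> v" by (cases e; cases "snd e") auto
    then show "H e f = (if e = f then 1 else 0)" unfolding H_def using ef by (intro row1) auto
  qed (use v in \<open>auto simp: E_def\<close>)
  then have "detS E H = W k' True True * W k' False False - W k' True False * W k' False True"
    by (simp add: HW)
  moreover have "detS E H = detS E (\<lambda>e f. of_bool (e = f) - Kmat ?k e f) * detS E G"
    unfolding H_def by (simp add: detS_mult)
  ultimately have "detS E (\<lambda>e f. of_bool (e = f) - Kmat ?k e f) * detS E G
     = W k' True True * W k' False False - W k' True False * W k' False True" by simp
  moreover have "a = d * w" if "a * g = w" "d * g = 1" for a d g w :: complex
    using that by (metis mult.assoc mult.commute mult.right_neutral)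
  ultimately show ?thesis using one by blast
qed

section \<open>Vertex types, twisted partition functions and their moments\<close>

definition ty :: "int \<times> int \<Rightarrow> ((int \<times> int) \<times> bool) set \<Rightarrow> nat" where
  "ty x S = (if (x, True) \<in> S \<and> (x, False) \<in> S then 2
     else if (x, True) \<in> S then (if outE x True \<in> S then 4 else 5)
     else if (x, False) \<in> S then (if outE x True \<in> S then 6 else 3) else 1)"

definition wtl :: "(bool \<Rightarrow> bool \<Rightarrow> complex) \<Rightarrow> nat \<Rightarrow> complex" where
  "wtl k t = (if t = 1 then 1 else if t = 2 then k True False * k False True - k True True * k False False
     else if t = 3 then k False False else if t = 4 then k True True
     else if t = 5 then k True False else if t = 6 then k False True else 0)"

text \<open>X and Y weigh each horizontal and each vertical edge of a line. Since those edges come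
  in multiples of n, only the twists u = X^n and v = Y^n per winding line are visible in the
  determinant.\<close>

definition kuni :: "complex \<Rightarrow> complex \<Rightarrow> complex \<Rightarrow> complex \<Rightarrow> complex \<Rightarrow> bool \<Rightarrow> bool \<Rightarrow> complex" where
  "kuni a b g X Y s s' = (if s then X else Y) * (if s = s' then (if s then a else b) else g)"

lemma wl_eq_wtl: "wl k x S = wtl (k x) (ty x S)"
  by (auto simp: wl_def wtl_def ty_def)

lemma ty_range: "ty x S \<in> {1..6}"
  by (simp add: ty_def)

lemma wtl_kuni:
  "wtl (kuni a b g X Y) (ty x S) = wtl (kuni a b g 1 1) (ty x S)
     * (if (x, True) \<in> S then X else 1) * (if (x, False) \<in> S then Y else 1)"
  by (cases "(x, True) \<in> S"; cases "(x, False) \<in> S"; cases "outE x True \<in> S")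
    (simp_all add: wtl_def kuni_def ty_def right_diff_distrib left_diff_distrib mult_ac)

definition Wt :: "complex \<Rightarrow> complex \<Rightarrow> complex \<Rightarrow> ((int \<times> int) \<times> bool) set \<Rightarrow> complex" where
  "Wt a b g S = (\<Prod>x\<in>V. wtl (kuni a b g 1 1) (ty x S))"

lemma prod_wtl_kuni:
  assumes S: "lines S"
  shows "(\<Prod>x\<in>V. wtl (kuni a b g X Y) (ty x S)) = Wt a b g S * (X ^ n) ^ Pn S * (Y ^ n) ^ Qn S"
proof -
  have c: "card {x\<in>V. (x, s) \<in> S} = card {e\<in>S. snd e = s}" for s
    by (rule bij_betw_same_card[of "\<lambda>x. (x, s)"], rule bij_betwI[where g = fst])
       (use linesD(1)[OF S] in \<open>auto simp: E_def\<close>)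
  have "(\<Prod>x\<in>V. if (x, s) \<in> S then c else 1) = c ^ card {x\<in>V. (x, s) \<in> S}" for s and c :: complex
    by (simp add: prod.If_cases Int_def)
  then have p: "(\<Prod>x\<in>V. if (x, True) \<in> S then X else 1) = (X ^ n) ^ Pn S"
    "(\<Prod>x\<in>V. if (x, False) \<in> S then Y else 1) = (Y ^ n) ^ Qn S"
    using c[of True] c[of False] card_horizontal[OF S] card_vertical[OF S] by (simp_all add: power_mult)
  have "(\<Prod>x\<in>V. wtl (kuni a b g X Y) (ty x S))
     = (\<Prod>x\<in>V. wtl (kuni a b g 1 1) (ty x S) * (if (x, True) \<in> S then X else 1) * (if (x, False) \<in> S then Y else 1))"
    by (intro prod.cong refl wtl_kuni)
  then show ?thesis by (simp only: prod.distrib Wt_def p)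
qed

definition DD :: "complex \<Rightarrow> complex \<Rightarrow> complex \<Rightarrow> complex \<Rightarrow> complex \<Rightarrow> complex" where
  "DD a b g u v = (\<Sum>S | lines S. of_int (line_sign S) * Wt a b g S * u ^ Pn S * v ^ Qn S)"

definition NN :: "complex \<Rightarrow> complex \<Rightarrow> complex \<Rightarrow> int \<times> int \<Rightarrow> nat \<Rightarrow> complex \<Rightarrow> complex \<Rightarrow> complex" where
  "NN a b g x t u v = (\<Sum>S | lines S \<and> ty x S = t. of_int (line_sign S) * Wt a b g S * u ^ Pn S * v ^ Qn S)"

definition dl :: "complex \<Rightarrow> complex \<Rightarrow> complex \<Rightarrow> complex \<Rightarrow> complex \<Rightarrow> complex" where
  "dl a b g w1 w2 = (1 + a * w1) * (1 + b * w2) - g\<^sup>2 * w1 * w2"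

text \<open>The sign comes from w = - X exp (2 pi i k / n): with it the factor 1 - a X zf of I - K
  becomes 1 + a w, as in Delta.\<close>

definition rts :: "complex \<Rightarrow> complex set" where "rts c = {w. (- w) ^ n = c}"

lemma bij_rts:
  assumes "X \<noteq> 0"
  shows "bij_betw (\<lambda>i. - (X * ee i)) {0..<int n} (rts (X ^ n))"
proof -
  have inj: "inj_on (\<lambda>i. - (X * ee i)) {0..<int n}"
  proof (rule inj_onI)
    fix i j assume ij: "i \<in> {0..<int n}" "j \<in> {0..<int n}" "- (X * ee i) = - (X * ee j)"
    then have "ee (i - j) = 1" using assms ee_add[of "i - j" j] by simp
    then show "i = j" using ij by (auto simp: ee_eq_1_iff mod_eq_dvd_iff[symmetric])
  qed
  have fin: "finite (rts (X ^ n))" and card: "card (rts (X ^ n)) = n"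
  proof -
    have b: "bij_betw uminus {w. w ^ n = X ^ n} (rts (X ^ n))"
      by (rule bij_betwI[where g = uminus]) (auto simp: rts_def)
    show "finite (rts (X ^ n))" using bij_betw_finite[OF b] finite_nth_roots[of n "X ^ n"] n2 by simp
    show "card (rts (X ^ n)) = n" using bij_betw_same_card[OF b] card_nth_roots[of "X ^ n" n] n2 assms by simp
  qed
  have sub: "(\<lambda>i. - (X * ee i)) ` {0..<int n} \<subseteq> rts (X ^ n)"
    by (auto simp: rts_def power_mult_distrib ee_power ee_eq_1_iff)
  moreover have "card ((\<lambda>i. - (X * ee i)) ` {0..<int n}) = card (rts (X ^ n))"
    using card card_image[OF inj] by simp
  ultimately have "(\<lambda>i. - (X * ee i)) ` {0..<int n} = rts (X ^ n)"
    by (intro card_subset_eq fin)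
  then show ?thesis using inj by (simp add: bij_betw_def)
qed

lemma finite_rts: "finite (rts c)"
proof -
  have b: "bij_betw uminus {w. w ^ n = c} (rts c)"
    by (rule bij_betwI[where g = uminus]) (auto simp: rts_def)
  show ?thesis using bij_betw_finite[OF b] finite_nth_roots[of n c] n2 by simp
qed

lemma sum_V_rts:
  assumes "X \<noteq> 0" "Y \<noteq> 0"
  shows "(\<Sum>z\<in>V. f (- (X * zf z True)) (- (Y * zf z False))) = (\<Sum>w1\<in>rts (X ^ n). \<Sum>w2\<in>rts (Y ^ n). f w1 w2)"
proof -
  have "(\<Sum>z\<in>V. f (- (X * zf z True)) (- (Y * zf z False)))
      = (\<Sum>i\<in>{0..<int n}. \<Sum>j\<in>{0..<int n}. f (- (X * ee i)) (- (Y * ee j)))"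
    unfolding V_def by (subst sum.cartesian_product') (simp add: zf_def)
  also have "\<dots> = (\<Sum>w1\<in>rts (X ^ n). \<Sum>w2\<in>rts (Y ^ n). f w1 w2)"
    unfolding sum.reindex_bij_betw[OF bij_rts[OF assms(2)], of "f w" for w]
    by (rule sum.reindex_bij_betw[OF bij_rts[OF assms(1)]])
  finally show ?thesis .
qed

lemma prod_V_rts:
  assumes "X \<noteq> 0" "Y \<noteq> 0"
  shows "(\<Prod>z\<in>V. f (- (X * zf z True)) (- (Y * zf z False))) = (\<Prod>w1\<in>rts (X ^ n). \<Prod>w2\<in>rts (Y ^ n). f w1 w2)"
proof -
  have "(\<Prod>z\<in>V. f (- (X * zf z True)) (- (Y * zf z False)))
      = (\<Prod>i\<in>{0..<int n}. \<Prod>j\<in>{0..<int n}. f (- (X * ee i)) (- (Y * ee j)))"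
    unfolding V_def by (subst prod.cartesian_product') (simp add: zf_def)
  also have "\<dots> = (\<Prod>w1\<in>rts (X ^ n). \<Prod>w2\<in>rts (Y ^ n). f w1 w2)"
    unfolding prod.reindex_bij_betw[OF bij_rts[OF assms(2)], of "f w" for w]
    by (rule prod.reindex_bij_betw[OF bij_rts[OF assms(1)]])
  finally show ?thesis .
qed

lemma DD_eq_det:
  "detS E (\<lambda>e f. of_bool (e = f) - Kmat (\<lambda>_. kuni a b g X Y) e f) = DD a b g (X ^ n) (Y ^ n)"
  unfolding det_expansion DD_def wl_eq_wtl
  by (intro sum.cong refl) (simp add: prod_wtl_kuni mult.assoc)

lemma exists_nth_root: "\<exists>X. X ^ n = (u :: complex)"
proof (cases "u = 0")
  case False
  have "card {z. z ^ n = u} \<noteq> 0" using card_nth_roots[OF False, of n] n2 by simp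
  then show ?thesis by (metis (mono_tags, lifting) Collect_empty_eq card.empty)
qed (use n2 in \<open>auto intro: exI[of _ 0]\<close>)

lemma DD_eq_prod:
  assumes "u \<noteq> 0" "v \<noteq> 0"
  shows "DD a b g u v = (\<Prod>w1\<in>rts u. \<Prod>w2\<in>rts v. dl a b g w1 w2)"
proof -
  obtain X Y where XY: "X ^ n = u" "Y ^ n = v" using exists_nth_root by metis
  then have nz: "X \<noteq> 0" "Y \<noteq> 0" using assms n2 by auto
  have "DD a b g u v = detS E (\<lambda>e f. of_bool (e = f) - Kmat (\<lambda>_. kuni a b g X Y) e f)"
    by (simp add: DD_eq_det XY)
  also have "\<dots> = (\<Prod>z\<in>V. dl a b g (- (X * zf z True)) (- (Y * zf z False)))"
    unfolding det_uniform
    by (intro prod.cong refl) (simp add: kuni_def dl_def power2_eq_square algebra_simps)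
  finally show ?thesis by (simp add: prod_V_rts[OF nz] XY)
qed

definition mom :: "complex \<Rightarrow> complex \<Rightarrow> complex \<Rightarrow> complex \<Rightarrow> complex \<Rightarrow> (complex \<Rightarrow> complex \<Rightarrow> complex) \<Rightarrow> complex" where
  "mom a b g u v h = (\<Sum>w1\<in>rts u. \<Sum>w2\<in>rts v. h w1 w2 / dl a b g w1 w2) / of_nat n ^ 2"

text \<open>The numerator f_t with its monomials in (w1, w2) and in (v1, v2) replaced by the
  respective moments. After this replacement f_5 and f_6 coincide.\<close>

definition Ebil :: "complex \<Rightarrow> complex \<Rightarrow> complex \<Rightarrow> nat \<Rightarrow> complex \<Rightarrow> complex \<Rightarrow> complex \<Rightarrow> complex \<Rightarrow> complex" where
  "Ebil a b g t m0 m1 m2 m12 =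
    (if t = 1 then (m0 + b * m2) * (m0 + a * m1) - g\<^sup>2 * m1 * m2
     else if t = 2 then (g\<^sup>2 - a * b) * (g\<^sup>2 * m12 * m12 - (m1 + b * m12) * (m2 + a * m12))
     else if t = 3 then b * ((m0 + b * m2) * (m2 + a * m12) - g\<^sup>2 * m12 * m2)
     else if t = 4 then a * ((m1 + b * m12) * (m0 + a * m1) - g\<^sup>2 * m1 * m12)
     else g\<^sup>2 * (m1 * m2 - m0 * m12))"

text \<open>Vary the weights \<open>k'\<close> at x alone. The expansion into lines is a combination
  of the weights \<open>wtl k' t\<close> with coefficients \<open>R t\<close>, the signed sums over
  the other vertices with type t at x; the rank two formula expresses the same function of the four
  entries of \<open>k'\<close> by the Green function. Comparing the two isolates each
  \<open>R t\<close>.\<close>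

lemma NN_eq:
  assumes uv: "u \<noteq> 0" "v \<noteq> 0" and x: "x \<in> V" and t: "t \<in> {1..6}"
    and nz: "\<And>w1 w2. w1 \<in> rts u \<Longrightarrow> w2 \<in> rts v \<Longrightarrow> dl a b g w1 w2 \<noteq> 0"
  defines "m \<equiv> mom a b g u v"
  shows "NN a b g x t u v = DD a b g u v
    * Ebil a b g t (m (\<lambda>_ _. 1)) (m (\<lambda>w1 _. w1)) (m (\<lambda>_ w2. w2)) (m (\<lambda>w1 w2. w1 * w2))"
proof -
  obtain X Y where XY: "X ^ n = u" "Y ^ n = v" using exists_nth_root by metis
  then have XYnz: "X \<noteq> 0" "Y \<noteq> 0" using uv n2 by auto
  define m0 m1 m2 m12 where "m0 = m (\<lambda>_ _. 1)" and "m1 = m (\<lambda>w1 _. w1)"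
    and "m2 = m (\<lambda>_ w2. w2)" and "m12 = m (\<lambda>w1 w2. w1 * w2)"
  let ?w1 = "\<lambda>z. - (X * zf z True)" and ?w2 = "\<lambda>z. - (Y * zf z False)"
  have mV: "m h = (\<Sum>z\<in>V. h (?w1 z) (?w2 z) / dl a b g (?w1 z) (?w2 z)) / of_nat n ^ 2" for h
    unfolding m_def mom_def using sum_V_rts[OF XYnz, of "\<lambda>w1 w2. h w1 w2 / dl a b g w1 w2"] by (simp add: XY)
  have dnz: "dl a b g (?w1 z) (?w2 z) \<noteq> 0" if "z \<in> V" for z
  proof (rule nz)
    have "ee i ^ n = 1" for i by (simp add: ee_power ee_eq_1_iff)
    then show "?w1 z \<in> rts u" "?w2 z \<in> rts v" by (auto simp: rts_def XY power_mult_distrib zf_def)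
  qed
  define k where "k = kuni a b g X Y"
  \<comment> \<open>Cramer's rule for the 2 x 2 block at frequency z, whose determinant is
    \<open>dl\<close>.\<close>
  define Gam where "Gam = (\<lambda>z s t. (if s then (if t then 1 + b * ?w2 z else - g * X / Y * ?w2 z)
      else (if t then - g * Y / X * ?w1 z else 1 + a * ?w1 z)) / dl a b g (?w1 z) (?w2 z))"
  define P where "P = (\<lambda>s t. (\<Sum>z\<in>V. Gam z s t) / of_nat n ^ 2)"
  define Q where "Q = (\<lambda>s t. (\<Sum>z\<in>V. zf z s * Gam z s t) / of_nat n ^ 2)"
  define W where "W = (\<lambda>k' s t. P s t - (k' s True * Q True t + k' s False * Q False t))"
  define D where "D = DD a b g u v"
  have inv: "Gam z s t - (k s True * zf z True * Gam z True t + k s False * zf z False * Gam z False t) = of_bool (s = t)"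
    if "z \<in> V" for z s t
  proof -
    define d where "d = dl a b g (?w1 z) (?w2 z)"
    have d: "d \<noteq> 0" using dnz[OF that] by (simp add: d_def)
    have deq: "d = (1 - a * X * zf z True) * (1 - b * Y * zf z False) - g\<^sup>2 * X * Y * zf z True * zf z False"
      by (simp add: d_def dl_def power2_eq_square algebra_simps)
    show ?thesis
      unfolding Gam_def d_def[symmetric] k_def kuni_def using XYnz d
      by (cases s; cases t; simp add: divide_simps; simp add: deq power2_eq_square algebra_simps)
  qed
  have pert: "detS E (\<lambda>e f. of_bool (e = f) - Kmat (\<lambda>y. if y = x then k' else k) e f)
      = D * (W k' True True * W k' False False - W k' True False * W k' False True)" for k'
    using det_vertex_perturbation[of x Gam k k', OF x inv] DD_eq_det[of a b g X Y]
    unfolding W_def P_def Q_def D_def k_def XY by simp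
  define R where "R = (\<lambda>t. \<Sum>S | lines S \<and> ty x S = t. of_int (line_sign S) * (\<Prod>y\<in>V - {x}. wtl k (ty y S)))"
  have finL: "finite {S. lines S}"
    by (rule finite_subset[of _ "Pow E"]) (auto simp: lines_def)
  have split: "(\<Prod>y\<in>V. f y) = f x * (\<Prod>y\<in>V - {x}. f y)" for f :: "_ \<Rightarrow> complex"
    using x by (simp add: prod.remove)
  have pertR: "detS E (\<lambda>e f. of_bool (e = f) - Kmat (\<lambda>y. if y = x then k' else k) e f)
      = (\<Sum>t\<in>{1..6}. wtl k' t * R t)" for k'
  proof -
    have "detS E (\<lambda>e f. of_bool (e = f) - Kmat (\<lambda>y. if y = x then k' else k) e f)
       = (\<Sum>S | lines S. of_int (line_sign S) * (wtl k' (ty x S) * (\<Prod>y\<in>V - {x}. wtl k (ty y S))))"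
      unfolding det_expansion wl_eq_wtl split by (intro sum.cong refl) simp
    also have "\<dots> = (\<Sum>t\<in>{1..6}. \<Sum>S\<in>{S\<in>{S. lines S}. ty x S = t}. of_int (line_sign S) * (wtl k' (ty x S) * (\<Prod>y\<in>V - {x}. wtl k (ty y S))))"
      by (intro sum.group[symmetric] finL image_subsetI ty_range) simp
    also have "\<dots> = (\<Sum>t\<in>{1..6}. wtl k' t * R t)"
      unfolding R_def by (intro sum.cong refl) (auto simp: sum_distrib_left mult_ac intro!: sum.cong)
    finally show ?thesis .
  qed
  have six: "(\<Sum>t\<in>{1..6}. f t) = f 1 + f 2 + f 3 + f 4 + f 5 + f 6" for f :: "nat \<Rightarrow> complex"
    by (simp add: eval_nat_numeral)
  have NR: "NN a b g x t u v = wtl k t * R t"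
    unfolding NN_def R_def sum_distrib_left
  proof (intro sum.cong refl)
    fix S assume "S \<in> {S. lines S \<and> ty x S = t}"
    then have S: "lines S" "ty x S = t" by auto
    have "Wt a b g S * u ^ Pn S * v ^ Qn S = (\<Prod>y\<in>V. wtl k (ty y S))"
      using prod_wtl_kuni[OF S(1), of a b g X Y] by (simp add: k_def XY)
    then show "of_int (line_sign S) * Wt a b g S * u ^ Pn S * v ^ Qn S
        = wtl k t * (of_int (line_sign S) * (\<Prod>y\<in>V - {x}. wtl k (ty y S)))"
      using S(2) by (simp add: split mult_ac)
  qed
  define kk where "kk = (\<lambda>p q r w s s'. if s then (if s' then p else q) else (if s' then r else w :: complex))"
  have eq: "(\<Sum>t\<in>{1..6}. wtl (kk p q r w) t * R t)
     = D * (W (kk p q r w) True True * W (kk p q r w) False False - W (kk p q r w) True False * W (kk p q r w) False True)" for p q r w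
    using pert[of "kk p q r w"] pertR[of "kk p q r w"] by simp
  have eqs: "R 1 + (q * r - p * w) * R 2 + w * R 3 + p * R 4 + q * R 5 + r * R 6
     = D * ((P True True - (p * Q True True + q * Q False True)) * (P False False - (r * Q True False + w * Q False False))
       - (P True False - (p * Q True False + q * Q False False)) * (P False True - (r * Q True True + w * Q False True)))" for p q r w
    using eq[where p = p and q = q and r = r and w = w] unfolding six by (simp add: wtl_def kk_def W_def)
  \<comment> \<open>The zero matrix, the four matrix units and the matrix with q = r = 1 determine
    the six coefficients one after the other.\<close>
  have R1: "R 1 = D * (P True True * P False False - P True False * P False True)"
    using eqs[where p = 0 and q = 0 and r = 0 and w = 0] by simp
  have R4: "R 4 = D * (Q True False * P False True - Q True True * P False False)"
    using eqs[where p = 1 and q = 0 and r = 0 and w = 0] R1 by (simp del: One_nat_def) algebra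
  have R5: "R 5 = D * (Q False False * P False True - Q False True * P False False)"
    using eqs[where p = 0 and q = 1 and r = 0 and w = 0] R1 by (simp del: One_nat_def) algebra
  have R6: "R 6 = D * (P True False * Q True True - P True True * Q True False)"
    using eqs[where p = 0 and q = 0 and r = 1 and w = 0] R1 by (simp del: One_nat_def) algebra
  have R3: "R 3 = D * (P True False * Q False True - P True True * Q False False)"
    using eqs[where p = 0 and q = 0 and r = 0 and w = 1] R1 by (simp del: One_nat_def) algebra
  have R2: "R 2 = D * (Q False True * Q True False - Q False False * Q True True)"
    using eqs[where p = 0 and q = 1 and r = 1 and w = 0] R1 R5 R6 by (simp del: One_nat_def) algebra
  have lin: "(\<Sum>z\<in>V. (c1 * h1 (?w1 z) (?w2 z) + c2 * h2 (?w1 z) (?w2 z)) / dl a b g (?w1 z) (?w2 z)) / of_nat n ^ 2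
      = c1 * m h1 + c2 * m h2" for c1 c2 h1 h2
    unfolding mV by (simp add: sum_distrib_left sum.distrib add_divide_distrib)
  have P: "P True True = m0 + b * m2" "P False False = m0 + a * m1"
    "P True False = - g * X / Y * m2" "P False True = - g * Y / X * m1"
    using lin[of 1 "\<lambda>_ _. 1" b "\<lambda>_ w2. w2"] lin[of 1 "\<lambda>_ _. 1" a "\<lambda>w1 _. w1"]
      lin[of "- g * X / Y" "\<lambda>_ w2. w2" 0 "\<lambda>_ w2. w2"] lin[of "- g * Y / X" "\<lambda>w1 _. w1" 0 "\<lambda>_ w2. w2"]
    by (simp_all add: P_def Gam_def m0_def m1_def m2_def)
  have Qlin: "Q s t = c1 * m h1 + c2 * m h2"
    if q: "\<And>z. z \<in> V \<Longrightarrow> zf z s * Gam z s t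
       = (c1 * h1 (?w1 z) (?w2 z) + c2 * h2 (?w1 z) (?w2 z)) / dl a b g (?w1 z) (?w2 z)"
    for s t c1 c2 h1 h2
    unfolding Q_def lin[symmetric] by (intro arg_cong2[where f = "(/)"] sum.cong refl q)
  have Q1: "Q True True = - 1 / X * m1 + (- b / X) * m12" unfolding m1_def m12_def
    by (rule Qlin) (use XYnz in \<open>simp add: Gam_def add_divide_distrib[symmetric] algebra_simps\<close>)
  have Q4: "Q False False = - 1 / Y * m2 + (- a / Y) * m12" unfolding m2_def m12_def
    by (rule Qlin) (use XYnz in \<open>simp add: Gam_def add_divide_distrib[symmetric] algebra_simps\<close>)
  have Q2: "Q True False = g / Y * m12 + 0 * m1" unfolding m12_def m1_def
    by (rule Qlin) (use XYnz in \<open>simp add: Gam_def\<close>)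
  have Q3: "Q False True = g / X * m12 + 0 * m1" unfolding m12_def m1_def
    by (rule Qlin) (use XYnz in \<open>simp add: Gam_def\<close>)
  have tt: "t = 1 \<or> t = 2 \<or> t = 3 \<or> t = 4 \<or> t = 5 \<or> t = 6" using t by auto
  have "wtl k t * R t = D * Ebil a b g t m0 m1 m2 m12"
    using tt XYnz
    by (elim disjE; simp add: wtl_def k_def kuni_def Ebil_def R1[unfolded One_nat_def] R2 R3 R4 R5 R6 P Q1 Q2 Q3 Q4 field_simps power2_eq_square)
  then show ?thesis by (simp add: NR D_def m0_def m1_def m2_def m12_def)
qed

end

section \<open>Sectors and concentration of the winding number\<close>

text \<open>On the unit circle |a - u b| = |cnj b - u cnj a|, so each factor may be reflected until
  its constant term is the larger coefficient. The reflected product is a polynomial in u with the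
  same modulus on the circle, and its value at 0 is a mean of its values there.\<close>

lemma prod_max_le:
  fixes a b :: "'i \<Rightarrow> complex"
  assumes I: "finite I" and bound: "\<And>u. norm u = 1 \<Longrightarrow> norm (\<Prod>i\<in>I. a i - u * b i) \<le> Z"
  shows "(\<Prod>i\<in>I. max (norm (a i)) (norm (b i))) \<le> Z"
proof -
  \<comment> \<open>N exceeds the degree \<open>card I\<close>, so that averaging over the N-th
    roots of unity keeps the constant coefficient only, and N >= 2 as the locale
    \<open>torus\<close> demands.\<close>
  define N where "N = card I + 2"
  interpret t: torus N by standard (simp add: N_def)
  define c where "c = (\<lambda>i. if norm (b i) \<le> norm (a i) then a i else cnj (b i))"
  define d where "d = (\<lambda>i. if norm (b i) \<le> norm (a i) then b i else cnj (a i))"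
  have reflect: "norm (c i - u * d i) = norm (a i - u * b i)" if "norm u = 1" for i u
  proof (cases "norm (b i) \<le> norm (a i)")
    case False
    have "u * cnj u = 1" using that by (simp add: complex_norm_square[symmetric])
    then have "cnj u * (a i - u * b i) = - cnj (cnj (b i) - u * cnj (a i))"
      by (simp add: algebra_simps)
    then have "norm (a i - u * b i) = norm (cnj (b i) - u * cnj (a i))"
      using that by (metis complex_mod_cnj mult_cancel_right2 norm_minus_cancel norm_mult mult.commute mult.right_neutral)
    then show ?thesis using False by (simp add: c_def d_def)
  qed (simp add: c_def d_def)
  have expand: "(\<Prod>i\<in>I. c i - u * d i) = (\<Sum>X\<in>Pow I. u ^ card X * ((\<Prod>i\<in>X. - d i) * (\<Prod>i\<in>I - X. c i)))" for u
  proof -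
    have "(\<Prod>i\<in>I. c i - u * d i) = (\<Prod>i\<in>I. u * (- d i) + c i)" by (simp add: algebra_simps)
    also have "\<dots> = (\<Sum>X\<in>Pow I. (\<Prod>i\<in>X. u * (- d i)) * (\<Prod>i\<in>I - X. c i))" by (rule prod_add[OF I])
    also have "\<dots> = (\<Sum>X\<in>Pow I. u ^ card X * ((\<Prod>i\<in>X. - d i) * (\<Prod>i\<in>I - X. c i)))"
      by (simp only: prod.distrib prod_constant mult.assoc)
    finally show ?thesis .
  qed
  have "(\<Sum>k\<in>{0..<int N}. \<Prod>i\<in>I. c i - t.ee k * d i)
      = (\<Sum>X\<in>Pow I. (\<Sum>k\<in>{0..<int N}. t.ee (k * int (card X))) * ((\<Prod>i\<in>X. - d i) * (\<Prod>i\<in>I - X. c i)))"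
    unfolding expand
    by (subst sum.swap, intro sum.cong refl) (simp only: t.ee_power sum_distrib_right mult.commute[of "int (card _)"])
  also have "\<dots> = (\<Sum>X\<in>Pow I. if X = {} then of_nat N * (\<Prod>i\<in>I. c i) else 0)"
  proof (intro sum.cong refl)
    fix X assume X: "X \<in> Pow I"
    then have "card X < N" using card_mono[OF I, of X] by (simp add: N_def)
    then have "int N dvd int (card X) \<longleftrightarrow> X = {}"
      using finite_subset[of X I] X I by (auto dest!: dvd_imp_le)
    then show "(\<Sum>k\<in>{0..<int N}. t.ee (k * int (card X))) * ((\<Prod>i\<in>X. - d i) * (\<Prod>i\<in>I - X. c i))
       = (if X = {} then of_nat N * (\<Prod>i\<in>I. c i) else 0)"
      by (simp add: t.sum_ee)
  qed
  also have "\<dots> = of_nat N * (\<Prod>i\<in>I. c i)" using I by simp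
  finally have "of_nat N * norm (\<Prod>i\<in>I. c i) = norm (\<Sum>k\<in>{0..<int N}. \<Prod>i\<in>I. c i - t.ee k * d i)"
    by (simp add: norm_mult)
  also have "\<dots> \<le> (\<Sum>k\<in>{0..<int N}. Z)"
  proof (rule sum_norm_le)
    fix k assume "k \<in> {0..<int N}"
    have "norm (t.ee k) = 1" by (simp add: t.ee_def)
    then show "norm (\<Prod>i\<in>I. c i - t.ee k * d i) \<le> Z"
      using bound[of "t.ee k"] by (simp add: prod_norm[symmetric] reflect)
  qed
  also have "\<dots> = of_nat N * Z" by simp
  finally have "norm (\<Prod>i\<in>I. c i) \<le> Z" by (simp add: N_def)
  moreover have "norm (\<Prod>i\<in>I. c i) = (\<Prod>i\<in>I. max (norm (a i)) (norm (b i)))"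
    unfolding prod_norm[symmetric] by (intro prod.cong refl) (auto simp: c_def)
  ultimately show ?thesis by simp
qed

locale sixv = torus +
  fixes \<alpha> \<beta> \<gamma> :: real
  assumes pos: "\<alpha> > 0" "\<beta> > 0" "\<gamma> > 0" and delta_pos: "\<gamma>\<^sup>2 > \<alpha> * \<beta>"
begin

definition rw :: "((int \<times> int) \<times> bool) set \<Rightarrow> real" where
  "rw S = (\<Prod>x\<in>V. sv_weights \<alpha> \<beta> \<gamma> (ty x S))"

definition Zr :: real where "Zr = (\<Sum>S | lines S. rw S)"

definition pr :: "((int \<times> int) \<times> bool) set \<Rightarrow> real" where "pr S = rw S / Zr"

lemma Wt_real: "Wt \<alpha> \<beta> \<gamma> S = of_real (rw S)"
proof -
  have "wtl (kuni \<alpha> \<beta> \<gamma> 1 1) (ty x S) = of_real (sv_weights \<alpha> \<beta> \<gamma> (ty x S))" for x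
    using ty_range[of x S] by (auto simp: wtl_def kuni_def sv_weights_def power2_eq_square)
  then show ?thesis by (simp add: Wt_def rw_def)
qed

lemma finite_lines: "finite {S. lines S \<and> R S}"
  by (rule finite_subset[of _ "Pow E"]) (auto simp: lines_def)

lemma finite_lines': "finite {S. lines S}"
  using finite_lines[of "\<lambda>_. True"] by simp

lemma rw_pos: "rw S > 0"
  unfolding rw_def
proof (intro prod_pos ballI)
  fix x
  show "0 < sv_weights \<alpha> \<beta> \<gamma> (ty x S)"
    using ty_range[of x S] pos delta_pos by (auto simp: sv_weights_def)
qed

lemma Zr_pos: "Zr > 0"
proof -
  have "lines {}" by (simp add: lines_def)
  then show ?thesis unfolding Zr_def using rw_pos
    by (intro sum_pos finite_lines') auto
qed

lemma pr_nonneg: "pr S \<ge> 0"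
  using rw_pos[of S] Zr_pos by (simp add: pr_def less_imp_le)

lemma sum_pr: "(\<Sum>S | lines S. pr S) = 1"
  using Zr_pos by (simp add: pr_def Zr_def sum_divide_distrib[symmetric])

section \<open>Six-vertex configurations as line configurations\<close>

definition red :: "int \<times> int \<Rightarrow> int \<times> int" where
  "red x = (fst x mod int n, snd x mod int n)"

lemma red_V: "red x \<in> V" using n2 by (simp add: red_def V_def)

lemma periodic_mod:
  assumes "\<And>i. f (i + int n) = f i"
  shows "f (i mod int n) = f i"
proof -
  have step: "f (i + int m * int n) = f i" for m i
  proof (induction m arbitrary: i)
    case (Suc m)
    have "f (i + int (Suc m) * int n) = f ((i + int m * int n) + int n)"
      by (rule arg_cong[of _ _ f]) (simp add: algebra_simps)
    then show ?case using assms Suc by simp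
  qed simp
  show ?thesis
  proof (cases "i div int n \<ge> 0")
    case True
    have "i mod int n + int (nat (i div int n)) * int n = i" using True by simp
    then show ?thesis using step[of "i mod int n" "nat (i div int n)"] by simp
  next
    case False
    have "i + int (nat (- (i div int n))) * int n = i mod int n"
      using False by (simp add: minus_div_mult_eq_mod[symmetric])
    then show ?thesis using step[of i "nat (- (i div int n))"] by simp
  qed
qed

lemma periodic_red:
  assumes "periodic_conf n \<sigma>"
  shows "fst \<sigma> (red x) = fst \<sigma> x" "snd \<sigma> (red x) = snd \<sigma> x"
proof -
  obtain i j where x: "x = (i, j)" by force
  have "fst \<sigma> (i mod int n, j mod int n) = fst \<sigma> (i, j mod int n)"
    by (rule periodic_mod[of "\<lambda>i. fst \<sigma> (i, j mod int n)"]) (use assms in \<open>simp add: periodic_conf_def\<close>)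
  also have "\<dots> = fst \<sigma> (i, j)"
    by (rule periodic_mod[of "\<lambda>j. fst \<sigma> (i, j)"]) (use assms in \<open>simp add: periodic_conf_def\<close>)
  finally show "fst \<sigma> (red x) = fst \<sigma> x" by (simp add: red_def x)
  have "snd \<sigma> (i mod int n, j mod int n) = snd \<sigma> (i, j mod int n)"
    by (rule periodic_mod[of "\<lambda>i. snd \<sigma> (i, j mod int n)"]) (use assms in \<open>simp add: periodic_conf_def\<close>)
  also have "\<dots> = snd \<sigma> (i, j)"
    by (rule periodic_mod[of "\<lambda>j. snd \<sigma> (i, j)"]) (use assms in \<open>simp add: periodic_conf_def\<close>)
  finally show "snd \<sigma> (red x) = snd \<sigma> x" by (simp add: red_def x)
qed

definition conf_lines :: "orientation \<Rightarrow> ((int \<times> int) \<times> bool) set" where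
  "conf_lines \<sigma> = {e\<in>E. \<not> (if snd e then fst \<sigma> (fst e) else snd \<sigma> (fst e))}"

definition lines_conf :: "((int \<times> int) \<times> bool) set \<Rightarrow> orientation" where
  "lines_conf S = (\<lambda>x. (red x, True) \<notin> S, \<lambda>x. (red x, False) \<notin> S)"

lemma local_edges:
  assumes "periodic_conf n \<sigma>"
  shows "(red (i, j), True) \<in> conf_lines \<sigma> \<longleftrightarrow> \<not> fst \<sigma> (i, j)"
    "(red (i, j), False) \<in> conf_lines \<sigma> \<longleftrightarrow> \<not> snd \<sigma> (i, j)"
    "outE (red (i, j)) True \<in> conf_lines \<sigma> \<longleftrightarrow> \<not> fst \<sigma> (i - 1, j)"
    "outE (red (i, j)) False \<in> conf_lines \<sigma> \<longleftrightarrow> \<not> snd \<sigma> (i, j - 1)"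
proof -
  have E: "(red x, s) \<in> E" for x s using red_V by (simp add: E_def)
  have o: "outE (red (i, j)) True = (red (i - 1, j), True)" "outE (red (i, j)) False = (red (i, j - 1), False)"
    by (simp_all add: outE_def red_def mod_simps)
  show "(red (i, j), True) \<in> conf_lines \<sigma> \<longleftrightarrow> \<not> fst \<sigma> (i, j)"
    "(red (i, j), False) \<in> conf_lines \<sigma> \<longleftrightarrow> \<not> snd \<sigma> (i, j)"
    "outE (red (i, j)) True \<in> conf_lines \<sigma> \<longleftrightarrow> \<not> fst \<sigma> (i - 1, j)"
    "outE (red (i, j)) False \<in> conf_lines \<sigma> \<longleftrightarrow> \<not> snd \<sigma> (i, j - 1)"
    unfolding o using E by (simp_all add: conf_lines_def periodic_red[OF assms])
qed

text \<open>Without lines all edges point right and up and the in-degree is 2; a line entering the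
  vertex raises it by one, and a line leaving it lowers it by one.\<close>

lemma in_degree_iff:
  assumes "periodic_conf n \<sigma>"
  shows "in_degree \<sigma> x = 2 \<longleftrightarrow>
    of_bool ((red x, True) \<in> conf_lines \<sigma>) + of_bool ((red x, False) \<in> conf_lines \<sigma>)
      = (of_bool (outE (red x) True \<in> conf_lines \<sigma>) + of_bool (outE (red x) False \<in> conf_lines \<sigma>) :: nat)"
  by (cases x) (simp add: local_edges[OF assms] in_degree_def)

lemma red_id: "x \<in> V \<Longrightarrow> red x = x"
  by (auto simp: red_def V_def)

lemma conf_lines_lines:
  assumes "\<sigma> \<in> six_vertex_configs n"
  shows "lines (conf_lines \<sigma>)"
  unfolding lines_def
proof (intro conjI ballI)
  show "conf_lines \<sigma> \<subseteq> E" by (auto simp: conf_lines_def)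
  fix x assume "x \<in> V"
  have p: "periodic_conf n \<sigma>" "in_degree \<sigma> x = 2" using assms unfolding six_vertex_configs_def by blast+
  show "of_bool ((x, True) \<in> conf_lines \<sigma>) + of_bool ((x, False) \<in> conf_lines \<sigma>)
      = (of_bool (outE x True \<in> conf_lines \<sigma>) + of_bool (outE x False \<in> conf_lines \<sigma>) :: nat)"
    using in_degree_iff[OF p(1), of x] p(2) red_id[OF \<open>x \<in> V\<close>] by simp
qed

lemma lines_conf_inverse:
  assumes "lines S"
  shows "lines_conf S \<in> six_vertex_configs n" "conf_lines (lines_conf S) = S"
proof -
  have p: "periodic_conf n (lines_conf S)"
    by (simp add: periodic_conf_def lines_conf_def red_def)
  show S: "conf_lines (lines_conf S) = S"
  proof (intro set_eqI)
    fix e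
    have "e \<in> conf_lines (lines_conf S) \<longleftrightarrow> e \<in> S" if "e \<in> E"
      using that red_id[of "fst e"] mem_split[of e S] by (auto simp: conf_lines_def lines_conf_def E_def)
    moreover have "e \<in> S \<Longrightarrow> e \<in> E" using linesD(1)[OF assms] by blast
    moreover have "e \<in> conf_lines (lines_conf S) \<Longrightarrow> e \<in> E" by (simp add: conf_lines_def)
    ultimately show "e \<in> conf_lines (lines_conf S) \<longleftrightarrow> e \<in> S" by blast
  qed
  have "in_degree (lines_conf S) x = 2" for x
    unfolding in_degree_iff[OF p] S using assms red_V[of x] by (auto simp: lines_def)
  then show "lines_conf S \<in> six_vertex_configs n" using p by (simp add: six_vertex_configs_def)
qed

lemma conf_lines_inverse:
  assumes "\<sigma> \<in> six_vertex_configs n"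
  shows "lines_conf (conf_lines \<sigma>) = \<sigma>"
proof -
  have p: "periodic_conf n \<sigma>" using assms by (simp add: six_vertex_configs_def)
  have "fst (lines_conf (conf_lines \<sigma>)) = fst \<sigma>" "snd (lines_conf (conf_lines \<sigma>)) = snd \<sigma>"
    by (auto simp: lines_conf_def local_edges[OF p] fun_eq_iff)
  then show ?thesis by (simp add: prod_eq_iff)
qed

lemma vtype_eq:
  assumes "\<sigma> \<in> six_vertex_configs n"
  shows "vtype \<sigma> x = ty (red x) (conf_lines \<sigma>)"
proof -
  obtain i j where x: "x = (i, j)" by force
  have p: "periodic_conf n \<sigma>" using assms by (simp add: six_vertex_configs_def)
  have l: "lines (conf_lines \<sigma>)" by (rule conf_lines_lines[OF assms])
  show ?thesis using lines_ice[OF l red_V, of x]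
    unfolding x local_edges[OF p] vtype_def ty_def Let_def by simp blast
qed

lemma sum_configs:
  "(\<Sum>\<sigma>\<in>{\<sigma> \<in> six_vertex_configs n. R (conf_lines \<sigma>)}. h (conf_lines \<sigma>)) = (\<Sum>S | lines S \<and> R S. h S)"
  by (rule sum.reindex_bij_witness[of _ lines_conf conf_lines])
     (auto simp: lines_conf_inverse conf_lines_inverse conf_lines_lines)

lemma torus_type_prob_eq:
  "torus_type_prob (sv_weights \<alpha> \<beta> \<gamma>) n v t = (\<Sum>S | lines S \<and> ty (red v) S = t. pr S)"
proof -
  have w: "conf_weight (sv_weights \<alpha> \<beta> \<gamma>) n \<sigma> = rw (conf_lines \<sigma>)" if "\<sigma> \<in> six_vertex_configs n" for \<sigma>
    unfolding conf_weight_def rw_def V_def[symmetric]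
    by (intro prod.cong refl) (simp add: vtype_eq[OF that] red_id)
  have "(\<Sum>\<sigma>\<in>{\<sigma> \<in> six_vertex_configs n. vtype \<sigma> v = t}. conf_weight (sv_weights \<alpha> \<beta> \<gamma>) n \<sigma>)
      = (\<Sum>\<sigma>\<in>{\<sigma> \<in> six_vertex_configs n. ty (red v) (conf_lines \<sigma>) = t}. rw (conf_lines \<sigma>))"
    by (intro sum.cong) (auto simp: w vtype_eq)
  also have "\<dots> = (\<Sum>S | lines S \<and> ty (red v) S = t. rw S)" by (rule sum_configs)
  finally have 1: "(\<Sum>\<sigma>\<in>{\<sigma> \<in> six_vertex_configs n. vtype \<sigma> v = t}. conf_weight (sv_weights \<alpha> \<beta> \<gamma>) n \<sigma>)
      = (\<Sum>S | lines S \<and> ty (red v) S = t. rw S)" .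
  have "(\<Sum>\<sigma>\<in>six_vertex_configs n. conf_weight (sv_weights \<alpha> \<beta> \<gamma>) n \<sigma>) = Zr"
    using sum_configs[where R = "\<lambda>_. True" and h = rw] by (simp add: w Zr_def)
  with 1 show ?thesis by (simp add: torus_type_prob_def pr_def sum_divide_distrib)
qed

section \<open>Removal of the sign by averaging over the four sectors\<close>

definition cs :: "bool \<Rightarrow> complex" where "cs e = (if e then - 1 else 1)"

text \<open>The sector with both signs +1 enters negatively and the three others positively, as in
  Kasteleyn's count of dimers on a torus. The signed sum then equals 2 for every pair of parities of
  P and Q.\<close>

definition cc :: "bool \<Rightarrow> bool \<Rightarrow> complex" where "cc e1 e2 = (if e1 \<or> e2 then 1 else - 1)"

lemma norm_cc [simp]: "norm (cc e1 e2) = 1"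
  by (simp add: cc_def)

lemma sector_identity:
  "(\<Sum>e1\<in>UNIV. \<Sum>e2\<in>UNIV. cc e1 e2 * (of_int (line_sign S) * (cs e1) ^ Pn S * (cs e2) ^ Qn S)) = 2"
  by (cases "even (Pn S)"; cases "even (Qn S)") (simp_all add: UNIV_bool cc_def cs_def line_sign_def)

lemma sector_sum:
  "2 * (\<Sum>S | lines S \<and> R S. of_real (rw S) * u ^ Pn S)
    = (\<Sum>e1\<in>UNIV. \<Sum>e2\<in>UNIV. cc e1 e2 *
        (\<Sum>S | lines S \<and> R S. of_int (line_sign S) * Wt \<alpha> \<beta> \<gamma> S * (cs e1 * u) ^ Pn S * (cs e2) ^ Qn S))"
proof -
  have "2 * (\<Sum>S | lines S \<and> R S. of_real (rw S) * u ^ Pn S)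
      = (\<Sum>S | lines S \<and> R S. (\<Sum>e1\<in>UNIV. \<Sum>e2\<in>UNIV. cc e1 e2 * (of_int (line_sign S) * (cs e1) ^ Pn S * (cs e2) ^ Qn S)) * (of_real (rw S) * u ^ Pn S))"
    unfolding sector_identity by (rule sum_distrib_left)
  also have "\<dots> = (\<Sum>S | lines S \<and> R S. (\<Sum>e1\<in>UNIV. \<Sum>e2\<in>UNIV. cc e1 e2 * (of_int (line_sign S) * Wt \<alpha> \<beta> \<gamma> S * (cs e1 * u) ^ Pn S * (cs e2) ^ Qn S)))"
    by (intro sum.cong refl) (simp add: UNIV_bool Wt_real power_mult_distrib algebra_simps)
  also have "\<dots> = (\<Sum>e1\<in>UNIV. \<Sum>e2\<in>UNIV. cc e1 e2 *
        (\<Sum>S | lines S \<and> R S. of_int (line_sign S) * Wt \<alpha> \<beta> \<gamma> S * (cs e1 * u) ^ Pn S * (cs e2) ^ Qn S))"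
    unfolding sum_distrib_left by (subst sum.swap, rule sum.cong[OF refl], rule sum.swap)
  finally show ?thesis .
qed

lemma sector_DD: "2 * (\<Sum>S | lines S. of_real (rw S) * u ^ Pn S)
    = (\<Sum>e1\<in>UNIV. \<Sum>e2\<in>UNIV. cc e1 e2 * DD \<alpha> \<beta> \<gamma> (cs e1 * u) (cs e2))"
  using sector_sum[where R = "\<lambda>_. True"] by (simp add: DD_def)

lemma sector_NN: "2 * (\<Sum>S | lines S \<and> ty x S = t. of_real (rw S) * u ^ Pn S)
    = (\<Sum>e1\<in>UNIV. \<Sum>e2\<in>UNIV. cc e1 e2 * NN \<alpha> \<beta> \<gamma> x t (cs e1 * u) (cs e2))"
  using sector_sum[where R = "\<lambda>S. ty x S = t"] by (simp add: NN_def)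

lemma norm_DD_le:
  assumes "norm v = 1"
  shows "norm (DD \<alpha> \<beta> \<gamma> u v) \<le> (\<Sum>S | lines S. rw S * norm u ^ Pn S)"
  unfolding DD_def
proof (rule sum_norm_le)
  fix S
  have "norm (of_int (line_sign S) :: complex) = 1" by (simp add: line_sign_def norm_power)
  then show "norm (of_int (line_sign S) * Wt \<alpha> \<beta> \<gamma> S * u ^ Pn S * v ^ Qn S) \<le> rw S * norm u ^ Pn S"
    using rw_pos[of S] assms by (simp add: norm_mult norm_power Wt_real)
qed

lemma norm_DD_le_Zr: "norm u = 1 \<Longrightarrow> norm v = 1 \<Longrightarrow> norm (DD \<alpha> \<beta> \<gamma> u v) \<le> Zr"
  using norm_DD_le[of v u] by (simp add: Zr_def)

section \<open>Products over the first variable and concentration of the winding number\<close>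

definition Aw :: "complex \<Rightarrow> complex" where "Aw w = 1 + of_real \<beta> * w"

definition Bw :: "complex \<Rightarrow> complex" where "Bw w = of_real \<alpha> - of_real (\<gamma>\<^sup>2 - \<alpha> * \<beta>) * w"

lemma dl_eq: "dl \<alpha> \<beta> \<gamma> w1 w2 = Aw w2 + Bw w2 * w1"
  by (simp add: dl_def Aw_def Bw_def algebra_simps power2_eq_square)

lemma card_rts:
  assumes "u \<noteq> 0" shows "card (rts u) = n"
proof -
  have b: "bij_betw uminus {w. w ^ n = u} (rts u)"
    by (rule bij_betwI[where g = uminus]) (auto simp: rts_def)
  show ?thesis using bij_betw_same_card[OF b] card_nth_roots[OF assms, of n] n2 by simp
qed

text \<open>As w runs over \<open>rts u\<close>, -w runs over the n-th roots of u. The product is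
  therefore the homogenised polynomial z^n - u at A / B, identified as a monic polynomial of degree
  n with these n roots.\<close>

lemma prod_rts:
  assumes u: "u \<noteq> 0"
  shows "(\<Prod>w\<in>rts u. A + B * w) = A ^ n - u * B ^ n"
proof (cases "B = 0")
  case True
  then show ?thesis using card_rts[OF u] n2 by simp
next
  case False
  define p where "p = (\<Prod>w\<in>rts u. [:w, 1:])"
  define q where "q = monom 1 n - [:u:]"
  have "p = q"
  proof (rule poly_eqI_degree_lead_coeff[where n = n and A = "uminus ` rts u"])
    have dp: "degree p = n"
      unfolding p_def by (subst degree_prod_eq_sum_degree) (simp_all add: card_rts u)
    have "lead_coeff p = 1" unfolding p_def by (simp add: lead_coeff_prod)
    then show "poly.coeff p n = poly.coeff q n" using dp n2 by (simp add: q_def coeff_pCons split: nat.split)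
    show "n \<le> card (uminus ` rts u)" by (simp add: card_image card_rts u)
    show "degree p \<le> n" using dp by simp
    show "degree q \<le> n" unfolding q_def by (intro degree_diff_le) (simp_all add: degree_monom_le)
    fix z assume "z \<in> uminus ` rts u"
    then obtain w where w: "w \<in> rts u" "z = - w" by auto
    then have "poly p z = 0" unfolding p_def by (auto simp: poly_prod finite_rts)
    moreover have "poly q z = 0" using w by (simp add: q_def poly_monom rts_def)
    ultimately show "poly p z = poly q z" by simp
  qed
  have "(\<Prod>w\<in>rts u. A + B * w) = (\<Prod>w\<in>rts u. B * (w + A / B))"
    using False by (intro prod.cong refl) (simp add: field_simps)
  also have "\<dots> = B ^ n * poly p (A / B)"
    unfolding p_def by (simp add: prod.distrib card_rts u poly_prod)
  also have "\<dots> = A ^ n - u * B ^ n"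
    unfolding \<open>p = q\<close> using False by (simp add: q_def poly_monom field_simps power_divide)
  finally show ?thesis .
qed

lemma DD_prod:
  assumes "u \<noteq> 0" "v \<noteq> 0"
  shows "DD \<alpha> \<beta> \<gamma> u v = (\<Prod>w\<in>rts v. Aw w ^ n - u * Bw w ^ n)"
  unfolding DD_eq_prod[OF assms] dl_eq by (subst prod.swap) (simp add: prod_rts assms)

text \<open>The number of factors A^n - u B^n in which the term with B dominates once |u| = exp (h
  n). For small h it is close to n times the value around which P / n concentrates.\<close>

definition cnt :: "real \<Rightarrow> complex \<Rightarrow> nat" where
  "cnt h v = card {w\<in>rts v. exp h * norm (Bw w) \<ge> norm (Aw w)}"

text \<open>exp (h n P) is u^P for the real twist u = exp (h n), so the moment is a combination of
  four twisted determinants. Each of their n factors is at most twice its larger term, and the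
  product of max(|A|, |B|)^n over the grid is at most Z. The resulting 2^n is harmless against
  exponents of order n^2.\<close>

lemma exp_moment_le:
  fixes h :: real
  shows "(\<Sum>S | lines S. pr S * exp (h * n * Pn S)) \<le> 2 ^ n * (exp (h * n * cnt h 1) + exp (h * n * cnt h (- 1)))"
proof -
  define M where "M = (\<lambda>w. max (norm (Aw w)) (norm (Bw w)))"
  define u where "u = complex_of_real (exp (h * n))"
  have M0: "M w \<ge> 0" for w by (simp add: M_def le_max_iff_disj)
  have bound: "norm (Aw w ^ n - c * Bw w ^ n) \<le> 2 * (M w ^ n * (if exp h * norm (Bw w) \<ge> norm (Aw w) then exp (h * n) else 1))"
    if c: "norm c = exp (h * n)" for c w
  proof -
    have ex: "exp (h * n) = exp h ^ n" by (simp add: exp_of_nat_mult[symmetric] mult.commute)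
    have "norm (Aw w ^ n - c * Bw w ^ n) \<le> norm (Aw w) ^ n + exp (h * n) * norm (Bw w) ^ n"
      using norm_triangle_ineq4[of "Aw w ^ n" "c * Bw w ^ n"] by (simp add: norm_mult norm_power c)
    also have "\<dots> = norm (Aw w) ^ n + (exp h * norm (Bw w)) ^ n" by (simp add: ex power_mult_distrib)
    also have "\<dots> \<le> 2 * (M w ^ n * (if exp h * norm (Bw w) \<ge> norm (Aw w) then exp (h * n) else 1))"
    proof (cases "exp h * norm (Bw w) \<ge> norm (Aw w)")
      case True
      have "norm (Aw w) ^ n \<le> (exp h * norm (Bw w)) ^ n" using True by (intro power_mono) auto
      moreover have "norm (Bw w) ^ n \<le> M w ^ n" by (intro power_mono) (auto simp: M_def)
      then have "(exp h * norm (Bw w)) ^ n \<le> exp (h * n) * M w ^ n" by (simp add: ex power_mult_distrib)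
      ultimately show ?thesis using True by (simp add: mult.commute)
    next
      case False
      have "(exp h * norm (Bw w)) ^ n \<le> norm (Aw w) ^ n" using False by (intro power_mono) auto
      moreover have "norm (Aw w) ^ n \<le> M w ^ n" by (intro power_mono) (auto simp: M_def)
      ultimately show ?thesis using False by simp
    qed
    finally show ?thesis .
  qed
  \<comment> \<open>The trivial upper bound |D(u, v)| <= Z on |u| = 1 becomes a lower bound for Z by
    \<open>prod_max_le\<close>.\<close>
  have lower: "(\<Prod>w\<in>rts v. M w ^ n) \<le> Zr" if v: "norm v = 1" for v
  proof -
    have v0: "v \<noteq> 0" using v by auto
    have "(\<Prod>w\<in>rts v. max (norm (Aw w ^ n)) (norm (Bw w ^ n))) \<le> Zr"
    proof (rule prod_max_le[OF finite_rts])
      fix u :: complex assume u: "norm u = 1"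
      then have "u \<noteq> 0" by auto
      then show "norm (\<Prod>w\<in>rts v. Aw w ^ n - u * Bw w ^ n) \<le> Zr"
        using norm_DD_le_Zr[OF u v] DD_prod[OF _ v0] by simp
    qed
    moreover have "M w ^ n \<le> max (norm (Aw w ^ n)) (norm (Bw w ^ n))" for w
      by (auto simp: M_def norm_power max_def)
    then have "(\<Prod>w\<in>rts v. M w ^ n) \<le> (\<Prod>w\<in>rts v. max (norm (Aw w ^ n)) (norm (Bw w ^ n)))"
      by (intro prod_mono) (auto simp: M0)
    ultimately show ?thesis by simp
  qed
  have upper: "norm (DD \<alpha> \<beta> \<gamma> (c * u) v) \<le> 2 ^ n * Zr * exp (h * n * cnt h v)" if v: "norm v = 1" and c: "norm c = 1" for c v
  proof -
    have v0: "v \<noteq> 0" and cu: "c * u \<noteq> 0" using v c by (auto simp: u_def)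
    have nc: "norm (c * u) = exp (h * n)" by (simp add: norm_mult c u_def)
    have "norm (DD \<alpha> \<beta> \<gamma> (c * u) v) = (\<Prod>w\<in>rts v. norm (Aw w ^ n - c * u * Bw w ^ n))"
      by (simp add: DD_prod[OF cu v0] prod_norm)
    also have "\<dots> \<le> (\<Prod>w\<in>rts v. 2 * (M w ^ n * (if exp h * norm (Bw w) \<ge> norm (Aw w) then exp (h * n) else 1)))"
      by (intro prod_mono conjI norm_ge_zero bound nc)
    also have "\<dots> = 2 ^ n * ((\<Prod>w\<in>rts v. M w ^ n) * exp (h * n) ^ cnt h v)"
      by (simp add: prod.distrib card_rts v0 prod.If_cases finite_rts cnt_def Int_def)
    also have "\<dots> \<le> 2 ^ n * (Zr * exp (h * n) ^ cnt h v)"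
      by (intro mult_left_mono mult_right_mono lower v) auto
    finally show ?thesis by (simp add: exp_of_nat_mult[symmetric] mult_ac)
  qed
  have "2 * (\<Sum>S | lines S. rw S * exp (h * n) ^ Pn S) = norm (2 * (\<Sum>S | lines S. of_real (rw S) * u ^ Pn S))"
  proof -
    have "(\<Sum>S | lines S. of_real (rw S) * u ^ Pn S) = of_real (\<Sum>S | lines S. rw S * exp (h * n) ^ Pn S)"
      by (simp add: u_def)
    moreover have "(\<Sum>S | lines S. rw S * exp (h * n) ^ Pn S) \<ge> 0"
      using rw_pos by (intro sum_nonneg) (simp add: less_imp_le)
    ultimately show ?thesis by (simp only: norm_mult norm_of_real norm_numeral abs_of_nonneg)
  qed
  also have "\<dots> \<le> (\<Sum>e1\<in>(UNIV :: bool set). \<Sum>e2\<in>UNIV. 2 ^ n * Zr * exp (h * n * cnt h (cs e2)))"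
    unfolding sector_DD
  proof (intro sum_norm_le)
    fix e1 e2
    have "norm (cs e) = 1" for e by (simp add: cs_def)
    then show "norm (cc e1 e2 * DD \<alpha> \<beta> \<gamma> (cs e1 * u) (cs e2)) \<le> 2 ^ n * Zr * exp (h * n * cnt h (cs e2))"
      using upper[of "cs e2" "cs e1"] by (simp add: norm_mult)
  qed
  also have "\<dots> = 2 * (2 ^ n * Zr * (exp (h * n * cnt h 1) + exp (h * n * cnt h (- 1))))"
    by (simp add: UNIV_bool cs_def algebra_simps)
  finally have "(\<Sum>S | lines S. rw S * exp (h * n) ^ Pn S) \<le> Zr * (2 ^ n * (exp (h * n * cnt h 1) + exp (h * n * cnt h (- 1))))"
    by (simp add: mult_ac)
  then have "(\<Sum>S | lines S. rw S * exp (h * n) ^ Pn S) / Zr \<le> 2 ^ n * (exp (h * n * cnt h 1) + exp (h * n * cnt h (- 1)))"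
    using Zr_pos by (simp add: field_simps)
  moreover have "(\<Sum>S | lines S. rw S * exp (h * n) ^ Pn S) / Zr = (\<Sum>S | lines S. pr S * exp (h * n * Pn S))"
    by (simp add: pr_def sum_divide_distrib exp_of_nat_mult[symmetric] mult_ac)
  ultimately show ?thesis by simp
qed

definition dev :: "real \<Rightarrow> real" where
  "dev m = (\<Sum>S | lines S. pr S * \<bar>Pn S / n - m\<bar>)"

lemma Pn_le: "Pn S \<le> n"
proof -
  have "card {j \<in> {0..<int n}. ((int n - 1, j), True) \<in> S} \<le> card {0..<int n}"
    by (intro card_mono) auto
  then show ?thesis by (simp add: Pn_def)
qed

text \<open>Chernoff's bound. The deviation is at most 1, and outside the window 2 e one of the two
  exponentials is at least 1, while each of them has mean at most 2^(n+1) exp (- h n^2 e).\<close>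

lemma dev_le:
  fixes h e m :: real
  assumes h: "h > 0" and e: "e > 0" and m: "0 \<le> m" "m \<le> 1"
    and up: "\<And>v. v \<in> {1, - 1} \<Longrightarrow> cnt h v \<le> n * (m + e)"
    and low: "\<And>v. v \<in> {1, - 1} \<Longrightarrow> cnt (- h) v \<ge> n * (m - e)"
  shows "dev m \<le> 2 * e + 2 ^ (n + 2) * exp (- h * n * n * e)"
proof -
  have n0: "real n > 0" using n2 by simp
  have pt: "\<bar>Pn S / n - m\<bar> \<le> 2 * e + (exp (- h * n * n * (m + 2 * e)) * exp (h * n * Pn S) + exp (h * n * n * (m - 2 * e)) * exp (- h * n * Pn S))" for S
  proof -
    have le1: "\<bar>Pn S / n - m\<bar> \<le> 1"
    proof -
      have "Pn S / n \<le> 1" "0 \<le> Pn S / n" using Pn_le[of S] n0 by (simp_all add: field_simps)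
      then show ?thesis using m by linarith
    qed
    have e1: "exp (- h * n * n * (m + 2 * e)) * exp (h * n * Pn S) = exp (h * n * n * (Pn S / n - m - 2 * e))"
      using n0 by (simp add: exp_add[symmetric] field_simps)
    have e2: "exp (h * n * n * (m - 2 * e)) * exp (- h * n * Pn S) = exp (h * n * n * (m - 2 * e - Pn S / n))"
      using n0 by (simp add: exp_add[symmetric] field_simps)
    have big: "1 \<le> exp (h * n * n * x)" if "x \<ge> 0" for x
      using that h by simp
    have p1: "0 < exp (h * n * n * (Pn S / n - m - 2 * e))" and p2: "0 < exp (h * n * n * (m - 2 * e - Pn S / n))" by simp_all
    consider "\<bar>Pn S / n - m\<bar> \<le> 2 * e" | "Pn S / n - m - 2 * e \<ge> 0" | "m - 2 * e - Pn S / n \<ge> 0" by linarith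
    then show ?thesis
    proof cases
      case 1
      then show ?thesis unfolding e1 e2 using p1 p2 by linarith
    next
      case 2
      then show ?thesis unfolding e1 e2 using big[OF 2] le1 e p2 by linarith
    next
      case 3
      then show ?thesis unfolding e1 e2 using big[OF 3] le1 e p1 by linarith
    qed
  qed
  have "dev m \<le> (\<Sum>S | lines S. pr S * (2 * e + (exp (- h * n * n * (m + 2 * e)) * exp (h * n * Pn S) + exp (h * n * n * (m - 2 * e)) * exp (- h * n * Pn S))))"
    unfolding dev_def by (intro sum_mono mult_left_mono pt pr_nonneg)
  also have "\<dots> = 2 * e * (\<Sum>S | lines S. pr S)
      + exp (- h * n * n * (m + 2 * e)) * (\<Sum>S | lines S. pr S * exp (h * n * Pn S))
      + exp (h * n * n * (m - 2 * e)) * (\<Sum>S | lines S. pr S * exp (- h * n * Pn S))"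
    unfolding sum_distrib_left sum.distrib[symmetric] by (intro sum.cong refl) (simp add: algebra_simps)
  also have "\<dots> \<le> 2 * e * 1 + 2 ^ n * (2 * exp (- h * n * n * e)) + 2 ^ n * (2 * exp (- h * n * n * e))"
  proof (intro add_mono)
    have "exp (- h * n * n * (m + 2 * e)) * (\<Sum>S | lines S. pr S * exp (h * n * Pn S))
      \<le> exp (- h * n * n * (m + 2 * e)) * (2 ^ n * (exp (h * n * cnt h 1) + exp (h * n * cnt h (- 1))))"
      by (intro mult_left_mono exp_moment_le) simp
    also have "\<dots> \<le> exp (- h * n * n * (m + 2 * e)) * (2 ^ n * (exp (h * n * (n * (m + e))) + exp (h * n * (n * (m + e)))))"
      using up h by (intro mult_left_mono add_mono iffD2[OF exp_le_cancel_iff]) auto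
    also have "\<dots> = 2 ^ n * (2 * exp (- h * n * n * e))"
    proof -
      have "exp (- h * n * n * (m + 2 * e)) * exp (h * n * (n * (m + e))) = exp (- h * n * n * e)"
        by (simp add: exp_add[symmetric] algebra_simps)
      then show ?thesis by (simp add: algebra_simps)
    qed
    finally show "exp (- h * n * n * (m + 2 * e)) * (\<Sum>S | lines S. pr S * exp (h * n * Pn S)) \<le> 2 ^ n * (2 * exp (- h * n * n * e))" .
    have "exp (h * n * n * (m - 2 * e)) * (\<Sum>S | lines S. pr S * exp (- h * n * Pn S))
      \<le> exp (h * n * n * (m - 2 * e)) * (2 ^ n * (exp (- h * n * cnt (- h) 1) + exp (- h * n * cnt (- h) (- 1))))"
      by (intro mult_left_mono exp_moment_le) simp
    also have "\<dots> \<le> exp (h * n * n * (m - 2 * e)) * (2 ^ n * (exp (- h * n * (n * (m - e))) + exp (- h * n * (n * (m - e)))))"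
    proof -
      have "exp (- h * n * cnt (- h) v) \<le> exp (- h * n * (n * (m - e)))" if "v \<in> {1, - 1}" for v
        using mult_left_mono[OF low[OF that], of "h * n"] h by simp
      then show ?thesis by (intro mult_left_mono add_mono) simp_all
    qed
    also have "\<dots> = 2 ^ n * (2 * exp (- h * n * n * e))"
    proof -
      have "exp (h * n * n * (m - 2 * e)) * exp (- h * n * (n * (m - e))) = exp (- h * n * n * e)"
        by (simp add: exp_add[symmetric] algebra_simps)
      then show ?thesis by (simp add: algebra_simps)
    qed
    finally show "exp (h * n * n * (m - 2 * e)) * (\<Sum>S | lines S. pr S * exp (- h * n * Pn S)) \<le> 2 ^ n * (2 * exp (- h * n * n * e))" .
  qed (simp add: sum_pr)
  finally show ?thesis by (simp add: power_add)
qed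

lemma norm_cis_minus_one_le: "norm (cis x - 1) \<le> \<bar>x\<bar>"
proof -
  have "norm (cis x - 1) = 2 * \<bar>sin (x / 2)\<bar>" by (simp add: cis_conv_exp dist_exp_i_1)
  also have "\<dots> \<le> \<bar>x\<bar>" using abs_sin_x_le_abs_x[of "x / 2"] by simp
  finally show ?thesis .
qed

text \<open>Let p be the probability, q its twisted version and z the twisted total mass. In p - I =
  (p - ph q) + ph (q - I z) - I (1 - ph z) the outer terms are the price of the twist and the middle
  one is linear in the sector sums, so that z may be arbitrarily small.\<close>

lemma prob_estimate:
  fixes m \<tau> \<delta> :: real and I :: complex
  assumes x: "x \<in> V" and t: "t \<in> {1..6}"
    and nz: "\<And>e1 e2 w1 w2. w1 \<in> rts (cs e1 * cis \<tau>) \<Longrightarrow> w2 \<in> rts (cs e2) \<Longrightarrow> dl \<alpha> \<beta> \<gamma> w1 w2 \<noteq> 0"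
    and close: "\<And>e1 e2. norm (Ebil \<alpha> \<beta> \<gamma> t (mom \<alpha> \<beta> \<gamma> (cs e1 * cis \<tau>) (cs e2) (\<lambda>_ _. 1))
          (mom \<alpha> \<beta> \<gamma> (cs e1 * cis \<tau>) (cs e2) (\<lambda>w1 _. w1))
          (mom \<alpha> \<beta> \<gamma> (cs e1 * cis \<tau>) (cs e2) (\<lambda>_ w2. w2))
          (mom \<alpha> \<beta> \<gamma> (cs e1 * cis \<tau>) (cs e2) (\<lambda>w1 w2. w1 * w2)) - I) \<le> \<delta>"
  shows "norm (of_real (\<Sum>S | lines S \<and> ty x S = t. pr S) - I) \<le> (1 + norm I) * (\<bar>\<tau>\<bar> * n * dev m) + 2 * \<delta>"
proof -
  have n0: "real n > 0" using n2 by simp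
  define u where "u = cis \<tau>"
  \<comment> \<open>\<open>ph\<close> is the inverse of the phase exp (i tau n m), which u^P
    approximates when P / n is close to m.\<close>
  define ph where "ph = cis (- \<tau> * n * m)"
  have phase: "norm (1 - ph * u ^ Pn S) \<le> \<bar>\<tau>\<bar> * n * \<bar>Pn S / n - m\<bar>" for S
  proof -
    have "u ^ Pn S = cis (Pn S * \<tau>)" unfolding u_def by (rule Complex.DeMoivre)
    then have "ph * u ^ Pn S = cis (\<tau> * n * (Pn S / n - m))"
      using n0 by (simp add: ph_def cis_mult algebra_simps)
    then have "norm (1 - ph * u ^ Pn S) \<le> \<bar>\<tau> * n * (Pn S / n - m)\<bar>"
      using norm_cis_minus_one_le[of "\<tau> * n * (Pn S / n - m)"] by (simp add: norm_minus_commute)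
    then show ?thesis by (simp add: abs_mult)
  qed
  have dv: "norm ((\<Sum>S | lines S \<and> R S. of_real (pr S)) - ph * (\<Sum>S | lines S \<and> R S. of_real (pr S) * u ^ Pn S)) \<le> \<bar>\<tau>\<bar> * n * dev m"
    for R
  proof -
    have "norm ((\<Sum>S | lines S \<and> R S. of_real (pr S)) - ph * (\<Sum>S | lines S \<and> R S. of_real (pr S) * u ^ Pn S))
      = norm (\<Sum>S | lines S \<and> R S. of_real (pr S) * (1 - ph * u ^ Pn S))"
      by (simp add: sum_distrib_left sum_subtractf right_diff_distrib mult_ac)
    also have "\<dots> \<le> (\<Sum>S | lines S \<and> R S. pr S * (\<bar>\<tau>\<bar> * n * \<bar>Pn S / n - m\<bar>))"
      by (intro sum_norm_le) (simp add: norm_mult pr_nonneg mult_left_mono phase)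
    also have "\<dots> \<le> (\<Sum>S | lines S. pr S * (\<bar>\<tau>\<bar> * n * \<bar>Pn S / n - m\<bar>))"
      by (intro sum_mono2 finite_lines') (auto simp: pr_nonneg)
    finally show ?thesis by (simp add: dev_def sum_distrib_left mult_ac)
  qed
  have main: "norm ((\<Sum>S | lines S \<and> ty x S = t. of_real (pr S) * u ^ Pn S) - I * (\<Sum>S | lines S. of_real (pr S) * u ^ Pn S)) \<le> 2 * \<delta>"
  proof -
    let ?N = "\<lambda>e1 e2. NN \<alpha> \<beta> \<gamma> x t (cs e1 * u) (cs e2)" and ?D = "\<lambda>e1 e2. DD \<alpha> \<beta> \<gamma> (cs e1 * u) (cs e2)"
    have "2 * of_real Zr * ((\<Sum>S | lines S \<and> ty x S = t. of_real (pr S) * u ^ Pn S) - I * (\<Sum>S | lines S. of_real (pr S) * u ^ Pn S))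
      = 2 * (\<Sum>S | lines S \<and> ty x S = t. of_real (rw S) * u ^ Pn S) - I * (2 * (\<Sum>S | lines S. of_real (rw S) * u ^ Pn S))"
      using Zr_pos by (simp add: pr_def sum_divide_distrib[symmetric] field_simps)
    also have "\<dots> = (\<Sum>e1\<in>UNIV. \<Sum>e2\<in>UNIV. cc e1 e2 * (?N e1 e2 - I * ?D e1 e2))"
      unfolding sector_NN sector_DD by (simp add: UNIV_bool algebra_simps)
    finally have "2 * Zr * norm ((\<Sum>S | lines S \<and> ty x S = t. of_real (pr S) * u ^ Pn S) - I * (\<Sum>S | lines S. of_real (pr S) * u ^ Pn S))
      = norm (\<Sum>e1\<in>UNIV. \<Sum>e2\<in>UNIV. cc e1 e2 * (?N e1 e2 - I * ?D e1 e2))"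
      using Zr_pos by (metis (no_types, lifting) abs_of_pos norm_mult norm_numeral norm_of_real)
    also have "\<dots> \<le> (\<Sum>e1\<in>(UNIV :: bool set). \<Sum>e2\<in>(UNIV :: bool set). Zr * \<delta>)"
    proof (intro sum_norm_le)
      fix e1 e2
      have c1: "norm (cs e) = 1" for e by (simp add: cs_def)
      then have c0: "cs e \<noteq> 0" for e by (simp add: cs_def)
      have "?N e1 e2 = ?D e1 e2 * Ebil \<alpha> \<beta> \<gamma> t (mom \<alpha> \<beta> \<gamma> (cs e1 * u) (cs e2) (\<lambda>_ _. 1))
          (mom \<alpha> \<beta> \<gamma> (cs e1 * u) (cs e2) (\<lambda>w1 _. w1))
          (mom \<alpha> \<beta> \<gamma> (cs e1 * u) (cs e2) (\<lambda>_ w2. w2))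
          (mom \<alpha> \<beta> \<gamma> (cs e1 * u) (cs e2) (\<lambda>w1 w2. w1 * w2))"
        by (rule NN_eq) (use x t nz c0 in \<open>auto simp: u_def\<close>)
      then have "cc e1 e2 * (?N e1 e2 - I * ?D e1 e2) = cc e1 e2 * ?D e1 e2 * (Ebil \<alpha> \<beta> \<gamma> t (mom \<alpha> \<beta> \<gamma> (cs e1 * u) (cs e2) (\<lambda>_ _. 1))
          (mom \<alpha> \<beta> \<gamma> (cs e1 * u) (cs e2) (\<lambda>w1 _. w1))
          (mom \<alpha> \<beta> \<gamma> (cs e1 * u) (cs e2) (\<lambda>_ w2. w2))
          (mom \<alpha> \<beta> \<gamma> (cs e1 * u) (cs e2) (\<lambda>w1 w2. w1 * w2)) - I)"
        by (simp add: algebra_simps)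
      moreover have "norm (cc e1 e2 * ?D e1 e2) \<le> Zr"
        using norm_DD_le_Zr[of "cs e1 * u" "cs e2"] c1 by (simp add: norm_mult u_def)
      ultimately show "norm (cc e1 e2 * (?N e1 e2 - I * ?D e1 e2)) \<le> Zr * \<delta>"
        using close[of e1 e2] Zr_pos unfolding u_def[symmetric]
        by (simp only: norm_mult) (intro mult_mono, auto simp: norm_mult)
    qed
    also have "\<dots> = 2 * Zr * (2 * \<delta>)" by (simp add: UNIV_bool)
    finally show ?thesis using Zr_pos by simp
  qed
  have one: "norm (1 - ph * (\<Sum>S | lines S. of_real (pr S) * u ^ Pn S)) \<le> \<bar>\<tau>\<bar> * n * dev m"
  proof -
    have "(\<Sum>S | lines S. of_real (pr S)) = (1 :: complex)" using sum_pr by (simp flip: of_real_sum)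
    then show ?thesis using dv[of "\<lambda>_. True"] by simp
  qed
  define p q z where "p = (\<Sum>S | lines S \<and> ty x S = t. complex_of_real (pr S))"
    and "q = (\<Sum>S | lines S \<and> ty x S = t. of_real (pr S) * u ^ Pn S)"
    and "z = (\<Sum>S | lines S. of_real (pr S) * u ^ Pn S)"
  have "norm (p - I) = norm ((p - ph * q) + (ph * (q - I * z) - I * (1 - ph * z)))"
    by (simp add: algebra_simps)
  also have "\<dots> \<le> norm (p - ph * q) + (norm (ph * (q - I * z)) + norm (I * (1 - ph * z)))"
    by (intro norm_triangle_le add_left_mono order_trans[OF norm_triangle_ineq4]) simp
  also have "\<dots> \<le> \<bar>\<tau>\<bar> * n * dev m + (2 * \<delta> + norm I * (\<bar>\<tau>\<bar> * n * dev m))"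
    using dv[of "\<lambda>S. ty x S = t"] main one
    by (intro add_mono) (auto simp: norm_mult ph_def p_def q_def z_def intro!: mult_left_mono)
  finally show ?thesis by (simp add: p_def algebra_simps)
qed

end

section \<open>Grid sums near the zeros of \<open>Delta\<close>\<close>

context torus
begin

lemma norm_rts:
  assumes "w \<in> rts v" "norm v = 1"
  shows "norm w = 1"
proof -
  have "norm ((- w) ^ n) = 1" using assms by (simp add: rts_def)
  then have "norm w ^ n = 1" by (simp add: norm_power)
  then show ?thesis using n2 power_eq_imp_eq_base[of "norm w" n 1] by simp
qed

lemma sum_power_rts:
  assumes u: "u \<noteq> 0"
  shows "(\<Sum>w\<in>rts u. w ^ k) = (if n dvd k then of_nat n * (- 1) ^ k * u ^ (k div n) else 0)"
proof -
  obtain X where X: "X ^ n = u" using exists_nth_root by auto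
  then have X0: "X \<noteq> 0" using u n2 by auto
  have "(\<Sum>w\<in>rts u. w ^ k) = (\<Sum>i\<in>{0..<int n}. (- (X * ee i)) ^ k)"
    using sum.reindex_bij_betw[OF bij_rts[OF X0], of "\<lambda>w. w ^ k"] X by simp
  also have "\<dots> = (\<Sum>i\<in>{0..<int n}. (- X) ^ k * ee (i * int k))"
    by (intro sum.cong refl) (simp add: power_mult_distrib[of "- X", simplified] ee_power mult.commute)
  also have "\<dots> = (- X) ^ k * (if n dvd k then of_nat n else 0)"
    by (simp add: sum_distrib_left[symmetric] sum_ee)
  also have "\<dots> = (if n dvd k then of_nat n * (- 1) ^ k * u ^ (k div n) else 0)"
    by (auto simp: X[symmetric] power_mult[symmetric] power_minus[of X])
  finally show ?thesis .
qed

text \<open>On the grid (- B w)^n = u B^n, so A + B w divides A^n - u B^n and the resolvent is a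
  polynomial in w of degree below n. Of the powers that occur, only w^0 in the first sum and w^n in
  the second have a nonzero grid sum.\<close>

lemma resolvent_sum:
  assumes u: "u \<noteq> 0" and nz: "A ^ n - u * B ^ n \<noteq> 0"
  shows "(\<Sum>w\<in>rts u. 1 / (A + B * w)) = of_nat n * A ^ (n - 1) / (A ^ n - u * B ^ n)" (is ?S1)
    and "(\<Sum>w\<in>rts u. w / (A + B * w)) = - of_nat n * u * B ^ (n - 1) / (A ^ n - u * B ^ n)" (is ?S2)
proof -
  obtain n' where n': "n = Suc n'" using n2 by (cases n) auto
  have factor: "A ^ n - u * B ^ n = (A + B * w) * (\<Sum>k<n. (- B) ^ k * A ^ (n - 1 - k) * w ^ k)" if "w \<in> rts u" for w
  proof -
    have "- (B * w) = (- w) * B" by simp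
    then have "u * B ^ n = (- (B * w)) ^ n" using that by (simp only: rts_def power_mult_distrib mem_Collect_eq)
    then have "A ^ n - u * B ^ n = A ^ n - (- (B * w)) ^ n" by simp
    also have "\<dots> = (A - - (B * w)) * (\<Sum>k<n. (- (B * w)) ^ k * A ^ (n - 1 - k))"
    proof -
      have "(- (B * w)) ^ n - A ^ n = (- (B * w) - A) * (\<Sum>k<n. (- (B * w)) ^ k * A ^ (n - 1 - k))"
        unfolding n' using diff_power_eq_sum[of "- (B * w)" n' A] by simp
      then show ?thesis by (simp add: algebra_simps)
    qed
    also have "(\<Sum>k<n. (- (B * w)) ^ k * A ^ (n - 1 - k)) = (\<Sum>k<n. (- B) ^ k * A ^ (n - 1 - k) * w ^ k)"
      by (intro sum.cong refl) (simp add: power_mult_distrib[symmetric] mult_ac)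
    finally show ?thesis by simp
  qed
  have inv: "h / (A + B * w) = (\<Sum>k<n. (- B) ^ k * A ^ (n - 1 - k) * (h * w ^ k)) / (A ^ n - u * B ^ n)" if "w \<in> rts u" for w h
  proof -
    have "A + B * w \<noteq> 0" using factor[OF that] nz by auto
    moreover have "h * (A ^ n - u * B ^ n) = (A + B * w) * (\<Sum>k<n. (- B) ^ k * A ^ (n - 1 - k) * (h * w ^ k))"
      unfolding factor[OF that] by (simp add: sum_distrib_left mult_ac)
    ultimately show ?thesis using nz by (simp add: divide_simps mult_ac)
  qed
  have "(\<Sum>w\<in>rts u. 1 / (A + B * w)) = (\<Sum>w\<in>rts u. (\<Sum>k<n. (- B) ^ k * A ^ (n - 1 - k) * (1 * w ^ k)) / (A ^ n - u * B ^ n))"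
    by (intro sum.cong refl inv)
  also have "\<dots> = (\<Sum>k<n. (- B) ^ k * A ^ (n - 1 - k) * (\<Sum>w\<in>rts u. w ^ k)) / (A ^ n - u * B ^ n)"
    unfolding sum_divide_distrib[symmetric] by (subst sum.swap) (simp add: sum_distrib_left)
  also have "(\<Sum>k<n. (- B) ^ k * A ^ (n - 1 - k) * (\<Sum>w\<in>rts u. w ^ k)) = (\<Sum>k<n. if k = 0 then of_nat n * A ^ (n - 1) else 0)"
    by (intro sum.cong refl) (auto simp: sum_power_rts[OF u] dest: dvd_imp_le)
  finally show ?S1 using n2 by simp
  have "(\<Sum>w\<in>rts u. w / (A + B * w)) = (\<Sum>w\<in>rts u. (\<Sum>k<n. (- B) ^ k * A ^ (n - 1 - k) * (w * w ^ k)) / (A ^ n - u * B ^ n))"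
    by (intro sum.cong refl inv)
  also have "\<dots> = (\<Sum>k<n. (- B) ^ k * A ^ (n - 1 - k) * (\<Sum>w\<in>rts u. w ^ Suc k)) / (A ^ n - u * B ^ n)"
    unfolding sum_divide_distrib[symmetric] by (subst sum.swap) (simp add: sum_distrib_left)
  also have "(\<Sum>k<n. (- B) ^ k * A ^ (n - 1 - k) * (\<Sum>w\<in>rts u. w ^ Suc k)) = (\<Sum>k<n. if k = n - 1 then - of_nat n * u * B ^ (n - 1) else 0)"
  proof (intro sum.cong refl)
    fix k assume k: "k \<in> {..<n}"
    show "(- B) ^ k * A ^ (n - 1 - k) * (\<Sum>w\<in>rts u. w ^ Suc k) = (if k = n - 1 then - of_nat n * u * B ^ (n - 1) else 0)"
    proof (cases "k = n - 1")
      case True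
      then have "Suc k = n" using n2 by simp
      have m: "(- B) ^ k * (- 1) ^ Suc k = - (B ^ k)" by (cases "even k") simp_all
      have "(\<Sum>w\<in>rts u. w ^ Suc k) = of_nat n * (- 1) ^ Suc k * u"
        using \<open>Suc k = n\<close> n2 unfolding sum_power_rts[OF u] by simp
      then have X: "(- B) ^ k * A ^ (n - 1 - k) * (\<Sum>w\<in>rts u. w ^ Suc k) = of_nat n * u * ((- B) ^ k * (- 1) ^ Suc k)"
        using True by (simp only: mult_ac diff_self_eq_0 power_0 mult_1)
      show ?thesis unfolding X m using True by simp
    next
      case False
      then have "\<not> n dvd Suc k" using k by (auto dest: dvd_imp_le)
      then show ?thesis using False by (simp add: sum_power_rts[OF u] del: power_Suc)
    qed
  qed
  finally show ?S2 using n2 by simp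
qed

text \<open>(r^2 - 1) / |w - r z|^2 is the Poisson kernel, the real part of an affine function of
  the resolvent 1 / (r z - w), so its grid sum is explicit. The radius 1 + K / n makes r^n >= 1 + K,
  which keeps the denominator r^n z^n - v' away from 0. Counting near points and summing over far
  ones thus avoids listing the grid by angle.\<close>

lemma poisson_sum:
  fixes K :: real and v z :: complex
  assumes v: "norm v = 1" and z: "norm z = 1" and K: "K > 0"
  defines "r \<equiv> 1 + K / n"
  shows "(\<Sum>w\<in>rts v. 1 / (n ^ 2 * norm (w - r * z) ^ 2)) \<le> (1 + 2 / K) / (2 * K)"
proof -
  have n0: "real n > 0" using n2 by simp
  have r1: "r > 1" using K n0 by (simp add: r_def)
  have v0: "v \<noteq> 0" using v by auto
  define R where "R = (of_real r * z) ^ n"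
  have nR: "norm R = r ^ n" using z r1 by (simp add: R_def norm_mult norm_power)
  have rn: "r ^ n \<ge> 1 + K"
  proof -
    have "1 + real n * (K / n) \<le> (1 + K / n) ^ n" using K n0 by (intro Bernoulli_inequality) (simp add: order_trans[of _ 0])
    then show ?thesis using n0 by (simp add: r_def)
  qed
  define v' where "v' = v * (- 1) ^ n"
  have nv': "norm v' = 1" using v by (simp add: v'_def norm_mult norm_power)
  have nz: "R - v' \<noteq> 0" using nR nv' rn K by auto
  have ptw: "(r ^ 2 - 1) / norm (w - r * z) ^ 2 = Re (2 * (of_real r * z) * (1 / (of_real r * z + (- 1) * w)) - 1)"
    if w: "w \<in> rts v" for w
  proof -
    have nw: "norm w = 1" by (rule norm_rts[OF w v])
    define d where "d = of_real r * z - w"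
    have "norm (of_real r * z) = r" using z r1 by (simp add: norm_mult)
    then have "d \<noteq> 0" using nw r1 by (auto simp: d_def)
    have "2 * (of_real r * z) * (1 / (of_real r * z + (- 1) * w)) - 1 = (of_real r * z + w) / d"
      using \<open>d \<noteq> 0\<close> by (simp add: d_def field_simps)
    also have "\<dots> = (of_real r * z + w) * cnj d / of_real (norm d ^ 2)"
      using \<open>d \<noteq> 0\<close> by (simp add: complex_div_cnj[of _ d])
    finally have "Re (2 * (of_real r * z) * (1 / (of_real r * z + (- 1) * w)) - 1) = Re ((of_real r * z + w) * cnj d) / norm d ^ 2"
      by (simp only: Re_divide_of_real)
    also have "Re ((of_real r * z + w) * cnj d) = norm (of_real r * z) ^ 2 - norm w ^ 2"
    proof -
      have "Re ((a + w) * cnj (a - w)) = norm a ^ 2 - norm w ^ 2" for a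
        unfolding cmod_power2 by (simp add: power2_eq_square algebra_simps)
      then show ?thesis unfolding d_def .
    qed
    also have "\<dots> = r ^ 2 - 1" using nw z r1 by (simp add: norm_mult)
    also have "norm d = norm (w - r * z)" by (simp add: d_def norm_minus_commute)
    finally show ?thesis by simp
  qed
  have "(\<Sum>w\<in>rts v. (r ^ 2 - 1) / norm (w - r * z) ^ 2) = Re (\<Sum>w\<in>rts v. 2 * (of_real r * z) * (1 / (of_real r * z + (- 1) * w)) - 1)"
    by (simp add: ptw cong: sum.cong)
  also have "(\<Sum>w\<in>rts v. 2 * (of_real r * z) * (1 / (of_real r * z + (- 1) * w)) - 1)
     = 2 * (of_real r * z) * (\<Sum>w\<in>rts v. 1 / (of_real r * z + (- 1) * w)) - of_nat n"
    unfolding sum_subtractf sum_distrib_left using sum_power_rts[OF v0, of 0] by simp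
  also have "\<dots> = of_nat n * ((R + v') / (R - v'))"
  proof -
    have nz': "(of_real r * z) ^ n - v * (- 1) ^ n \<noteq> 0" using nz by (simp add: R_def v'_def)
    have "(of_real r * z) * (of_real r * z) ^ (n - 1) = R" using n2 by (simp add: R_def power_eq_if)
    moreover have "2 * x * (of_nat n * p / q) = of_nat n * (2 * (x * p) / q)" for x p q :: complex
      by (simp add: mult_ac)
    moreover have "(of_real r * z) ^ n - v * (- 1) ^ n = R - v'" by (simp only: R_def v'_def)
    ultimately have "2 * (of_real r * z) * (\<Sum>w\<in>rts v. 1 / (of_real r * z + (- 1) * w)) = of_nat n * (2 * R / (R - v'))"
      unfolding resolvent_sum(1)[OF v0 nz'] by (simp only:)
    then show ?thesis using nz by (simp add: field_simps)
  qed
  also have "Re (of_nat n * ((R + v') / (R - v'))) \<le> n * norm ((R + v') / (R - v'))"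
    using complex_Re_le_cmod[of "of_nat n * ((R + v') / (R - v'))"] by (simp add: norm_mult norm_divide)
  also have "\<dots> \<le> n * ((r ^ n + 1) / (r ^ n - 1))"
  proof (intro mult_left_mono)
    have "norm (R + v') \<le> r ^ n + 1" using norm_triangle_ineq[of R v'] nR nv' by simp
    moreover have "norm (R - v') \<ge> r ^ n - 1" using norm_triangle_ineq2[of R v'] nR nv' by simp
    ultimately show "norm ((R + v') / (R - v')) \<le> (r ^ n + 1) / (r ^ n - 1)"
      using rn K by (simp add: norm_divide frac_le)
  qed simp
  also have "\<dots> \<le> n * (1 + 2 / K)"
    using rn K by (intro mult_left_mono) (auto simp: field_simps)
  finally have A: "(\<Sum>w\<in>rts v. (r ^ 2 - 1) / norm (w - r * z) ^ 2) \<le> n * (1 + 2 / K)" .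
  have "r ^ 2 - 1 = 2 * (K / n) + (K / n) ^ 2" by (simp add: r_def power2_eq_square algebra_simps)
  then have B: "r ^ 2 - 1 \<ge> 2 * K / n" by simp
  have "2 * K * n * (\<Sum>w\<in>rts v. 1 / (n ^ 2 * norm (w - r * z) ^ 2)) = (\<Sum>w\<in>rts v. (2 * K / n) / norm (w - r * z) ^ 2)"
    using n0 by (simp add: sum_distrib_left field_simps power2_eq_square)
  also have "\<dots> \<le> (\<Sum>w\<in>rts v. (r ^ 2 - 1) / norm (w - r * z) ^ 2)"
    using B by (intro sum_mono divide_right_mono) auto
  also note A
  finally have "n * (2 * K * (\<Sum>w\<in>rts v. 1 / (n ^ 2 * norm (w - r * z) ^ 2))) \<le> n * (1 + 2 / K)"
    by (simp only: mult_ac)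
  then have "2 * K * (\<Sum>w\<in>rts v. 1 / (n ^ 2 * norm (w - r * z) ^ 2)) \<le> 1 + 2 / K"
    using n0 mult_le_cancel_left_pos by blast
  then show ?thesis using K by (simp add: pos_le_divide_eq mult.commute)
qed

text \<open>A grid point within K / n of z is within 2 K / n of r z, hence accounts for at least 1 /
  (4 K^2) of the sum in \<open>poisson_sum\<close>.\<close>

lemma near_card:
  fixes K :: real and v z :: complex
  assumes v: "norm v = 1" and z: "norm z = 1" and K: "K > 0"
  shows "card {w\<in>rts v. norm (w - z) \<le> K / n} \<le> 2 * K + 4"
proof -
  have n0: "real n > 0" using n2 by simp
  define r where "r = 1 + K / n"
  have d: "norm (w - r * z) \<le> norm (w - z) + K / n" for w
  proof -
    have "w - r * z = (w - z) - of_real (K / n) * z" by (simp add: r_def algebra_simps)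
    also have "norm \<dots> \<le> norm (w - z) + norm (of_real (K / n) * z)" by (rule norm_triangle_ineq4)
    finally show ?thesis using z K n0 by (simp add: norm_mult norm_divide)
  qed
  have pos: "norm (w - r * z) > 0" if "w \<in> rts v" for w
  proof -
    have "r > 1" using K n0 by (simp add: r_def)
    then have "norm (of_real r * z) > 1" using z by (simp add: norm_mult)
    then show ?thesis using norm_rts[OF that v] by auto
  qed
  let ?B = "{w\<in>rts v. norm (w - z) \<le> K / n}"
  have "card ?B * (1 / (4 * K ^ 2)) = (\<Sum>w\<in>?B. 1 / (4 * K ^ 2))" by simp
  also have "\<dots> \<le> (\<Sum>w\<in>?B. 1 / (n ^ 2 * norm (w - r * z) ^ 2))"
  proof (rule sum_mono)
    fix w assume w: "w \<in> ?B"
    then have "n * norm (w - r * z) \<le> 2 * K" using d[of w] n0 by (simp add: field_simps)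
    then have "(n * norm (w - r * z)) ^ 2 \<le> (2 * K) ^ 2" by (intro power_mono) auto
    then have "n ^ 2 * norm (w - r * z) ^ 2 \<le> 4 * K ^ 2" by (simp add: power_mult_distrib)
    moreover have "0 < n ^ 2 * norm (w - r * z) ^ 2" using pos[of w] w n0 by simp
    ultimately show "1 / (4 * K ^ 2) \<le> 1 / (n ^ 2 * norm (w - r * z) ^ 2)" by (simp add: frac_le)
  qed
  also have "\<dots> \<le> (\<Sum>w\<in>rts v. 1 / (n ^ 2 * norm (w - r * z) ^ 2))"
    by (intro sum_mono2 finite_rts) auto
  also have "\<dots> \<le> (1 + 2 / K) / (2 * K)" unfolding r_def by (rule poisson_sum[OF v z K])
  finally show ?thesis using K by (simp add: field_simps power2_eq_square)
qed

text \<open>Beyond distance K / n from z, replacing z by r z at most doubles the distance, which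
  costs a factor 4 in the sum of inverse squares.\<close>

lemma far_sum:
  fixes K :: real and v z :: complex
  assumes v: "norm v = 1" and z: "norm z = 1" and K: "K > 0"
  shows "(\<Sum>w | w \<in> rts v \<and> norm (w - z) > K / n. 1 / (n ^ 2 * norm (w - z) ^ 2)) \<le> (2 / K) * (1 + 2 / K)"
proof -
  have n0: "real n > 0" using n2 by simp
  define r where "r = 1 + K / n"
  have d: "norm (w - r * z) \<le> norm (w - z) + K / n" for w
  proof -
    have "w - r * z = (w - z) - of_real (K / n) * z" by (simp add: r_def algebra_simps)
    also have "norm \<dots> \<le> norm (w - z) + norm (of_real (K / n) * z)" by (rule norm_triangle_ineq4)
    finally show ?thesis using z K n0 by (simp add: norm_mult norm_divide)
  qed
  have pos: "norm (w - r * z) > 0" if "w \<in> rts v" for w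
  proof -
    have "r > 1" using K n0 by (simp add: r_def)
    then have "norm (of_real r * z) > 1" using z by (simp add: norm_mult)
    then show ?thesis using norm_rts[OF that v] by auto
  qed
  let ?G = "{w. w \<in> rts v \<and> norm (w - z) > K / n}"
  have "(\<Sum>w\<in>?G. 1 / (n ^ 2 * norm (w - z) ^ 2)) \<le> (\<Sum>w\<in>?G. 4 * (1 / (n ^ 2 * norm (w - r * z) ^ 2)))"
  proof (rule sum_mono)
    fix w assume w: "w \<in> ?G"
    then have "norm (w - r * z) \<le> 2 * norm (w - z)" using d[of w] by simp
    then have "norm (w - r * z) ^ 2 \<le> (2 * norm (w - z)) ^ 2" by (intro power_mono) auto
    then have "n ^ 2 * norm (w - r * z) ^ 2 \<le> n ^ 2 * (4 * norm (w - z) ^ 2)" by (simp add: power_mult_distrib mult_left_mono)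
    moreover have "0 < n ^ 2 * norm (w - r * z) ^ 2" using pos[of w] w n0 by simp
    ultimately have "4 / (n ^ 2 * (4 * norm (w - z) ^ 2)) \<le> 4 / (n ^ 2 * norm (w - r * z) ^ 2)" by (intro divide_left_mono) auto
    then show "1 / (n ^ 2 * norm (w - z) ^ 2) \<le> 4 * (1 / (n ^ 2 * norm (w - r * z) ^ 2))" by simp
  qed
  also have "\<dots> \<le> 4 * (\<Sum>w\<in>rts v. 1 / (n ^ 2 * norm (w - r * z) ^ 2))"
    unfolding sum_distrib_left[symmetric] by (intro mult_left_mono sum_mono2 finite_rts) auto
  also have "\<dots> \<le> 4 * ((1 + 2 / K) / (2 * K))"
    unfolding r_def by (intro mult_left_mono poisson_sum[OF v z K]) simp
  finally show ?thesis using K by (simp add: field_simps)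
qed

end

lemma norm_cis_diff_ge:
  assumes "0 \<le> y" "y \<le> x" "x \<le> 1"
  shows "norm (cis x - cis y) \<ge> (x - y) / 2"
proof -
  have sin_ge: "sin t \<ge> t / 2" if "0 \<le> t" "t \<le> 1" for t :: real
  proof -
    have "sin 0 - 0 / 2 \<le> sin t - t / 2"
    proof (rule DERIV_nonneg_imp_nondecreasing[of 0 t "\<lambda>t. sin t - t / 2"])
      fix s assume s: "0 \<le> s" "s \<le> t"
      have "cos (pi / 3) \<le> cos s" using s that pi_gt3 by (intro cos_monotone_0_pi_le) auto
      then have "0 \<le> cos s - 1 / 2" by (simp add: cos_60)
      moreover have "((\<lambda>t. sin t - t / 2) has_real_derivative cos s - 1 / 2) (at s)"
        by (auto intro!: derivative_eq_intros)
      ultimately show "\<exists>D. ((\<lambda>t. sin t - t / 2) has_real_derivative D) (at s) \<and> 0 \<le> D" by blast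
    qed (use that in simp)
    then show ?thesis by simp
  qed
  have "cis x - cis y = cis y * (cis (x - y) - 1)" by (simp add: cis_mult algebra_simps)
  then have "norm (cis x - cis y) = norm (cis (x - y) - 1)" by (simp add: norm_mult)
  also have "\<dots> \<ge> \<bar>Im (cis (x - y) - 1)\<bar>" by (rule abs_Im_le_cmod)
  finally have "norm (cis x - cis y) \<ge> sin (x - y)" by simp
  then show ?thesis using sin_ge[of "x - y"] assms by simp
qed

text \<open>a^n - b^n is a - b times a sum of n terms, each at least b^(n-1).\<close>

lemma geometric_gap:
  fixes a b :: real
  assumes "0 \<le> b" "b < a" "n > 0"
  shows "b ^ n / (a * (a ^ n - b ^ n)) \<le> 1 / (n * (a - b))"
proof -
  have a: "a > 0" using assms by simp
  obtain n' where n': "n = Suc n'" using assms by (cases n) auto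
  have lt: "b ^ n < a ^ n" using assms by (intro power_strict_mono) auto
  have "a ^ n - b ^ n = (a - b) * (\<Sum>p<n. a ^ p * b ^ (n - 1 - p))"
    unfolding n' using diff_power_eq_sum[of a n' b] by simp
  also have "\<dots> \<ge> (a - b) * (\<Sum>p<n. b ^ p * b ^ (n - 1 - p))"
    using assms by (intro mult_left_mono sum_mono mult_right_mono power_mono) auto
  also have "(\<Sum>p<n. b ^ p * b ^ (n - 1 - p)) = n * b ^ (n - 1)"
    by (simp add: power_add[symmetric])
  finally have "n * (a - b) * b ^ (n - 1) \<le> a ^ n - b ^ n" by (simp add: mult_ac)
  then have "a * (n * (a - b) * b ^ (n - 1)) \<le> a * (a ^ n - b ^ n)" using a by (intro mult_left_mono) auto
  moreover have "b ^ n * (n * (a - b)) \<le> a * (n * (a - b) * b ^ (n - 1))"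
  proof -
    have "b * (n * (a - b) * b ^ (n - 1)) \<le> a * (n * (a - b) * b ^ (n - 1))"
      using assms by (intro mult_right_mono) auto
    then show ?thesis unfolding n' by (simp add: mult_ac)
  qed
  ultimately have "b ^ n * (n * (a - b)) \<le> a * (a ^ n - b ^ n)" by linarith
  then show ?thesis using a lt assms by (simp add: field_simps)
qed

context sixv
begin

section \<open>The points of the unit circle where |A| and |B| balance\<close>

definition dlt :: real where "dlt = \<gamma>\<^sup>2 - \<alpha> * \<beta>"
definition kap :: real where "kap = 2 * (\<beta> + \<alpha> * dlt)"
text \<open>The value of Re w at which |A| = |B| for |w| = 1, see
  \<open>norm_A_B_diff\<close>.\<close>

definition c0 :: real where "c0 = (\<alpha>\<^sup>2 + dlt\<^sup>2 - 1 - \<beta>\<^sup>2) / kap"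
text \<open>If c0 lies outside [-1, 1] there is no balance point; clamping then puts zeta at 1 or
  -1. The lower bound \<open>gap_lower\<close> persists, because clamping can only decrease |Re w -
  c0|.\<close>

definition zeta :: complex where "zeta = cis (arccos (max (- 1) (min 1 c0)))"
definition C1 :: real where "C1 = 1 + \<beta> + \<alpha> + dlt"
definition cM :: real where "cM = \<gamma>\<^sup>2 / (dlt + \<beta>)"
definition Mw :: "complex \<Rightarrow> real" where "Mw w = max (norm (Aw w)) (norm (Bw w))"

lemma dlt_pos: "dlt > 0" and kap_pos: "kap > 0" and C1_pos: "C1 > 0" and cM_pos: "cM > 0"
  using pos delta_pos by (auto simp: dlt_def kap_def C1_def cM_def intro!: add_pos_pos divide_pos_pos)

lemma norm_zeta: "norm zeta = 1" "norm (cnj zeta) = 1"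
  by (simp_all add: zeta_def)

lemma Bw_eq: "Bw w = of_real \<alpha> - of_real dlt * w"
  by (simp add: Bw_def dlt_def)

lemma norm_A_B_diff:
  assumes "norm w = 1"
  shows "norm (Aw w) ^ 2 - norm (Bw w) ^ 2 = kap * (Re w - c0)"
proof -
  have w: "Re w ^ 2 + Im w ^ 2 = 1" using assms by (metis cmod_power2 power_one)
  have "norm (Aw w) ^ 2 = 1 + 2 * \<beta> * Re w + \<beta> ^ 2 * (Re w ^ 2 + Im w ^ 2)"
    unfolding cmod_power2 Aw_def by (simp add: power2_eq_square algebra_simps)
  then have "norm (Aw w) ^ 2 = 1 + 2 * \<beta> * Re w + \<beta> ^ 2" by (simp only: w mult_1_right)
  moreover have "norm (Bw w) ^ 2 = \<alpha> ^ 2 - 2 * \<alpha> * dlt * Re w + dlt ^ 2 * (Re w ^ 2 + Im w ^ 2)"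
    unfolding cmod_power2 Bw_eq by (simp add: power2_eq_square algebra_simps)
  then have "norm (Bw w) ^ 2 = \<alpha> ^ 2 - 2 * \<alpha> * dlt * Re w + dlt ^ 2" by (simp only: w mult_1_right)
  moreover have "kap * (Re w - c0) = kap * Re w - (\<alpha>\<^sup>2 + dlt\<^sup>2 - 1 - \<beta>\<^sup>2)"
  proof -
    have "kap * c0 = \<alpha>\<^sup>2 + dlt\<^sup>2 - 1 - \<beta>\<^sup>2" using kap_pos by (simp add: c0_def)
    then show ?thesis by (simp only: right_diff_distrib)
  qed
  moreover have "kap * Re w = 2 * \<beta> * Re w + 2 * \<alpha> * dlt * Re w" by (simp add: kap_def algebra_simps)
  ultimately show ?thesis by linarith
qed

lemma norm_A_B_sum: "norm w = 1 \<Longrightarrow> norm (Aw w) + norm (Bw w) \<le> C1"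
  using norm_triangle_ineq[of 1 "of_real \<beta> * w"] norm_triangle_ineq4[of "of_real \<alpha>" "of_real dlt * w"] pos dlt_pos
  by (simp add: Aw_def Bw_eq C1_def norm_mult)

text \<open>The combination dlt A + beta B is the constant gamma^2, so A and B cannot be small
  together.\<close>

lemma Mw_ge: "Mw w \<ge> cM"
proof -
  have "of_real dlt * Aw w + of_real \<beta> * Bw w = of_real (\<gamma>\<^sup>2)"
    by (simp add: Aw_def Bw_eq dlt_def algebra_simps)
  then have "\<gamma>\<^sup>2 = norm (of_real dlt * Aw w + of_real \<beta> * Bw w)" by (simp add: norm_power)
  also have "\<dots> \<le> dlt * norm (Aw w) + \<beta> * norm (Bw w)"
    using norm_triangle_ineq[of "of_real dlt * Aw w" "of_real \<beta> * Bw w"] dlt_pos pos by (simp add: norm_mult)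
  also have "\<dots> \<le> dlt * Mw w + \<beta> * Mw w"
    using dlt_pos pos by (intro add_mono mult_left_mono) (auto simp: Mw_def)
  finally show ?thesis using dlt_pos pos by (simp add: cM_def field_simps)
qed

text \<open>For |w| = 1 the product of the distances to zeta and its conjugate is 2 |Re w - Re
  zeta|, while |A|^2 - |B|^2 is kap (Re w - c0); divide by |A| + |B| <= C1. The product form also
  records the double zero when the two points merge.\<close>

lemma gap_lower:
  assumes w: "norm w = 1"
  shows "\<bar>norm (Aw w) - norm (Bw w)\<bar> \<ge> kap / (2 * C1) * (norm (w - zeta) * norm (w - cnj zeta))"
proof -
  let ?c = "max (- 1) (min 1 c0)"
  have Rz: "Re zeta = ?c" by (simp add: zeta_def)
  have "\<bar>Re w\<bar> \<le> 1" using abs_Re_le_cmod[of w] w by simp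
  then have clamp: "\<bar>Re w - ?c\<bar> \<le> \<bar>Re w - c0\<bar>" by (auto simp: max_def min_def)
  have "zeta * cnj zeta = 1" "w * cnj w = 1" using norm_zeta w by (simp_all add: complex_norm_square[symmetric])
  then have "(w - zeta) * (w - cnj zeta) = w * (w + cnj w - (zeta + cnj zeta))"
    by (simp add: algebra_simps)
  also have "\<dots> = w * of_real (2 * (Re w - ?c))" by (simp add: complex_add_cnj Rz)
  finally have "norm (w - zeta) * norm (w - cnj zeta) = 2 * \<bar>Re w - ?c\<bar>"
    using w by (metis (no_types, lifting) abs_mult abs_numeral mult_1 norm_mult norm_of_real)
  then have "kap * (norm (w - zeta) * norm (w - cnj zeta)) \<le> 2 * (kap * \<bar>Re w - c0\<bar>)"
    using clamp kap_pos by (simp add: mult_left_mono)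
  also have "kap * \<bar>Re w - c0\<bar> = \<bar>norm (Aw w) ^ 2 - norm (Bw w) ^ 2\<bar>"
    unfolding norm_A_B_diff[OF w] using kap_pos by (simp add: abs_mult)
  also have "\<dots> = \<bar>norm (Aw w) - norm (Bw w)\<bar> * (norm (Aw w) + norm (Bw w))"
    by (simp add: power2_eq_square square_diff_square_factored abs_mult mult.commute)
  also have "\<dots> \<le> \<bar>norm (Aw w) - norm (Bw w)\<bar> * C1"
    by (intro mult_left_mono norm_A_B_sum w) simp
  finally show ?thesis using C1_pos by (simp add: field_simps)
qed

section \<open>Resolvent means over the first variable and their limits\<close>

definition gA :: "complex \<Rightarrow> complex \<Rightarrow> complex" where
  "gA u w = Aw w ^ (n - 1) / (Aw w ^ n - u * Bw w ^ n)"
definition gB :: "complex \<Rightarrow> complex \<Rightarrow> complex" where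
  "gB u w = - u * Bw w ^ (n - 1) / (Aw w ^ n - u * Bw w ^ n)"
text \<open>\<open>GA\<close> and \<open>GB\<close> are the limits of \<open>gA u\<close> and
  \<open>gB u\<close>, in which the larger of the powers A^n and B^n wins. Both are set to 0 at |A|
  = |B|, which holds only on a null set of the circle.\<close>

definition GA :: "complex \<Rightarrow> complex" where
  "GA w = (if norm (Aw w) > norm (Bw w) then 1 / Aw w else 0)"
definition GB :: "complex \<Rightarrow> complex" where
  "GB w = (if norm (Bw w) > norm (Aw w) then 1 / Bw w else 0)"

lemma norm_G_le: "norm (GA w) \<le> 1 / cM" "norm (GB w) \<le> 1 / cM"
  using Mw_ge[of w] cM_pos by (auto simp: GA_def GB_def Mw_def norm_divide max_def frac_le)

lemma norm_diff_power_ge: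
  fixes a b u :: complex
  assumes "norm u = 1"
  shows "norm (a ^ n - u * b ^ n) \<ge> norm a ^ n - norm b ^ n" "norm (a ^ n - u * b ^ n) \<ge> norm b ^ n - norm a ^ n"
  using norm_triangle_ineq2[of "a ^ n" "u * b ^ n"] norm_triangle_ineq2[of "u * b ^ n" "a ^ n"] assms
  by (simp_all add: norm_mult norm_power norm_minus_commute)

text \<open>After subtraction of the limit the numerator contains a power of the smaller modulus,
  and the geometric sum gives the factor 1 / n. The bound is uniform in u on the unit circle, so it
  serves all sectors and all twists.\<close>

lemma resolvent_gap:
  fixes a b u :: complex
  assumes u: "norm u = 1" and ne: "norm a \<noteq> norm b"
  shows "a ^ n - u * b ^ n \<noteq> 0"
    and "norm (a ^ (n - 1) / (a ^ n - u * b ^ n) - (if norm a > norm b then 1 / a else 0)) \<le> 1 / (n * \<bar>norm a - norm b\<bar>)"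
    and "norm (- u * b ^ (n - 1) / (a ^ n - u * b ^ n) - (if norm b > norm a then 1 / b else 0)) \<le> 1 / (n * \<bar>norm a - norm b\<bar>)"
proof -
  have n0: "n > 0" using n2 by simp
  have pe: "x * x ^ (n - 1) = x ^ n" for x :: complex using n0 by (simp add: power_eq_if)
  have per: "x * x ^ (n - 1) = x ^ n" for x :: real using n0 by (simp add: power_eq_if)
  have nz: "a ^ n - u * b ^ n \<noteq> 0"
  proof
    assume "a ^ n - u * b ^ n = 0"
    then have "norm (a ^ n) = norm (u * b ^ n)" by simp
    then have "norm a ^ n = norm b ^ n" using u by (simp add: norm_mult norm_power)
    then show False using ne power_eq_imp_eq_base[of "norm a" n "norm b"] n0 by simp
  qed
  then show "a ^ n - u * b ^ n \<noteq> 0" .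
  have big: "norm (c * y ^ n / (x * (a ^ n - u * b ^ n))) \<le> 1 / (n * (norm x - norm y))"
    if "norm y < norm x" "norm c = 1" "norm (a ^ n - u * b ^ n) \<ge> norm x ^ n - norm y ^ n" for x y c
  proof -
    have x0: "norm x > 0" using that norm_ge_zero[of y] by linarith
    have lt: "norm y ^ n < norm x ^ n" using that n0 by (intro power_strict_mono) auto
    have "norm (c * y ^ n / (x * (a ^ n - u * b ^ n))) = norm y ^ n / (norm x * norm (a ^ n - u * b ^ n))"
      using that by (simp add: norm_divide norm_mult norm_power)
    also have "\<dots> \<le> norm y ^ n / (norm x * (norm x ^ n - norm y ^ n))"
      using that x0 lt nz by (intro divide_left_mono mult_left_mono mult_pos_pos) auto
    also have "\<dots> \<le> 1 / (n * (norm x - norm y))" using that n0 by (intro geometric_gap) auto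
    finally show ?thesis .
  qed
  have small: "norm (c * y ^ (n - 1) / (a ^ n - u * b ^ n)) \<le> 1 / (n * (norm x - norm y))"
    if "norm y < norm x" "norm c = 1" "norm (a ^ n - u * b ^ n) \<ge> norm x ^ n - norm y ^ n" for x y c
  proof (cases "y = 0")
    case True
    then show ?thesis using that n2 by (simp add: power_0_left)
  next
    case False
    have lt: "norm y ^ n < norm x ^ n" using that n0 by (intro power_strict_mono) auto
    have x0: "norm x > 0" and y0: "norm y > 0" using that norm_ge_zero[of y] False by auto
    have "norm (c * y ^ (n - 1) / (a ^ n - u * b ^ n)) = norm y ^ (n - 1) / norm (a ^ n - u * b ^ n)"
      using that by (simp add: norm_divide norm_mult norm_power)
    also have "\<dots> \<le> norm y ^ (n - 1) / (norm x ^ n - norm y ^ n)"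
      using that lt nz by (intro divide_left_mono mult_pos_pos) auto
    also have "\<dots> \<le> 1 / (n * (norm x - norm y))"
    proof -
      have "norm x ^ n - norm y ^ n = (norm x - norm y) * (\<Sum>p<n. norm x ^ p * norm y ^ (n - 1 - p))"
        using diff_power_eq_sum[of "norm x" "n - 1" "norm y"] n0 by simp
      also have "\<dots> \<ge> (norm x - norm y) * (\<Sum>p<n. norm y ^ p * norm y ^ (n - 1 - p))"
        using that by (intro mult_left_mono sum_mono mult_right_mono power_mono) auto
      also have "(\<Sum>p<n. norm y ^ p * norm y ^ (n - 1 - p)) = n * norm y ^ (n - 1)"
        by (simp add: power_add[symmetric])
      finally have "n * (norm x - norm y) * norm y ^ (n - 1) \<le> norm x ^ n - norm y ^ n" by (simp add: mult_ac)
      then show ?thesis using that lt n0 by (simp add: field_simps)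
    qed
    finally show ?thesis .
  qed
  note ge = norm_diff_power_ge[OF u, where a = a and b = b]
  show "norm (a ^ (n - 1) / (a ^ n - u * b ^ n) - (if norm a > norm b then 1 / a else 0)) \<le> 1 / (n * \<bar>norm a - norm b\<bar>)"
  proof (cases "norm b < norm a")
    case True
    then have "a \<noteq> 0" by auto
    then have "a ^ (n - 1) / (a ^ n - u * b ^ n) - 1 / a = u * b ^ n / (a * (a ^ n - u * b ^ n))"
      using nz by (simp add: divide_simps) (simp add: pe[symmetric] mult_ac)
    then show ?thesis using big[OF True u ge(1)] True by simp
  next
    case False
    then have lt: "norm a < norm b" using ne by simp
    show ?thesis using small[OF lt norm_one ge(2)] lt by simp
  qed
  show "norm (- u * b ^ (n - 1) / (a ^ n - u * b ^ n) - (if norm b > norm a then 1 / b else 0)) \<le> 1 / (n * \<bar>norm a - norm b\<bar>)"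
  proof (cases "norm a < norm b")
    case True
    then have "b \<noteq> 0" by auto
    then have "- u * b ^ (n - 1) / (a ^ n - u * b ^ n) - 1 / b = (- 1) * a ^ n / (b * (a ^ n - u * b ^ n))"
      using nz by (simp add: divide_simps) (simp add: pe[symmetric] algebra_simps)
    then show ?thesis using big[OF True _ ge(2), of "- 1"] True by simp
  next
    case False
    then have lt: "norm b < norm a" using ne by simp
    have "norm (- u) = 1" using u by simp
    from small[OF lt this ge(1)] show ?thesis using lt by simp
  qed
qed

lemma mom_eq:
  assumes u: "u \<noteq> 0" and v: "v \<noteq> 0" and nz: "\<And>w. w \<in> rts v \<Longrightarrow> Aw w ^ n - u * Bw w ^ n \<noteq> 0"
  shows "mom \<alpha> \<beta> \<gamma> u v (\<lambda>_ _. 1) = (\<Sum>w\<in>rts v. gA u w) / n"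
    "mom \<alpha> \<beta> \<gamma> u v (\<lambda>w1 _. w1) = (\<Sum>w\<in>rts v. gB u w) / n"
    "mom \<alpha> \<beta> \<gamma> u v (\<lambda>_ w2. w2) = (\<Sum>w\<in>rts v. w * gA u w) / n"
    "mom \<alpha> \<beta> \<gamma> u v (\<lambda>w1 w2. w1 * w2) = (\<Sum>w\<in>rts v. w * gB u w) / n"
proof -
  have n0: "of_nat n \<noteq> (0 :: complex)" using n2 by simp
  have "mom \<alpha> \<beta> \<gamma> u v (\<lambda>w1 w2. h w2 * 1) = (\<Sum>w\<in>rts v. h w * gA u w) / n" for h
  proof -
    have "mom \<alpha> \<beta> \<gamma> u v (\<lambda>w1 w2. h w2 * 1) = (\<Sum>w\<in>rts v. h w * (\<Sum>w1\<in>rts u. 1 / (Aw w + Bw w * w1))) / n ^ 2"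
      unfolding mom_def dl_eq by (subst sum.swap) (simp add: sum_distrib_left)
    also have "\<dots> = (\<Sum>w\<in>rts v. n * (h w * gA u w)) / n ^ 2"
      by (intro arg_cong2[where f = "(/)"] sum.cong refl) (simp add: resolvent_sum(1)[OF u nz] gA_def)
    finally show ?thesis using n0 by (simp add: sum_distrib_left[symmetric] power2_eq_square)
  qed
  from this[of "\<lambda>_. 1"] this[of "\<lambda>w. w"]
  show "mom \<alpha> \<beta> \<gamma> u v (\<lambda>_ _. 1) = (\<Sum>w\<in>rts v. gA u w) / n"
    "mom \<alpha> \<beta> \<gamma> u v (\<lambda>_ w2. w2) = (\<Sum>w\<in>rts v. w * gA u w) / n" by simp_all
  have "mom \<alpha> \<beta> \<gamma> u v (\<lambda>w1 w2. w1 * h w2) = (\<Sum>w\<in>rts v. h w * gB u w) / n" for h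
  proof -
    have "mom \<alpha> \<beta> \<gamma> u v (\<lambda>w1 w2. w1 * h w2) = (\<Sum>w\<in>rts v. h w * (\<Sum>w1\<in>rts u. w1 / (Aw w + Bw w * w1))) / n ^ 2"
      unfolding mom_def dl_eq by (subst sum.swap) (simp add: sum_distrib_left mult.commute)
    also have "\<dots> = (\<Sum>w\<in>rts v. n * (h w * gB u w)) / n ^ 2"
      by (intro arg_cong2[where f = "(/)"] sum.cong refl) (simp add: resolvent_sum(2)[OF u nz] gB_def)
    finally show ?thesis using n0 by (simp add: sum_distrib_left[symmetric] power2_eq_square)
  qed
  from this[of "\<lambda>_. 1"] this[of "\<lambda>w. w"]
  show "mom \<alpha> \<beta> \<gamma> u v (\<lambda>w1 _. w1) = (\<Sum>w\<in>rts v. gB u w) / n"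
    "mom \<alpha> \<beta> \<gamma> u v (\<lambda>w1 w2. w1 * w2) = (\<Sum>w\<in>rts v. w * gB u w) / n" by simp_all
qed

definition near :: "real \<Rightarrow> complex \<Rightarrow> complex set" where
  "near K v = {w\<in>rts v. norm (w - zeta) \<le> K / n \<or> norm (w - cnj zeta) \<le> K / n}"

lemma near_card_le:
  fixes K :: real
  assumes v: "norm v = 1" and K: "K > 0"
  shows "card (near K v) \<le> 4 * K + 8"
proof -
  have "near K v = {w\<in>rts v. norm (w - zeta) \<le> K / n} \<union> {w\<in>rts v. norm (w - cnj zeta) \<le> K / n}"
    by (auto simp: near_def)
  then have "card (near K v) \<le> card {w\<in>rts v. norm (w - zeta) \<le> K / n} + card {w\<in>rts v. norm (w - cnj zeta) \<le> K / n}"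
    by (simp add: card_Un_le)
  then show ?thesis
    using near_card[OF v norm_zeta(1) K] near_card[OF v norm_zeta(2) K] by linarith
qed

text \<open>1 / (x y) <= 1 / x^2 + 1 / y^2 separates the two balance points in
  \<open>gap_lower\<close> and reduces the error to inverse squares, which \<open>far_sum\<close>
  controls even if the points merge.\<close>

lemma far_norm_ne:
  fixes K :: real
  assumes w: "w \<in> rts v - near K v" and v: "norm v = 1" and K: "K > 0"
  shows "norm (Aw w) \<noteq> norm (Bw w)"
    and "1 / (n * \<bar>norm (Aw w) - norm (Bw w)\<bar>) \<le> 2 * C1 * n / kap * (1 / (n ^ 2 * norm (w - zeta) ^ 2) + 1 / (n ^ 2 * norm (w - cnj zeta) ^ 2))"
proof -
  have n0: "real n > 0" using n2 by simp
  have far: "norm (w - zeta) > K / n" "norm (w - cnj zeta) > K / n" using w by (auto simp: near_def)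
  moreover have "K / n > 0" using K n0 by simp
  ultimately have p: "norm (w - zeta) > 0" "norm (w - cnj zeta) > 0" by linarith+
  define x y where "x = norm (w - zeta)" and "y = norm (w - cnj zeta)"
  have xy: "x > 0" "y > 0" using p by (simp_all add: x_def y_def)
  have nw: "norm w = 1" using w v norm_rts by auto
  have g: "\<bar>norm (Aw w) - norm (Bw w)\<bar> \<ge> kap / (2 * C1) * (x * y)"
    using gap_lower[OF nw] by (simp add: x_def y_def)
  have kc: "kap / (2 * C1) * (x * y) > 0" using xy kap_pos C1_pos by simp
  show "norm (Aw w) \<noteq> norm (Bw w)"
  proof
    assume "norm (Aw w) = norm (Bw w)"
    then have "\<bar>norm (Aw w) - norm (Bw w)\<bar> = 0" by simp
    then show False using g kc by linarith
  qed
  have "1 / (n * \<bar>norm (Aw w) - norm (Bw w)\<bar>) \<le> 1 / (n * (kap / (2 * C1) * (x * y)))"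
    using g kc n0 xy kap_pos C1_pos order_less_le_trans[OF kc g] by (intro divide_left_mono mult_left_mono mult_pos_pos) auto
  also have "\<dots> = 2 * C1 / (kap * n) * (1 / (x * y))" using kap_pos C1_pos xy n0 by (simp add: field_simps)
  also have "1 / (x * y) \<le> 1 / x ^ 2 + 1 / y ^ 2"
  proof -
    have "0 \<le> (1 / x - 1 / y) ^ 2 + (1 / x) ^ 2 + (1 / y) ^ 2" by simp
    then show ?thesis by (simp add: power2_eq_square algebra_simps)
  qed
  then have "2 * C1 / (kap * n) * (1 / (x * y)) \<le> 2 * C1 / (kap * n) * (1 / x ^ 2 + 1 / y ^ 2)"
    using C1_pos kap_pos n0 by (intro mult_left_mono) auto
  also have "\<dots> = 2 * C1 * n / kap * (1 / (n ^ 2 * x ^ 2) + 1 / (n ^ 2 * y ^ 2))"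
    using n0 xy kap_pos by (simp add: field_simps power2_eq_square)
  finally show "1 / (n * \<bar>norm (Aw w) - norm (Bw w)\<bar>) \<le> 2 * C1 * n / kap * (1 / (n ^ 2 * norm (w - zeta) ^ 2) + 1 / (n ^ 2 * norm (w - cnj zeta) ^ 2))"
    by (simp add: x_def y_def)
qed

text \<open>Away from the two zeros the grid sums converge with a summable error; the at most
  \<open>4 * K + 8\<close> grid points near a zero contribute \<open>O(1 / R)\<close> each once the twist \<open>u\<close> keeps
  \<open>A ^ n - u * B ^ n\<close> at relative distance \<open>R / n\<close> from \<open>0\<close>.\<close>

lemma grid_sum_estimate:
  fixes K R :: real and psi g G :: "complex \<Rightarrow> complex"
  assumes u: "norm u = 1" and v: "norm v = 1" and K: "K \<ge> 1" and R: "R > 0"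
    and sep: "\<And>w. w \<in> near K v \<Longrightarrow> norm (Aw w ^ n - u * Bw w ^ n) \<ge> R / n * Mw w ^ n"
    and psi: "\<And>w. norm w = 1 \<Longrightarrow> norm (psi w) \<le> 1"
    and gG: "(g, G) \<in> {(gA u, GA), (gB u, GB)}"
  shows "norm ((\<Sum>w\<in>rts v. psi w * g w) / n - (\<Sum>w\<in>rts v. psi w * G w) / n)
    \<le> (24 * C1 / kap) / K + (12 * K / cM) * (1 / R + 1 / n)"
proof -
  have n0: "real n > 0" using n2 by simp
  have K0: "K > 0" using K by simp
  define err where "err = (\<lambda>w. 2 * C1 * n / kap * (1 / (n ^ 2 * norm (w - zeta) ^ 2) + 1 / (n ^ 2 * norm (w - cnj zeta) ^ 2)))"
  have nearR: "near K v \<subseteq> rts v" by (auto simp: near_def)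
  have fnear: "finite (near K v)" by (rule finite_subset[OF nearR finite_rts])
  have fr: "norm (g w - G w) \<le> err w" if w: "w \<in> rts v - near K v" for w
  proof -
    have "norm (g w - G w) \<le> 1 / (n * \<bar>norm (Aw w) - norm (Bw w)\<bar>)"
      using gG resolvent_gap(2,3)[OF u far_norm_ne(1)[OF w v K0]]
      by (auto simp: gA_def gB_def GA_def GB_def)
    then show ?thesis using far_norm_ne(2)[OF w v K0] by (simp add: err_def)
  qed
  have nr: "norm (g w - G w) \<le> n / (R * cM) + 1 / cM" if w: "w \<in> near K v" for w
  proof -
    have M0: "Mw w > 0" using Mw_ge[of w] cM_pos by linarith
    have le: "norm (Aw w) ^ (n - 1) \<le> Mw w ^ (n - 1)" "norm (Bw w) ^ (n - 1) \<le> Mw w ^ (n - 1)"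
      by (auto simp: Mw_def intro!: power_mono)
    have M: "Mw w ^ n = Mw w * Mw w ^ (n - 1)" using n2 by (simp add: power_eq_if)
    obtain c where c: "norm (g w) = c / norm (Aw w ^ n - u * Bw w ^ n)" "0 \<le> c" "c \<le> Mw w ^ (n - 1)"
    proof -
      have "g = gA u \<or> g = gB u" using gG by auto
      then show ?thesis
      proof
        assume "g = gA u"
        then show ?thesis using le
          by (intro that[of "norm (Aw w) ^ (n - 1)"]) (simp_all add: gA_def norm_divide norm_power)
      next
        assume "g = gB u"
        then show ?thesis using le u
          by (intro that[of "norm (Bw w) ^ (n - 1)"]) (simp_all add: gB_def norm_divide norm_mult norm_power)
      qed
    qed
    have "norm (g w) \<le> Mw w ^ (n - 1) / (R / n * Mw w ^ n)"
      unfolding c(1) using c(2,3) sep[OF w] M0 n0 R by (intro frac_le mult_pos_pos) simp_all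
    also have "\<dots> = n / (R * Mw w)" using M0 n0 R by (simp add: M field_simps)
    also have "\<dots> \<le> n / (R * cM)"
      using Mw_ge[of w] cM_pos R n0 M0 by (intro divide_left_mono mult_left_mono mult_pos_pos) auto
    finally have "norm (g w) \<le> n / (R * cM)" .
    moreover have "norm (G w) \<le> 1 / cM" using gG norm_G_le by auto
    ultimately show ?thesis using norm_triangle_ineq4[of "g w" "G w"] by linarith
  qed
  have "norm ((\<Sum>w\<in>rts v. psi w * g w) / n - (\<Sum>w\<in>rts v. psi w * G w) / n)
     = norm (\<Sum>w\<in>rts v. psi w * (g w - G w)) / n"
    using n0 by (simp add: diff_divide_distrib[symmetric] sum_subtractf[symmetric] right_diff_distrib norm_divide)
  also have "norm (\<Sum>w\<in>rts v. psi w * (g w - G w)) \<le> (\<Sum>w\<in>rts v. norm (g w - G w))"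
  proof (rule sum_norm_le)
    fix w assume "w \<in> rts v"
    then have "norm (psi w) \<le> 1" using psi norm_rts[OF _ v] by blast
    then show "norm (psi w * (g w - G w)) \<le> norm (g w - G w)"
      by (simp add: norm_mult mult_left_le_one_le)
  qed
  also have "(\<Sum>w\<in>rts v. norm (g w - G w)) = (\<Sum>w\<in>rts v - near K v. norm (g w - G w)) + (\<Sum>w\<in>near K v. norm (g w - G w))"
    by (rule sum.subset_diff[OF nearR finite_rts])
  also have "(\<Sum>w\<in>near K v. norm (g w - G w)) \<le> (\<Sum>w\<in>near K v. n / (R * cM) + 1 / cM)"
    by (rule sum_mono) (rule nr)
  also have "\<dots> = card (near K v) * (n / (R * cM) + 1 / cM)" by simp
  \<comment> \<open>K >= 1 gives 4 K + 8 <= 12 K.\<close>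
  also have "\<dots> \<le> (12 * K) * (n / (R * cM) + 1 / cM)"
    using near_card_le[OF v K0] K R cM_pos n0 by (intro mult_right_mono) auto
  also have "(\<Sum>w\<in>rts v - near K v. norm (g w - G w)) \<le> (\<Sum>w\<in>rts v - near K v. err w)"
    by (rule sum_mono) (rule fr)
  also have "\<dots> \<le> 2 * C1 * n / kap * (6 / K + 6 / K)"
  proof -
    have part: "(\<Sum>w\<in>rts v - near K v. 1 / (n ^ 2 * norm (w - z) ^ 2)) \<le> 6 / K" if z: "z = zeta \<or> z = cnj zeta" for z
    proof -
      have "(\<Sum>w\<in>rts v - near K v. 1 / (n ^ 2 * norm (w - z) ^ 2)) \<le> (\<Sum>w | w \<in> rts v \<and> norm (w - z) > K / n. 1 / (n ^ 2 * norm (w - z) ^ 2))"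
        using z by (intro sum_mono2 finite_subset[OF _ finite_rts]) (auto simp: near_def)
      also have "\<dots> \<le> (2 / K) * (1 + 2 / K)" using z norm_zeta by (intro far_sum v K0) auto
      also have "\<dots> \<le> (2 / K) * 3" using K by (intro mult_left_mono) (auto simp: field_simps)
      finally show ?thesis by simp
    qed
    show ?thesis unfolding err_def sum_distrib_left[symmetric] sum.distrib
      using C1_pos kap_pos n0 by (intro mult_left_mono add_mono part) auto
  qed
  finally have "norm ((\<Sum>w\<in>rts v. psi w * g w) / n - (\<Sum>w\<in>rts v. psi w * G w) / n)
    \<le> (2 * C1 * n / kap * (6 / K + 6 / K) + (12 * K) * (n / (R * cM) + 1 / cM)) / n"
    using n0 by (simp add: divide_right_mono)
  also have "\<dots> = (24 * C1 / kap) / K + (12 * K / cM) * (1 / R + 1 / n)"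
    using n0 K0 R cM_pos kap_pos by (simp add: field_simps)
  finally show ?thesis .
qed

text \<open>Pigeonhole. A triple (e1, e2, w) can spoil only one of the twists 8 R l / n: two of them
  are at chord distance at least 4 R / n, which moves u B^n by at least 2 R / n times M^n, while
  both would have to be within R / n times M^n of A^n. There are at most 2 * 2 * (4 K + 8) <= 48 K
  triples and L + 1 > 48 K twists. The bound on 8 R L / n keeps all angles in [0, 1], where a chord
  is at least half its angle.\<close>

lemma good_twist:
  fixes K R :: real
  assumes K: "K \<ge> 1" and R: "R > 0" and L: "real L \<ge> 48 * K" and nL: "8 * R * L / n \<le> 1" and nR: "2 * R \<le> n"
  obtains l where "l \<le> L"
    "\<And>e1 e2 w. w \<in> near K (cs e2) \<Longrightarrow> norm (Aw w ^ n - cs e1 * cis (8 * R * real l / n) * Bw w ^ n) \<ge> R / n * Mw w ^ n"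
proof (rule ccontr)
  note good = that
  assume contra: "\<not> thesis"
  have n0: "real n > 0" using n2 by simp
  have K0: "K > 0" using K by simp
  define T where "T = (UNIV :: bool set) \<times> (SIGMA e2:(UNIV :: bool set). near K (cs e2))"
  define bad where "bad = (\<lambda>l (e1, e2 :: bool, w). norm (Aw w ^ n - cs e1 * cis (8 * R * real l / n) * Bw w ^ n) < R / n * Mw w ^ n)"
  have nearf: "finite (near K v)" for v by (rule finite_subset[OF _ finite_rts[of v]]) (auto simp: near_def)
  have fT: "finite T" unfolding T_def by (intro finite_SigmaI nearf) auto
  have "\<exists>x\<in>T. bad l x" if "l \<le> L" for l
  proof (rule ccontr)
    assume "\<not> (\<exists>x\<in>T. bad l x)"
    then have "norm (Aw w ^ n - cs e1 * cis (8 * R * real l / n) * Bw w ^ n) \<ge> R / n * Mw w ^ n"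
      if "w \<in> near K (cs e2)" for e1 e2 w using that by (force simp: T_def bad_def not_less)
    then show False using contra good[OF that] by blast
  qed
  then obtain f where f: "\<And>l. l \<le> L \<Longrightarrow> f l \<in> T \<and> bad l (f l)" by metis
  have excl: False if lt: "l' < l" "l \<le> L" and x: "bad l x" "bad l' x" for l l' x
  proof -
    obtain e1 e2 w where xe: "x = (e1, e2, w)" by (cases x)
    define t t' where "t = 8 * R * real l / n" and "t' = 8 * R * real l' / n"
    define a b M where "a = Aw w ^ n" and "b = cs e1 * Bw w ^ n" and "M = Mw w ^ n"
    have cs1: "norm (cs e1) = 1" by (simp add: cs_def)
    have M0: "M > 0" using Mw_ge[of w] cM_pos by (simp add: M_def)
    have b1: "norm (a - cis t * b) < R / n * M" "norm (a - cis t' * b) < R / n * M"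
      using x by (simp_all add: xe bad_def a_def b_def M_def t_def t'_def mult_ac)
    have nb: "norm b = norm (Bw w) ^ n" and na: "norm a = norm (Aw w) ^ n"
      using cs1 by (simp_all add: a_def b_def norm_mult norm_power)
    have RM: "R / n * M \<le> M / 2" using nR n0 M0 by (simp add: field_simps)
    \<comment> \<open>In a spoiled triple the two powers are comparable: if the maximum M is |A|^n,
      a difference below M / 2 leaves at least M / 2 for |B|^n.\<close>
    have "norm b \<ge> M / 2"
    proof (cases "norm (Aw w) \<le> norm (Bw w)")
      case True
      then have "M = norm b" by (simp add: M_def nb Mw_def max_def)
      then show ?thesis using M0 by simp
    next
      case False
      then have "M = norm a" by (simp add: M_def na Mw_def max_def)
      moreover have "norm a \<le> norm (a - cis t * b) + norm (cis t * b)"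
        using norm_triangle_ineq[of "a - cis t * b" "cis t * b"] by simp
      moreover have "norm (cis t * b) = norm b" by (simp add: norm_mult)
      ultimately show ?thesis using b1(1) RM by linarith
    qed
    have t: "0 \<le> t'" "t' \<le> t" "t \<le> 1" "t - t' \<ge> 8 * R / n"
    proof -
      show "0 \<le> t'" "t' \<le> t" using R n0 lt by (simp_all add: t_def t'_def divide_right_mono)
      have "8 * R * real l / n \<le> 8 * R * real L / n" using R n0 lt by (intro divide_right_mono mult_left_mono) auto
      then show "t \<le> 1" using nL by (simp add: t_def)
      have "real l - real l' \<ge> 1" using lt by linarith
      then have "8 * R * (real l - real l') / n \<ge> 8 * R * 1 / n" using R n0 by (intro divide_right_mono mult_left_mono) auto
      then show "t - t' \<ge> 8 * R / n" by (simp add: t_def t'_def diff_divide_distrib right_diff_distrib)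
    qed
    have "4 * R / n * (M / 2) \<le> norm (cis t - cis t') * norm b"
      using norm_cis_diff_ge[OF t(1-3)] t(4) \<open>norm b \<ge> M / 2\<close> M0 R n0 by (intro mult_mono) auto
    also have "\<dots> = norm ((a - cis t' * b) - (a - cis t * b))" by (simp add: norm_mult[symmetric] algebra_simps)
    also have "\<dots> \<le> norm (a - cis t' * b) + norm (a - cis t * b)" by (rule norm_triangle_ineq4)
    also have "\<dots> < 2 * (R / n * M)" using add_strict_mono[OF b1(2) b1(1)] by (simp only: mult_2)
    finally show False by (simp add: mult_ac)
  qed
  have "inj_on f {..L}"
  proof (rule inj_onI)
    fix l l' assume l: "l \<in> {..L}" "l' \<in> {..L}" "f l = f l'"
    show "l = l'"
    proof (rule linorder_cases[of l l'])
      assume "l < l'" then show ?thesis using excl[of l l' "f l"] l f[of l] f[of l'] by simp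
    next
      assume "l' < l" then show ?thesis using excl[of l' l "f l"] l f[of l] f[of l'] by simp
    qed
  qed
  then have "card {..L} \<le> card T" using f by (intro card_inj_on_le[of f]) (auto simp: fT)
  also have "real (card T) \<le> 48 * K"
  proof -
    have "card T = 2 * (card (near K (cs True)) + card (near K (cs False)))"
      unfolding T_def by (simp add: card_SigmaI nearf UNIV_bool)
    moreover have "card (near K (cs e)) \<le> 4 * K + 8" for e
      using near_card_le[of "cs e" K] K0 by (simp add: cs_def)
    from this[of True] this[of False] have "real (card (near K (cs True)) + card (near K (cs False))) \<le> 24 * K" using K by simp
    ultimately show ?thesis by simp
  qed
  finally show False using L by simp
qed

end

section \<open>The limit of the type probabilities\<close>

definition circle_mean :: "(complex \<Rightarrow> complex) \<Rightarrow> complex" where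
  "circle_mean f = (LINT \<theta>:{0..<2*pi}|lborel. f (cis \<theta>)) / (2 * pi)"

lemma countable_cos_eq: "countable {\<theta> :: real. cos \<theta> = c}"
proof -
  have "{\<theta>. cos \<theta> = c} \<subseteq> (\<Union>k::int. {arccos c + 2 * k * pi, - arccos c + 2 * k * pi})"
    by (auto simp: cos_eq_arccos_Ex)
  then show ?thesis by (rule countable_subset) auto
qed

lemma AE_cos_ne: "AE \<theta> :: real in lborel. cos \<theta> \<noteq> c"
proof -
  have "{\<theta> :: real. cos \<theta> = c} \<in> null_sets lborel"
    by (rule countable_imp_null_set_lborel[OF countable_cos_eq])
  then have "AE \<theta> :: real in lborel. \<theta> \<notin> {\<theta> :: real. cos \<theta> = c}" by (rule AE_not_in)
  then show ?thesis by simp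
qed

text \<open>The mean is the integral of a step function on n cells of length 2 pi / n. As 0 <= s <=
  2 pi, every sample lies in its closed cell, so the step functions converge wherever f is
  continuous, that is off the null set cos \<theta> = c, and dominated convergence applies although
  f may jump there.\<close>

lemma equidistributed_sum_tendsto:
  fixes f :: "complex \<Rightarrow> complex" and s :: "nat \<Rightarrow> real"
  assumes meas: "(\<lambda>\<theta>. f (cis \<theta>)) \<in> borel_measurable borel"
    and bound: "\<And>w. norm w = 1 \<Longrightarrow> norm (f w) \<le> C"
    and cont: "\<And>\<theta>. cos \<theta> \<noteq> c \<Longrightarrow> isCont (\<lambda>\<theta>. f (cis \<theta>)) \<theta>"
    and s: "\<And>n. 0 \<le> s n \<and> s n \<le> 2 * pi"
  shows "(\<lambda>n. (\<Sum>i<n. f (cis ((2 * pi * i + s n) / n))) / n) \<longlonglongrightarrow> circle_mean f"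
proof -
  define pt where "pt = (\<lambda>n i :: nat. (2 * pi * i + s n) / n)"
  define J where "J = (\<lambda>(n :: nat) (i :: nat). {2 * pi * i / n ..< 2 * pi * (i + 1) / n})"
  define F where "F = (\<lambda>n \<theta>. \<Sum>i<n. indicator (J n i) \<theta> *\<^sub>R f (cis (pt n i)))"
  define k where "k = (\<lambda>(n :: nat) \<theta>. nat \<lfloor>n * \<theta> / (2 * pi)\<rfloor>)"
  have C0: "C \<ge> 0" using bound[of 1] order_trans[OF norm_ge_zero] by simp
  have J: "\<theta> \<in> J n i \<longleftrightarrow> \<lfloor>n * \<theta> / (2 * pi)\<rfloor> = int i" if "n > 0" for n i :: nat and \<theta> :: real
    using that by (simp add: J_def floor_eq_iff field_simps)
  have F_eq: "F n \<theta> = (if 0 \<le> \<theta> \<and> \<theta> < 2 * pi then f (cis (pt n (k n \<theta>))) else 0)" if n: "n > 0" for n :: nat and \<theta> :: real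
  proof (cases "0 \<le> \<theta> \<and> \<theta> < 2 * pi")
    case True
    define x where "x = n * \<theta> / (2 * pi)"
    have x: "0 \<le> x" "x < n" using True n by (simp_all add: x_def field_simps)
    then have fl: "0 \<le> \<lfloor>x\<rfloor>" "\<lfloor>x\<rfloor> < int n" by (simp_all add: floor_less_iff)
    have Jx: "\<theta> \<in> J n i \<longleftrightarrow> \<lfloor>x\<rfloor> = int i" for i
      using J[where n = n and \<theta> = \<theta> and i = i] n unfolding x_def by blast
    have "F n \<theta> = (\<Sum>i<n. if i = nat \<lfloor>x\<rfloor> then f (cis (pt n i)) else 0)"
      unfolding F_def by (intro sum.cong refl) (use fl in \<open>auto simp: indicator_def Jx\<close>)
    also have "\<dots> = f (cis (pt n (nat \<lfloor>x\<rfloor>)))" using fl by (simp add: nat_less_iff)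
    finally show ?thesis using True by (simp add: k_def x_def)
  next
    case False
    have "\<theta> \<notin> J n i" if "i < n" for i
    proof
      assume "\<theta> \<in> J n i"
      then have "2 * pi * i / n \<le> \<theta>" "\<theta> < 2 * pi * (real i + 1) / n" by (auto simp: J_def)
      moreover have "2 * pi * (real i + 1) / n \<le> 2 * pi"
        using that mult_left_mono[of "real i + 1" "real n" "2 * pi"] by (simp add: divide_le_eq)
      moreover have "0 \<le> 2 * pi * i / n" by simp
      ultimately show False using False by linarith
    qed
    then have "F n \<theta> = 0" unfolding F_def by (intro sum.neutral) auto
    then show ?thesis using False by auto
  qed
  have emeasure_Ico_finite: "emeasure lborel {a..<b} < \<infinity>" for a b :: real
    by (cases "a \<le> b") simp_all
  have Fint: "integral\<^sup>L lborel (F n) = (2 * pi) * ((\<Sum>i<n. f (cis (pt n i))) / n)" for n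
  proof -
    have "integral\<^sup>L lborel (F n) = (\<Sum>i<n. integral\<^sup>L lborel (\<lambda>\<theta>. indicator (J n i) \<theta> *\<^sub>R f (cis (pt n i))))"
      unfolding F_def by (intro Bochner_Integration.integral_sum integrable_scaleR_left integrable_real_indicator)
        (use emeasure_Ico_finite in \<open>auto simp: J_def\<close>)
    also have "\<dots> = (\<Sum>i<n. (2 * pi / n) *\<^sub>R f (cis (pt n i)))"
      by (intro sum.cong refl) (auto simp: J_def field_simps)
    also have "\<dots> = (2 * pi / n) *\<^sub>R (\<Sum>i<n. f (cis (pt n i)))" by (rule scaleR_sum_right[symmetric])
    finally show ?thesis by (simp add: scaleR_conv_of_real)
  qed
  have "(\<lambda>n. integral\<^sup>L lborel (F n)) \<longlonglongrightarrow> integral\<^sup>L lborel (\<lambda>\<theta>. indicator {0..<2*pi} \<theta> *\<^sub>R f (cis \<theta>))"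
  proof (rule integral_dominated_convergence[where w = "\<lambda>\<theta>. C * indicator {0..<2*pi} \<theta>"])
    show "(\<lambda>\<theta>. indicator {0..<2*pi} \<theta> *\<^sub>R f (cis \<theta>)) \<in> borel_measurable lborel"
      using meas by (intro borel_measurable_scaleR) auto
    show "F n \<in> borel_measurable lborel" for n
      unfolding F_def by (intro borel_measurable_sum borel_measurable_scaleR) (auto simp: J_def)
    show "integrable lborel (\<lambda>\<theta>. C * indicator {0..<2*pi} \<theta>)"
      by (intro integrable_mult_right integrable_real_indicator) auto
    show "AE \<theta> in lborel. norm (F n \<theta>) \<le> C * indicator {0..<2*pi} \<theta>" for n
    proof (cases "n = 0")
      case True
      then show ?thesis using C0 by (simp add: F_def)
    next
      case False
      then show ?thesis using bound C0 by (intro AE_I2) (auto simp: F_eq)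
    qed
    show "AE \<theta> in lborel. (\<lambda>n. F n \<theta>) \<longlonglongrightarrow> indicator {0..<2*pi} \<theta> *\<^sub>R f (cis \<theta>)"
      using AE_cos_ne[of c]
    proof eventually_elim
      case (elim \<theta>)
      show ?case
      proof (cases "0 \<le> \<theta> \<and> \<theta> < 2 * pi")
        case True
        have "(\<lambda>n. pt n (k n \<theta>) - \<theta>) \<longlonglongrightarrow> 0"
        proof (rule Lim_null_comparison)
          show "eventually (\<lambda>n. norm (pt n (k n \<theta>) - \<theta>) \<le> 2 * pi / real n) sequentially"
            using eventually_gt_at_top[of 0]
          proof eventually_elim
            case (elim n)
            define x where "x = n * \<theta> / (2 * pi)"
            have "0 \<le> x" using True by (simp add: x_def)
            then have kx: "real (k n \<theta>) \<le> x" "x < real (k n \<theta>) + 1" by (simp_all add: k_def x_def[symmetric])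
            have "\<theta> = 2 * pi * x / n" using elim by (simp add: x_def)
            then have e: "pt n (k n \<theta>) - \<theta> = (2 * pi * (k n \<theta> - x) + s n) / n"
              by (simp add: pt_def diff_divide_distrib add_divide_distrib algebra_simps)
            have "2 * pi * (k n \<theta> - x) \<le> 0" "- (2 * pi) \<le> 2 * pi * (k n \<theta> - x)"
              using kx mult_left_mono[of "-1" "k n \<theta> - x" "2 * pi"] by (auto simp: mult_nonneg_nonpos)
            then have "\<bar>2 * pi * (k n \<theta> - x) + s n\<bar> \<le> 2 * pi" using s[of n] by linarith
            then show ?case unfolding e using elim by (simp add: divide_right_mono)
          qed
          show "(\<lambda>n. 2 * pi / real n) \<longlonglongrightarrow> 0" by (rule lim_const_over_n)
        qed
        then have "(\<lambda>n. pt n (k n \<theta>)) \<longlonglongrightarrow> \<theta>" by (rule LIM_zero_cancel)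
        then have "(\<lambda>n. f (cis (pt n (k n \<theta>)))) \<longlonglongrightarrow> f (cis \<theta>)"
          by (rule isCont_tendsto_compose[OF cont[OF elim]])
        moreover have "eventually (\<lambda>n. F n \<theta> = f (cis (pt n (k n \<theta>)))) sequentially"
          using eventually_gt_at_top[of 0] by eventually_elim (use True F_eq in auto)
        ultimately have "(\<lambda>n. F n \<theta>) \<longlonglongrightarrow> f (cis \<theta>)" by (simp add: tendsto_cong)
        then show ?thesis using True by simp
      next
        case False
        have "eventually (\<lambda>n. F n \<theta> = 0) sequentially"
          using eventually_gt_at_top[of 0] by eventually_elim (use False F_eq in auto)
        then have "(\<lambda>n. F n \<theta>) \<longlonglongrightarrow> 0" by (rule tendsto_eventually)
        then show ?thesis using False by auto
      qed
    qed
  qed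
  then have "(\<lambda>n. (2 * pi) * ((\<Sum>i<n. f (cis (pt n i))) / n) / (2 * pi)) \<longlonglongrightarrow> integral\<^sup>L lborel (\<lambda>\<theta>. indicator {0..<2*pi} \<theta> *\<^sub>R f (cis \<theta>)) / (2 * pi)"
    unfolding Fint by (intro tendsto_divide tendsto_const) auto
  then show ?thesis by (simp add: circle_mean_def set_lebesgue_integral_def pt_def)
qed

text \<open>Depending on v and on the parity of n, the grid consists of the n-th roots of unity or
  of their rotation by half a step.\<close>

lemma (in torus) sum_rts_sign:
  assumes "v = 1 \<or> v = - 1"
  shows "(\<Sum>w\<in>rts v. f w) = (\<Sum>i<n. f (cis ((2 * pi * i + (if (- 1) ^ n = v then 0 else pi)) / n)))"
proof -
  define s where "s = (if (- 1) ^ n = v then 0 else pi)"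
  define X where "X = - cis (s / n)"
  have n0: "real n > 0" using n2 by simp
  have "cis s = (- 1) ^ n * v"
    using assms by (cases "even n") (auto simp: s_def)
  moreover have "cis (s / n) ^ n = cis s"
    using n0 Complex.DeMoivre[of "s / n" n] by simp
  ultimately have X: "X ^ n = v" by (simp add: X_def power_minus[of "cis _"] flip: power_mult_distrib)
  have X0: "X \<noteq> 0" by (simp add: X_def)
  have "(\<Sum>w\<in>rts v. f w) = (\<Sum>i\<in>{0..<int n}. f (- (X * ee i)))"
    using sum.reindex_bij_betw[OF bij_rts[OF X0], of f] X by simp
  also have "\<dots> = (\<Sum>i<n. f (cis ((2 * pi * i + s) / n)))"
  proof (rule sum.reindex_bij_witness[of _ int nat])
    fix i assume "i \<in> {0..<int n}"
    then show "f (cis ((2 * pi * nat i + s) / n)) = f (- (X * ee i))"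
      by (simp add: X_def ee_def cis_mult add_divide_distrib add.commute)
  qed auto
  finally show ?thesis by (simp add: s_def)
qed

lemma grid_mean_tendsto:
  fixes f :: "complex \<Rightarrow> complex"
  assumes "(\<lambda>\<theta>. f (cis \<theta>)) \<in> borel_measurable borel"
    and "\<And>w. norm w = 1 \<Longrightarrow> norm (f w) \<le> C"
    and "\<And>\<theta>. cos \<theta> \<noteq> c \<Longrightarrow> isCont (\<lambda>\<theta>. f (cis \<theta>)) \<theta>"
    and v: "v = 1 \<or> v = - 1"
  shows "(\<lambda>n. (\<Sum>w\<in>torus.rts n v. f w) / n) \<longlonglongrightarrow> circle_mean f"
proof -
  have A: "(\<lambda>n. (\<Sum>i<n. f (cis ((2 * pi * i + (if (- 1) ^ n = v then 0 else pi)) / n))) / n) \<longlonglongrightarrow> circle_mean f"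
    by (rule equidistributed_sum_tendsto[OF assms(1-3)]) auto
  have ev: "eventually (\<lambda>n. (\<Sum>w\<in>torus.rts n v. f w) / n = (\<Sum>i<n. f (cis ((2 * pi * i + (if (- 1) ^ n = v then 0 else pi)) / n))) / n) sequentially"
    using eventually_ge_at_top[of 2]
  proof eventually_elim
    case (elim n)
    interpret torus n by standard (rule elim)
    show ?case by (simp only: sum_rts_sign[OF v])
  qed
  show ?thesis by (rule iffD2[OF tendsto_cong[OF ev] A])
qed

definition arc :: "real \<Rightarrow> complex \<Rightarrow> complex" where
  "arc c w = (if Re w \<le> c then 1 else 0)"

lemma arc_mean_tendsto:
  assumes "v = 1 \<or> v = - 1"
  shows "(\<lambda>n. card {w\<in>torus.rts n v. Re w \<le> c} / n) \<longlonglongrightarrow> Re (circle_mean (arc c))"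
proof -
  have "(\<lambda>n. (\<Sum>w\<in>torus.rts n v. arc c w) / n) \<longlonglongrightarrow> circle_mean (arc c)"
  proof (rule grid_mean_tendsto[where c = c and C = 1])
    show "(\<lambda>\<theta>. arc c (cis \<theta>)) \<in> borel_measurable borel"
      unfolding arc_def by simp
    fix \<theta> assume "cos \<theta> \<noteq> c"
    then consider "cos \<theta> < c" | "cos \<theta> > c" by linarith
    then show "isCont (\<lambda>\<theta>. arc c (cis \<theta>)) \<theta>"
    proof cases
      case 1
      have "open {t :: real. cos t < c}" by (intro open_Collect_less continuous_intros)
      then have "eventually (\<lambda>t. cos t < c) (nhds \<theta>)" using 1 eventually_nhds_in_open by fastforce
      then have "eventually (\<lambda>t. arc c (cis t) = 1) (nhds \<theta>)" by eventually_elim (simp add: arc_def)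
      then show ?thesis by (subst isCont_cong[of _ "\<lambda>_. 1"]) auto
    next
      case 2
      have "open {t :: real. cos t > c}" by (intro open_Collect_less continuous_intros)
      then have "eventually (\<lambda>t. cos t > c) (nhds \<theta>)" using 2 eventually_nhds_in_open by fastforce
      then have "eventually (\<lambda>t. arc c (cis t) = 0) (nhds \<theta>)" by eventually_elim (simp add: arc_def)
      then show ?thesis by (subst isCont_cong[of _ "\<lambda>_. 0"]) auto
    qed
  qed (use assms in \<open>auto simp: arc_def\<close>)
  then have A: "(\<lambda>n. Re ((\<Sum>w\<in>torus.rts n v. arc c w) / n)) \<longlonglongrightarrow> Re (circle_mean (arc c))"
    by (rule tendsto_Re)
  have ev: "eventually (\<lambda>n. Re ((\<Sum>w\<in>torus.rts n v. arc c w) / n) = card {w\<in>torus.rts n v. Re w \<le> c} / n) sequentially"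
    using eventually_ge_at_top[of 2]
  proof eventually_elim
    case (elim n)
    interpret torus n by standard (rule elim)
    have "(\<Sum>w\<in>rts v. arc c w) = of_nat (card {w\<in>rts v. Re w \<le> c})"
      by (simp add: arc_def sum.If_cases finite_rts Int_def)
    have "Re (of_nat k / of_nat n) = k / n" for k
      using Re_divide_of_nat[of "of_nat k" n] by simp
    then show ?case unfolding \<open>(\<Sum>w\<in>rts v. arc c w) = _\<close> by blast
  qed
  show ?thesis by (rule iffD1[OF tendsto_cong[OF ev] A])
qed

text \<open>The angles with cos \<theta> = c form a null set, so the measure of the arc has no jump
  at c.\<close>

lemma arc_mean_continuous:
  assumes x: "x \<longlonglongrightarrow> c"
  shows "(\<lambda>k. Re (circle_mean (arc (x k)))) \<longlonglongrightarrow> Re (circle_mean (arc c))"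
proof -
  have "(\<lambda>k. integral\<^sup>L lborel (\<lambda>\<theta>. indicator {0..<2*pi} \<theta> *\<^sub>R arc (x k) (cis \<theta>)))
     \<longlonglongrightarrow> integral\<^sup>L lborel (\<lambda>\<theta>. indicator {0..<2*pi} \<theta> *\<^sub>R arc c (cis \<theta>))"
  proof (rule integral_dominated_convergence[where w = "indicator {0..<2*pi}"])
    show "integrable lborel (indicator {0..<2*pi} :: real \<Rightarrow> real)" by (intro integrable_real_indicator) auto
    show "AE \<theta> in lborel. (\<lambda>k. indicator {0..<2*pi} \<theta> *\<^sub>R arc (x k) (cis \<theta>)) \<longlonglongrightarrow> indicator {0..<2*pi} \<theta> *\<^sub>R arc c (cis \<theta>)"
      using AE_cos_ne[of c]
    proof eventually_elim
      case (elim \<theta>)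
      then consider "cos \<theta> < c" | "cos \<theta> > c" by linarith
      then have "eventually (\<lambda>k. arc (x k) (cis \<theta>) = arc c (cis \<theta>)) sequentially"
      proof cases
        case 1
        from order_tendstoD(1)[OF x 1] show ?thesis by eventually_elim (use 1 in \<open>simp add: arc_def\<close>)
      next
        case 2
        from order_tendstoD(2)[OF x 2] show ?thesis by eventually_elim (use 2 in \<open>simp add: arc_def\<close>)
      qed
      then have "(\<lambda>k. arc (x k) (cis \<theta>)) \<longlonglongrightarrow> arc c (cis \<theta>)" by (rule tendsto_eventually)
      then show ?case by (intro tendsto_intros)
    qed
  qed (auto simp: arc_def indicator_def)
  then show ?thesis
    unfolding circle_mean_def set_lebesgue_integral_def
    by (intro tendsto_intros) auto
qed

lemma dist_Pair_le_add: "dist (a, b) (a', b') \<le> dist a a' + dist b b'"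
  unfolding dist_Pair_Pair by (rule sqrt_sum_squares_le_sum) auto

section \<open>Limits for fixed weights\<close>

locale weights =
  fixes \<alpha> \<beta> \<gamma> :: real
  assumes pos': "\<alpha> > 0" "\<beta> > 0" "\<gamma> > 0" and delta_pos': "\<gamma>\<^sup>2 > \<alpha> * \<beta>"
begin

lemma sixv: "2 \<le> n \<Longrightarrow> sixv n \<alpha> \<beta> \<gamma>"
  using pos' delta_pos' by unfold_locales auto

text \<open>Quantities such as \<open>c0\<close>, \<open>Aw\<close>, \<open>GA\<close> do not depend
  on n; the instance n = 2 supplies names for them outside any particular torus.\<close>

sublocale w: sixv 2 \<alpha> \<beta> \<gamma>
  by (rule sixv) simp

text \<open>The limit of P / n: the fraction of the w_2 circle on which |A| <= |B|.\<close>

definition dens :: real where "dens = Re (circle_mean (arc w.c0))"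

lemma dens_bounds: "0 \<le> dens" "dens \<le> 1"
proof -
  have lim: "(\<lambda>n. card {w\<in>torus.rts n 1. Re w \<le> w.c0} / n) \<longlonglongrightarrow> dens"
    unfolding dens_def by (rule arc_mean_tendsto) simp
  show "0 \<le> dens" by (rule LIMSEQ_le_const[OF lim]) simp
  have le1: "card {w\<in>torus.rts n 1. Re w \<le> w.c0} / n \<le> 1" if "2 \<le> n" for n :: nat
  proof -
    interpret s: sixv n \<alpha> \<beta> \<gamma> by (rule sixv[OF that])
    have "card {w\<in>s.rts 1. Re w \<le> w.c0} \<le> card (s.rts 1)"
      by (intro card_mono s.finite_rts) auto
    then have "card {w\<in>s.rts 1. Re w \<le> w.c0} \<le> n" by (simp add: s.card_rts)
    then show ?thesis using that by (simp add: divide_le_eq)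
  qed
  then show "dens \<le> 1" by (intro LIMSEQ_le_const2[OF lim] exI[of _ 2] allI impI le1)
qed

text \<open>Multiplying |B| by exp (h) or exp (- h) shifts the threshold for Re w by at most x,
  because |A|^2 - |B|^2 = kap (Re w - c0) and |B| <= C1. The counts thus become arc counts, whose
  limits are known.\<close>

lemma cnt_bounds:
  assumes n: "2 \<le> n" and v: "v = 1 \<or> v = - 1" and h: "h > 0" and x: "(exp (2 * h) - 1) * w.C1\<^sup>2 \<le> w.kap * x"
  shows "sixv.cnt n \<alpha> \<beta> \<gamma> h v \<le> card {w\<in>torus.rts n v. Re w \<le> w.c0 + x}"
    and "sixv.cnt n \<alpha> \<beta> \<gamma> (- h) v \<ge> card {w\<in>torus.rts n v. Re w \<le> w.c0 - x}"
proof -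
  interpret s: sixv n \<alpha> \<beta> \<gamma> by (rule sixv[OF n])
  have nv: "norm v = 1" using v by auto
  have B: "norm (w.Bw w) ^ 2 \<le> w.C1\<^sup>2" if "norm w = 1" for w
    using w.norm_A_B_sum[OF that] by (intro power_mono) (auto intro: order_trans[rotated])
  have Bh: "(exp (2 * h) - 1) * norm (w.Bw w) ^ 2 \<le> w.kap * x" if "norm w = 1" for w
  proof -
    have "0 \<le> exp (2 * h) - 1" using h by simp
    from mult_left_mono[OF B[OF that] this] x show ?thesis by (rule order_trans)
  qed
  have e2: "exp (2 * y) = exp y ^ 2" for y :: real by (simp add: exp_double)
  show "s.cnt h v \<le> card {w\<in>s.rts v. Re w \<le> w.c0 + x}"
    unfolding s.cnt_def
  proof (intro card_mono finite_subset[OF _ s.finite_rts[of v]])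
    show "{w \<in> s.rts v. norm (w.Aw w) \<le> exp h * norm (w.Bw w)} \<subseteq> {w \<in> s.rts v. Re w \<le> w.c0 + x}"
    proof safe
      fix w assume w: "w \<in> s.rts v" "norm (w.Aw w) \<le> exp h * norm (w.Bw w)"
      have nw: "norm w = 1" by (rule s.norm_rts[OF w(1) nv])
      have "norm (w.Aw w) ^ 2 \<le> (exp h * norm (w.Bw w)) ^ 2" using w(2) by (intro power_mono) auto
      then have "norm (w.Aw w) ^ 2 - norm (w.Bw w) ^ 2 \<le> (exp (2 * h) - 1) * norm (w.Bw w) ^ 2"
        by (simp add: power_mult_distrib e2 left_diff_distrib)
      then have "w.kap * (Re w - w.c0) \<le> w.kap * x" using Bh[OF nw] w.norm_A_B_diff[OF nw] by simp
      then show "Re w \<le> w.c0 + x" using w.kap_pos by simp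
    qed
  qed auto
  show "card {w\<in>s.rts v. Re w \<le> w.c0 - x} \<le> s.cnt (- h) v"
    unfolding s.cnt_def
  proof (intro card_mono finite_subset[OF _ s.finite_rts[of v]])
    show "{w\<in>s.rts v. Re w \<le> w.c0 - x} \<subseteq> {w \<in> s.rts v. norm (w.Aw w) \<le> exp (- h) * norm (w.Bw w)}"
    proof safe
      fix w assume w: "w \<in> s.rts v" "Re w \<le> w.c0 - x"
      have nw: "norm w = 1" by (rule s.norm_rts[OF w(1) nv])
      have "w.kap * (Re w - w.c0) \<le> w.kap * (- x)" using w(2) w.kap_pos by (intro mult_left_mono) auto
      then have "norm (w.Aw w) ^ 2 \<le> norm (w.Bw w) ^ 2 - (exp (2 * h) - 1) * norm (w.Bw w) ^ 2"
        using w.norm_A_B_diff[OF nw] Bh[OF nw] by simp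
      also have "\<dots> = (2 - exp (2 * h)) * norm (w.Bw w) ^ 2" by (simp add: algebra_simps)
      \<comment> \<open>exp (2 h) + exp (- 2 h) >= 2.\<close>
      also have "\<dots> \<le> exp (- (2 * h)) * norm (w.Bw w) ^ 2"
      proof (intro mult_right_mono)
        have "0 \<le> (exp h - exp (- h)) ^ 2" by simp
        also have "\<dots> = exp h ^ 2 + exp (- h) ^ 2 - 2" by (simp add: power2_diff exp_minus)
        also have "exp (- h) ^ 2 = exp (- (2 * h))" using e2[of "- h"] by simp
        finally show "2 - exp (2 * h) \<le> exp (- (2 * h))" using e2[of h] by simp
      qed simp
      also have "\<dots> = (exp (- h) * norm (w.Bw w)) ^ 2"
        using e2[of "- h"] by (simp add: power_mult_distrib)
      finally show "norm (w.Aw w) \<le> exp (- h) * norm (w.Bw w)"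
        by (rule power2_le_imp_le) simp
    qed
  qed auto
qed

lemma dev_tendsto: "(\<lambda>n. sixv.dev n \<alpha> \<beta> \<gamma> dens) \<longlonglongrightarrow> 0"
proof (rule LIMSEQ_I)
  fix r :: real assume r: "r > 0"
  define e where "e = r / 4"
  have e: "e > 0" using r by (simp add: e_def)
  have "(\<lambda>k. w.c0 + 1 / real (Suc k)) \<longlonglongrightarrow> w.c0 + 0" "(\<lambda>k. w.c0 - 1 / real (Suc k)) \<longlonglongrightarrow> w.c0 - 0"
    by (intro tendsto_intros LIMSEQ_Suc[OF lim_1_over_n])+
  then have lims: "(\<lambda>k. Re (circle_mean (arc (w.c0 + 1 / real (Suc k))))) \<longlonglongrightarrow> dens"
    "(\<lambda>k. Re (circle_mean (arc (w.c0 - 1 / real (Suc k))))) \<longlonglongrightarrow> dens"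
    unfolding dens_def by (auto intro!: arc_mean_continuous simp del: of_nat_Suc)
  have "eventually (\<lambda>k. Re (circle_mean (arc (w.c0 + 1 / real (Suc k)))) < dens + e \<and> Re (circle_mean (arc (w.c0 - 1 / real (Suc k)))) > dens - e) sequentially"
    using order_tendstoD(2)[OF lims(1), of "dens + e"] order_tendstoD(1)[OF lims(2), of "dens - e"] e
    by (simp add: eventually_conj)
  then obtain k where k: "Re (circle_mean (arc (w.c0 + 1 / real (Suc k)))) < dens + e"
    "Re (circle_mean (arc (w.c0 - 1 / real (Suc k)))) > dens - e"
    by (auto simp: eventually_sequentially)
  define x where "x = 1 / real (Suc k)"
  have x0: "x > 0" by (simp add: x_def)
  \<comment> \<open>The largest h that \<open>cnt_bounds\<close> admits for the shift x, which was
    fixed first by the continuity of the arc measure.\<close>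
  define h where "h = ln (1 + w.kap * x / w.C1\<^sup>2) / 2"
  have arg: "w.kap * x / w.C1\<^sup>2 > 0" using w.kap_pos w.C1_pos x0 by simp
  have h0: "h > 0" using arg by (simp add: h_def)
  have hx: "(exp (2 * h) - 1) * w.C1\<^sup>2 \<le> w.kap * x"
    using arg w.C1_pos by (simp add: h_def exp_ln_iff)
  have ev: "eventually (\<lambda>n. card {w\<in>torus.rts n v. Re w \<le> w.c0 + x} / n < dens + e \<and> card {w\<in>torus.rts n v. Re w \<le> w.c0 - x} / n > dens - e) sequentially"
    if "v = 1 \<or> v = - 1" for v
    using order_tendstoD(2)[OF arc_mean_tendsto[OF that] k(1)] order_tendstoD(1)[OF arc_mean_tendsto[OF that] k(2)]
    unfolding x_def[symmetric] by (rule eventually_conj)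
  have small: "(\<lambda>n. 4 * (2 * exp (- 2)) ^ n) \<longlonglongrightarrow> (4 * 0 :: real)"
  proof (intro tendsto_intros LIMSEQ_power_zero)
    have "exp 2 \<ge> (3 :: real)" using exp_ge_add_one_self[of "2 :: real"] by simp
    then show "norm (2 * exp (- 2) :: real) < 1" by (simp add: exp_minus field_simps)
  qed
  \<comment> \<open>From here on exp (- h n^2 e) <= exp (-2)^n, and exp 2 > 2 outweighs the factor
    2^n of \<open>dev_le\<close>.\<close>
  have "eventually (\<lambda>n. 2 \<le> h * e * real n) sequentially"
  proof -
    have "filterlim (\<lambda>n. h * e * real n) at_top sequentially"
      using h0 e by (intro filterlim_tendsto_pos_mult_at_top[OF tendsto_const] filterlim_real_sequentially) auto
    then show ?thesis by (simp add: filterlim_at_top)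
  qed
  moreover have "eventually (\<lambda>n. 4 * (2 * exp (- 2)) ^ n < e) sequentially"
    using order_tendstoD(2)[OF small, of e] e by simp
  ultimately have "eventually (\<lambda>n. norm (sixv.dev n \<alpha> \<beta> \<gamma> dens - 0) < r) sequentially"
    using ev[OF disjI1[OF refl]] ev[OF disjI2[OF refl]] eventually_ge_at_top[of 2]
  proof eventually_elim
    case (elim n)
    interpret s: sixv n \<alpha> \<beta> \<gamma> by (rule sixv) (use elim in simp)
    have n0: "real n > 0" using elim by simp
    have "s.dev dens \<le> 2 * e + 2 ^ (n + 2) * exp (- h * n * n * e)"
    proof (rule s.dev_le[OF h0 e dens_bounds])
      fix v :: complex assume v: "v \<in> {1, - 1}"
      then have v': "v = 1 \<or> v = - 1" by simp
      have c: "card {w\<in>s.rts v. Re w \<le> w.c0 + x} / n < dens + e \<and> card {w\<in>s.rts v. Re w \<le> w.c0 - x} / n > dens - e"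
        using v elim by auto
      have "real (s.cnt h v) \<le> card {w\<in>s.rts v. Re w \<le> w.c0 + x}"
        using cnt_bounds(1)[OF elim(5) v' h0 hx] by simp
      also have "\<dots> \<le> n * (dens + e)" using c n0 by (simp add: field_simps)
      finally show "real (s.cnt h v) \<le> n * (dens + e)" .
      have "n * (dens - e) \<le> card {w\<in>s.rts v. Re w \<le> w.c0 - x}" using c n0 by (simp add: field_simps)
      also have "\<dots> \<le> real (s.cnt (- h) v)" using cnt_bounds(2)[OF elim(5) v' h0 hx] by simp
      finally show "n * (dens - e) \<le> real (s.cnt (- h) v)" .
    qed
    also have "2 ^ (n + 2) * exp (- h * n * n * e) \<le> 4 * (2 * exp (- 2)) ^ n"
    proof -
      have "exp (- h * n * n * e) \<le> exp (real n * - 2)"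
        using mult_left_mono[OF elim(1), of "real n"] by (simp add: mult_ac)
      also have "\<dots> = exp (- 2) ^ n" by (rule exp_of_nat_mult)
      finally show ?thesis by (simp add: power_mult_distrib)
    qed
    also have "\<dots> < e" by (rule elim(2))
    finally have "s.dev dens < r" using e by (simp add: e_def)
    moreover have "s.dev dens \<ge> 0" unfolding s.dev_def by (intro sum_nonneg mult_nonneg_nonneg s.pr_nonneg) auto
    ultimately show ?case by simp
  qed
  then show "\<exists>no. \<forall>n\<ge>no. norm (sixv.dev n \<alpha> \<beta> \<gamma> dens - 0) < r"
    by (simp add: eventually_sequentially)
qed

lemma norm_A_ne_B: "cos \<theta> \<noteq> w.c0 \<Longrightarrow> norm (w.Aw (cis \<theta>)) \<noteq> norm (w.Bw (cis \<theta>))"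
  using w.norm_A_B_diff[of "cis \<theta>"] w.kap_pos by auto

lemma continuous_AB: "continuous_on UNIV (\<lambda>\<theta>. w.Aw (cis \<theta>))" "continuous_on UNIV (\<lambda>\<theta>. w.Bw (cis \<theta>))"
  unfolding w.Aw_def w.Bw_def by (intro continuous_intros)+

lemma isCont_GA_GB:
  assumes "cos \<theta> \<noteq> w.c0"
  shows "isCont (\<lambda>\<theta>. w.GA (cis \<theta>)) \<theta>" "isCont (\<lambda>\<theta>. w.GB (cis \<theta>)) \<theta>"
proof -
  let ?A = "\<lambda>\<theta>. w.Aw (cis \<theta>)" and ?B = "\<lambda>\<theta>. w.Bw (cis \<theta>)"
  have c: "isCont ?A \<theta>" "isCont ?B \<theta>"
    using continuous_AB by (simp_all add: continuous_on_eq_continuous_at)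
  have o: "open {t. norm (?B t) < norm (?A t)}" "open {t. norm (?A t) < norm (?B t)}"
    using continuous_AB by (auto intro!: open_Collect_less continuous_on_norm)
  consider "norm (?B \<theta>) < norm (?A \<theta>)" | "norm (?A \<theta>) < norm (?B \<theta>)"
    using norm_A_ne_B[OF assms] by linarith
  then have "isCont (\<lambda>\<theta>. w.GA (cis \<theta>)) \<theta> \<and> isCont (\<lambda>\<theta>. w.GB (cis \<theta>)) \<theta>"
  proof cases
    case 1
    then have ev: "eventually (\<lambda>t. t \<in> {t. norm (?B t) < norm (?A t)}) (nhds \<theta>)" by (intro eventually_nhds_in_open o) simp
    have e1: "eventually (\<lambda>t. w.GA (cis t) = 1 / ?A t) (nhds \<theta>)" using ev by eventually_elim (simp add: w.GA_def)
    have e2: "eventually (\<lambda>t. w.GB (cis t) = 0) (nhds \<theta>)" using ev by eventually_elim (simp add: w.GB_def)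
    have "?A \<theta> \<noteq> 0" using 1 by auto
    then have "isCont (\<lambda>t. 1 / ?A t) \<theta>" using c by (intro continuous_intros) auto
    then show ?thesis using isCont_cong[OF e1] isCont_cong[OF e2] by simp
  next
    case 2
    then have ev: "eventually (\<lambda>t. t \<in> {t. norm (?A t) < norm (?B t)}) (nhds \<theta>)" by (intro eventually_nhds_in_open o) simp
    have e1: "eventually (\<lambda>t. w.GB (cis t) = 1 / ?B t) (nhds \<theta>)" using ev by eventually_elim (simp add: w.GB_def)
    have e2: "eventually (\<lambda>t. w.GA (cis t) = 0) (nhds \<theta>)" using ev by eventually_elim (simp add: w.GA_def)
    have "?B \<theta> \<noteq> 0" using 2 by auto
    then have "isCont (\<lambda>t. 1 / ?B t) \<theta>" using c by (intro continuous_intros) auto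
    then show ?thesis using isCont_cong[OF e1] isCont_cong[OF e2] by simp
  qed
  then show "isCont (\<lambda>\<theta>. w.GA (cis \<theta>)) \<theta>" "isCont (\<lambda>\<theta>. w.GB (cis \<theta>)) \<theta>" by auto
qed

lemma measurable_AB [measurable]:
  "(\<lambda>\<theta>. w.Aw (cis \<theta>)) \<in> borel_measurable borel" "(\<lambda>\<theta>. w.Bw (cis \<theta>)) \<in> borel_measurable borel"
  using continuous_AB by (auto intro: borel_measurable_continuous_onI)

lemma measurable_cis [measurable]: "cis \<in> borel_measurable borel"
  by (intro borel_measurable_continuous_onI continuous_intros)

lemma measurable_GA_GB [measurable]:
  "(\<lambda>\<theta>. w.GA (cis \<theta>)) \<in> borel_measurable borel" "(\<lambda>\<theta>. w.GB (cis \<theta>)) \<in> borel_measurable borel"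
  unfolding w.GA_def w.GB_def by measurable

lemma G_mean_tendsto:
  assumes v: "v = 1 \<or> v = - 1" and G: "G \<in> {w.GA, w.GB}" and psi: "psi = (\<lambda>_. 1) \<or> psi = (\<lambda>w. w)"
  shows "(\<lambda>n. (\<Sum>w\<in>torus.rts n v. psi w * G w) / n) \<longlonglongrightarrow> circle_mean (\<lambda>w. psi w * G w)"
proof (rule grid_mean_tendsto[where c = w.c0 and C = "1 / w.cM", OF _ _ _ v])
  have "(\<lambda>\<theta>. G (cis \<theta>)) \<in> borel_measurable borel" using G by auto
  then show "(\<lambda>\<theta>. psi (cis \<theta>) * G (cis \<theta>)) \<in> borel_measurable borel" using psi by auto
  show "norm (psi w * G w) \<le> 1 / w.cM" if "norm w = 1" for w
    using psi G w.norm_G_le that by (auto simp: norm_mult)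
  show "isCont (\<lambda>\<theta>. psi (cis \<theta>) * G (cis \<theta>)) \<theta>" if "cos \<theta> \<noteq> w.c0" for \<theta>
  proof -
    have "isCont (\<lambda>\<theta>. G (cis \<theta>)) \<theta>" using G isCont_GA_GB[OF that] by auto
    moreover have "continuous_on UNIV cis" by (intro continuous_intros)
    then have "isCont (\<lambda>\<theta>. cis \<theta>) \<theta>" by (simp add: continuous_on_eq_continuous_at)
    ultimately show ?thesis using psi by (auto intro!: continuous_intros)
  qed
qed

text \<open>Limits of the four moments. \<open>has2_resolvent\<close> identifies them as the torus
  integrals of 1, w1, w2 and w1 w2 over Delta.\<close>

definition I0 :: complex where "I0 = circle_mean w.GA"
definition I1 :: complex where "I1 = circle_mean w.GB"
definition I2 :: complex where "I2 = circle_mean (\<lambda>w. w * w.GA w)"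
definition I12 :: complex where "I12 = circle_mean (\<lambda>w. w * w.GB w)"

text \<open>The order of the choices matters: d from the continuity of \<open>Ebil\<close>, then K
  against the far grid points, then R against the near ones given K, then the number L of twists,
  and n last. As R and L are independent of n, |tau| n stays bounded by 8 R L and
  \<open>dev_tendsto\<close> makes the price of the twist vanish.\<close>

lemma type_prob_tendsto:
  assumes t: "t \<in> {1..6}"
  shows "(\<lambda>n. complex_of_real (torus_type_prob (sv_weights \<alpha> \<beta> \<gamma>) n v t)) \<longlonglongrightarrow> w.Ebil \<alpha> \<beta> \<gamma> t I0 I1 I2 I12"
proof (rule LIMSEQ_I)
  fix r :: real assume r: "r > 0"
  define I where "I = w.Ebil \<alpha> \<beta> \<gamma> t I0 I1 I2 I12"
  define e where "e = r / 4"
  have e: "e > 0" using r by (simp add: e_def)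
  have "isCont (\<lambda>p. w.Ebil \<alpha> \<beta> \<gamma> t (fst p) (fst (snd p)) (fst (snd (snd p))) (snd (snd (snd p)))) (I0, I1, I2, I12)"
    unfolding w.Ebil_def by (cases "t = 1"; cases "t = 2"; cases "t = 3"; cases "t = 4"; simp; intro continuous_intros)
  then obtain d where d: "d > 0" "\<And>p. dist p (I0, I1, I2, I12) < d \<Longrightarrow>
      dist (w.Ebil \<alpha> \<beta> \<gamma> t (fst p) (fst (snd p)) (fst (snd (snd p))) (snd (snd (snd p)))) I < e"
    unfolding continuous_at_eps_delta I_def using e by (metis fst_conv snd_conv)
  have close: "norm (w.Ebil \<alpha> \<beta> \<gamma> t m0 m1 m2 m12 - I) \<le> e"
    if "norm (m0 - I0) < d / 4" "norm (m1 - I1) < d / 4" "norm (m2 - I2) < d / 4" "norm (m12 - I12) < d / 4" for m0 m1 m2 m12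
  proof -
    have "dist (m0, m1, m2, m12) (I0, I1, I2, I12) < d"
      using dist_Pair_le_add[of m0 "(m1, m2, m12)" I0 "(I1, I2, I12)"] dist_Pair_le_add[of m1 "(m2, m12)" I1 "(I2, I12)"]
        dist_Pair_le_add[of m2 m12 I2 I12] that unfolding dist_norm[symmetric] by linarith
    from d(2)[OF this] show ?thesis by (simp add: dist_norm)
  qed
  \<comment> \<open>The tolerance d / 4 for each moment is split into four parts d / 16: far points
    (K), near points through 1 / R, near points through 1 / n, and the Riemann sum of the limit
    function.\<close>
  define K where "K = max 1 (24 * w.C1 / w.kap * 16 / d)"
  have K1: "K \<ge> 1" and K0: "K > 0" by (simp_all add: K_def less_max_iff_disj)
  have Kd: "(24 * w.C1 / w.kap) / K \<le> d / 16"
  proof -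
    have "24 * w.C1 / w.kap * 16 / d \<le> K" by (simp add: K_def)
    then show ?thesis using d(1) K0 w.kap_pos by (simp add: field_simps)
  qed
  define c where "c = 12 * K / w.cM"
  have c: "c > 0" using K0 w.cM_pos by (simp add: c_def)
  define R where "R = c * 16 / d"
  have R: "R > 0" using c d by (simp add: R_def)
  have Rd: "c * (1 / R) = d / 16" using c d by (simp add: R_def field_simps)
  define L where "L = nat \<lceil>48 * K\<rceil>"
  have L: "real L \<ge> 48 * K" unfolding L_def by linarith
  have ev1: "eventually (\<lambda>n. 8 * R * L / real n \<le> 1) sequentially"
    "eventually (\<lambda>n. c * (1 / real n) < d / 16) sequentially"
    "eventually (\<lambda>n. 2 * R \<le> real n) sequentially"
  proof -
    have "(\<lambda>n. 8 * R * L / real n) \<longlonglongrightarrow> 0" "(\<lambda>n. c / real n) \<longlonglongrightarrow> 0" by (rule lim_const_over_n)+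
    from order_tendstoD(2)[OF this(1), of 1] order_tendstoD(2)[OF this(2), of "d / 16"] d(1)
    show "eventually (\<lambda>n. 8 * R * L / real n \<le> 1) sequentially" "eventually (\<lambda>n. c * (1 / real n) < d / 16) sequentially"
      by (auto elim: eventually_mono)
    show "eventually (\<lambda>n. 2 * R \<le> real n) sequentially"
      using filterlim_real_sequentially by (simp add: filterlim_at_top)
  qed
  have ev2: "eventually (\<lambda>n. (1 + norm I) * (8 * R * L) * sixv.dev n \<alpha> \<beta> \<gamma> dens < e) sequentially"
  proof -
    have "(\<lambda>n. (1 + norm I) * (8 * R * L) * sixv.dev n \<alpha> \<beta> \<gamma> dens) \<longlonglongrightarrow> (1 + norm I) * (8 * R * L) * 0"
      by (intro tendsto_intros dev_tendsto)
    from order_tendstoD(2)[OF this, of e] e show ?thesis by simp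
  qed
  have ev3: "eventually (\<lambda>n. norm ((\<Sum>w\<in>torus.rts n v. psi w * G w) / n - circle_mean (\<lambda>w. psi w * G w)) < d / 16) sequentially"
    if "v = 1 \<or> v = - 1" "G \<in> {w.GA, w.GB}" "psi = (\<lambda>_. 1) \<or> psi = (\<lambda>w. w)" for v G psi
    using tendstoD[OF G_mean_tendsto[OF that], of "d / 16"] d(1) by (simp add: dist_norm)
  have ev3': "eventually (\<lambda>n. \<forall>v\<in>{1, - 1}. \<forall>G\<in>{w.GA, w.GB}. \<forall>psi\<in>{\<lambda>_. 1, \<lambda>w. w}.
      norm ((\<Sum>w\<in>torus.rts n v. psi w * G w) / n - circle_mean (\<lambda>w. psi w * G w)) < d / 16) sequentially"
    by (intro eventually_ball_finite ballI finite.intros ev3) auto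
  have "eventually (\<lambda>n. norm (complex_of_real (torus_type_prob (sv_weights \<alpha> \<beta> \<gamma>) n v t) - I) < r) sequentially"
    using ev1 ev2 ev3' eventually_ge_at_top[of 2]
  proof eventually_elim
    case (elim n)
    interpret s: sixv n \<alpha> \<beta> \<gamma> by (rule sixv) (use elim in simp)
    have n0: "real n > 0" using elim by simp
    obtain l where l: "l \<le> L"
      "\<And>e1 e2 w. w \<in> s.near K (s.cs e2) \<Longrightarrow> norm (w.Aw w ^ n - s.cs e1 * cis (8 * R * real l / n) * w.Bw w ^ n) \<ge> R / n * w.Mw w ^ n"
      using s.good_twist[OF K1 R L elim(1,3)] by blast
    define \<tau> where "\<tau> = 8 * R * real l / n"
    have cs: "norm (s.cs b) = 1" "s.cs b = 1 \<or> s.cs b = - 1" for b by (auto simp: s.cs_def)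
    have u: "norm (s.cs b * cis \<tau>) = 1" for b by (simp add: norm_mult cs)
    have nzD: "w.Aw w ^ n - s.cs e1 * cis \<tau> * w.Bw w ^ n \<noteq> 0" if w: "w \<in> s.rts (s.cs e2)" for w e1 e2
    proof (cases "w \<in> s.near K (s.cs e2)")
      case True
      have "0 < R / n * w.Mw w ^ n" using R n0 w.Mw_ge[of w] w.cM_pos by (intro mult_pos_pos zero_less_power) auto
      then show ?thesis using l(2)[OF True, of e1] by (auto simp: \<tau>_def)
    next
      case False
      then have "w \<in> s.rts (s.cs e2) - s.near K (s.cs e2)" using w by simp
      from s.far_norm_ne(1)[OF this cs(1) K0] show ?thesis by (intro s.resolvent_gap(1) u)
    qed
    have est: "norm ((\<Sum>w\<in>s.rts (s.cs e2). psi w * g w) / n - circle_mean (\<lambda>w. psi w * G w)) < d / 4"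
      if psi: "psi = (\<lambda>_. 1) \<or> psi = (\<lambda>w. w)" and gG: "(g, G) \<in> {(s.gA (s.cs e1 * cis \<tau>), w.GA), (s.gB (s.cs e1 * cis \<tau>), w.GB)}"
      for psi g G e1 e2
    proof -
      have "norm ((\<Sum>w\<in>s.rts (s.cs e2). psi w * g w) / n - (\<Sum>w\<in>s.rts (s.cs e2). psi w * G w) / n)
         \<le> (24 * w.C1 / w.kap) / K + c * (1 / R + 1 / n)"
        unfolding c_def
        by (rule s.grid_sum_estimate[OF u cs(1) K1 R _ _ gG]) (use psi l(2) in \<open>auto simp: \<tau>_def\<close>)
      also have "\<dots> < 3 * (d / 16)" using Kd Rd elim(2) by (simp add: distrib_left)
      finally have 1: "norm ((\<Sum>w\<in>s.rts (s.cs e2). psi w * g w) / n - (\<Sum>w\<in>s.rts (s.cs e2). psi w * G w) / n) < 3 * (d / 16)" .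
      have "norm ((\<Sum>w\<in>s.rts (s.cs e2). psi w * G w) / n - circle_mean (\<lambda>w. psi w * G w)) < d / 16"
        using elim(5) cs(2)[of e2] psi gG by auto
      from norm_diff_triangle_less[OF 1 this] show ?thesis by simp
    qed
    have mom: "norm (s.mom \<alpha> \<beta> \<gamma> (s.cs e1 * cis \<tau>) (s.cs e2) (\<lambda>_ _. 1) - I0) < d / 4"
      "norm (s.mom \<alpha> \<beta> \<gamma> (s.cs e1 * cis \<tau>) (s.cs e2) (\<lambda>w1 _. w1) - I1) < d / 4"
      "norm (s.mom \<alpha> \<beta> \<gamma> (s.cs e1 * cis \<tau>) (s.cs e2) (\<lambda>_ w2. w2) - I2) < d / 4"
      "norm (s.mom \<alpha> \<beta> \<gamma> (s.cs e1 * cis \<tau>) (s.cs e2) (\<lambda>w1 w2. w1 * w2) - I12) < d / 4" for e1 e2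
    proof -
      have nz: "s.cs e1 * cis \<tau> \<noteq> 0" "s.cs e2 \<noteq> 0" using u[of e1] cs(1)[of e2] by (metis norm_zero zero_neq_one)+
      note m = s.mom_eq[OF nz nzD]
      show "norm (s.mom \<alpha> \<beta> \<gamma> (s.cs e1 * cis \<tau>) (s.cs e2) (\<lambda>_ _. 1) - I0) < d / 4"
        using est[of "\<lambda>_. 1" "s.gA (s.cs e1 * cis \<tau>)" w.GA e1 e2] by (simp add: m I0_def)
      show "norm (s.mom \<alpha> \<beta> \<gamma> (s.cs e1 * cis \<tau>) (s.cs e2) (\<lambda>w1 _. w1) - I1) < d / 4"
        using est[of "\<lambda>_. 1" "s.gB (s.cs e1 * cis \<tau>)" w.GB e1 e2] by (simp add: m I1_def)
      show "norm (s.mom \<alpha> \<beta> \<gamma> (s.cs e1 * cis \<tau>) (s.cs e2) (\<lambda>_ w2. w2) - I2) < d / 4"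
        using est[of "\<lambda>w. w" "s.gA (s.cs e1 * cis \<tau>)" w.GA e1 e2] by (simp add: m I2_def)
      show "norm (s.mom \<alpha> \<beta> \<gamma> (s.cs e1 * cis \<tau>) (s.cs e2) (\<lambda>w1 w2. w1 * w2) - I12) < d / 4"
        using est[of "\<lambda>w. w" "s.gB (s.cs e1 * cis \<tau>)" w.GB e1 e2] by (simp add: m I12_def)
    qed
    have "norm (of_real (\<Sum>S | s.lines S \<and> s.ty (s.red v) S = t. s.pr S) - I) \<le> (1 + norm I) * (\<bar>\<tau>\<bar> * n * s.dev dens) + 2 * e"
    proof (rule s.prob_estimate[OF s.red_V t])
      fix e1 e2 w1 w2
      assume w: "w1 \<in> s.rts (s.cs e1 * cis \<tau>)" "w2 \<in> s.rts (s.cs e2)"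
      \<comment> \<open>A zero of Delta at a grid pair would give A = - w1 B, hence A^n = u B^n,
        which the good twist excludes.\<close>
      show "s.dl \<alpha> \<beta> \<gamma> w1 w2 \<noteq> 0"
      proof
        assume "s.dl \<alpha> \<beta> \<gamma> w1 w2 = 0"
        then have "w.Aw w2 = (- w1) * w.Bw w2" by (simp add: s.dl_eq eq_neg_iff_add_eq_0 mult.commute)
        then have "w.Aw w2 ^ n = s.cs e1 * cis \<tau> * w.Bw w2 ^ n" using w(1) by (simp only: power_mult_distrib s.rts_def mem_Collect_eq)
        then show False using nzD[OF w(2), of e1] by simp
      qed
    next
      show "norm (s.Ebil \<alpha> \<beta> \<gamma> t (s.mom \<alpha> \<beta> \<gamma> (s.cs e1 * cis \<tau>) (s.cs e2) (\<lambda>_ _. 1))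
          (s.mom \<alpha> \<beta> \<gamma> (s.cs e1 * cis \<tau>) (s.cs e2) (\<lambda>w1 _. w1))
          (s.mom \<alpha> \<beta> \<gamma> (s.cs e1 * cis \<tau>) (s.cs e2) (\<lambda>_ w2. w2))
          (s.mom \<alpha> \<beta> \<gamma> (s.cs e1 * cis \<tau>) (s.cs e2) (\<lambda>w1 w2. w1 * w2)) - I) \<le> e" for e1 e2
        by (rule close[OF mom])
    qed
    also have "(1 + norm I) * (\<bar>\<tau>\<bar> * n * s.dev dens) \<le> (1 + norm I) * (8 * R * L) * s.dev dens"
    proof -
      have "\<bar>\<tau>\<bar> * n = 8 * R * l" using R n0 by (simp add: \<tau>_def)
      also have "\<dots> \<le> 8 * R * L" using R l(1) by simp
      finally have "\<bar>\<tau>\<bar> * n * s.dev dens \<le> 8 * R * L * s.dev dens"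
        by (intro mult_right_mono) (auto simp: s.dev_def intro!: sum_nonneg mult_nonneg_nonneg s.pr_nonneg)
      then have "(1 + norm I) * (\<bar>\<tau>\<bar> * n * s.dev dens) \<le> (1 + norm I) * (8 * R * L * s.dev dens)"
        by (intro mult_left_mono) auto
      then show ?thesis by (simp only: mult.assoc)
    qed
    also have "\<dots> < e" by (rule elim(4))
    finally show ?case using e by (simp add: s.torus_type_prob_eq e_def)
  qed
  then show "\<exists>no. \<forall>n\<ge>no. norm (complex_of_real (torus_type_prob (sv_weights \<alpha> \<beta> \<gamma>) n v t) - w.Ebil \<alpha> \<beta> \<gamma> t I0 I1 I2 I12) < r"
    by (simp add: eventually_sequentially I_def)
qed

end

section \<open>The torus integral\<close>

lemma norm_cis_minus_one: "norm (cis x - 1) = 2 * \<bar>sin (x / 2)\<bar>"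
  by (simp add: cis_conv_exp dist_exp_i_1)

text \<open>Up to angle 1 the chord is at least half the angle; from there to pi it is at least 1 /
  2, and pi < 4 turns this into an eighth of the angle.\<close>

lemma norm_cis_minus_one_ge:
  assumes "\<bar>u\<bar> \<le> pi"
  shows "norm (cis u - 1) \<ge> \<bar>u\<bar> / 8"
proof -
  have pos: "norm (cis x - 1) \<ge> x / 8" if x: "0 \<le> x" "x \<le> pi" for x
  proof (cases "x \<le> 1")
    case True
    then show ?thesis using norm_cis_diff_ge[of 0 x] x by simp
  next
    case False
    have "1 / 2 \<le> norm (cis 1 - 1)" using norm_cis_diff_ge[of 0 1] by simp
    also have "\<dots> = 2 * \<bar>sin (1 / 2)\<bar>" by (rule norm_cis_minus_one)
    also have "\<dots> \<le> 2 * \<bar>sin (x / 2)\<bar>"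
    proof -
      have "0 \<le> sin (1 / 2 :: real)" using pi_gt3 by (intro sin_ge_zero) auto
      moreover have "sin (1 / 2) \<le> sin (x / 2)" using False x pi_gt3 by (intro sin_monotone_2pi_le) auto
      ultimately show ?thesis by simp
    qed
    also have "\<dots> = norm (cis x - 1)" by (rule norm_cis_minus_one[symmetric])
    finally show ?thesis using x pi_less_4 by simp
  qed
  have "norm (cis u - 1) = norm (cis \<bar>u\<bar> - 1)"
  proof (cases "u \<ge> 0")
    case False
    have "cis \<bar>u\<bar> - 1 = cnj (cis u - 1)" using False by (simp add: cis_cnj)
    then show ?thesis by (simp only: complex_mod_cnj)
  qed simp
  then show ?thesis using pos[of "\<bar>u\<bar>"] assms by simp
qed

lemma nn_integral_abs_powr_finite:
  assumes p: "0 < p" "p < 1" and a: "a \<ge> 0"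
  shows "(\<integral>\<^sup>+x. ennreal (indicator {- a..a} x * \<bar>x\<bar> powr (- p)) \<partial>lborel) < \<infinity>"
proof -
  have I: "((\<lambda>x. x powr (- p)) has_integral (a powr (- p + 1) / (- p + 1))) {0..a}"
    using p a by (intro has_integral_powr_from_0) auto
  have 1: "(\<integral>\<^sup>+x. ennreal (indicator {0..a} x * x powr (- p)) \<partial>lborel) = a powr (- p + 1) / (- p + 1)"
    by (rule nn_integral_has_integral_lebesgue[OF _ I]) simp
  have 2: "(\<integral>\<^sup>+x. ennreal (indicator {0..a} (- x) * (- x) powr (- p)) \<partial>lborel)
     = (\<integral>\<^sup>+x. ennreal (indicator {0..a} x * x powr (- p)) \<partial>lborel)"
    using nn_integral_real_affine[of "\<lambda>x. ennreal (indicator {0..a} x * x powr (- p))" "-1" 0]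
    by simp
  have "(\<integral>\<^sup>+x. ennreal (indicator {- a..a} x * \<bar>x\<bar> powr (- p)) \<partial>lborel)
     \<le> (\<integral>\<^sup>+x. ennreal (indicator {0..a} x * x powr (- p)) + ennreal (indicator {0..a} (- x) * (- x) powr (- p)) \<partial>lborel)"
    by (intro nn_integral_mono) (auto simp: indicator_def)
  also have "\<dots> = ennreal (a powr (- p + 1) / (- p + 1)) + ennreal (a powr (- p + 1) / (- p + 1))"
    by (subst nn_integral_add) (simp_all add: 1 2)
  finally show ?thesis by (rule order_le_less_trans) simp
qed

text \<open>The kernel is compared with |s - c|^(-p), where c is the argument of z or its translate
  by 2 pi or - 2 pi, one of which lies within pi of s. Translation invariance of the measure makes
  the bound the same for all z.\<close>

lemma circle_kernel_bound:
  assumes p: "0 < p" "p < 1"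
  obtains C where "C < \<infinity>"
    "\<And>z. norm z = 1 \<Longrightarrow> (\<integral>\<^sup>+s. ennreal (indicator {0..2*pi} s * norm (cis s - z) powr (- p)) \<partial>lborel) \<le> C"
proof -
  define K where "K = (\<lambda>u. indicator {- (6 * pi)..6 * pi} u * (8 powr p * \<bar>u\<bar> powr (- p)))"
  have K0: "K u \<ge> 0" for u by (simp add: K_def)
  have Km: "K \<in> borel_measurable borel" unfolding K_def by measurable
  define C where "C = (\<integral>\<^sup>+u. ennreal (K u) \<partial>lborel)"
  have "C = (\<integral>\<^sup>+u. ennreal (8 powr p) * ennreal (indicator {- (6 * pi)..6 * pi} u * \<bar>u\<bar> powr (- p)) \<partial>lborel)"
    unfolding C_def K_def by (intro nn_integral_cong) (simp add: ennreal_mult[symmetric] mult_ac)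
  also have "\<dots> = ennreal (8 powr p) * (\<integral>\<^sup>+u. ennreal (indicator {- (6 * pi)..6 * pi} u * \<bar>u\<bar> powr (- p)) \<partial>lborel)"
    by (intro nn_integral_cmult) measurable
  also have "\<dots> < \<infinity>"
    using nn_integral_abs_powr_finite[OF p, of "6 * pi"] by (simp add: ennreal_mult_less_top)
  finally have Cfin: "C < \<infinity>" .
  have shift: "(\<integral>\<^sup>+s. ennreal (K (s - c)) \<partial>lborel) = C" for c
    unfolding C_def using nn_integral_real_affine[of "\<lambda>u. ennreal (K u)" 1 "- c"] Km
    by (simp add: add.commute)
  show thesis
  proof (rule that[of "C + (C + C)"])
    show "C + (C + C) < \<infinity>" using Cfin by simp
    fix z :: complex assume z: "norm z = 1"
    then have "z \<noteq> 0" by auto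
    define \<phi> where "\<phi> = Arg z"
    have \<phi>: "- pi < \<phi>" "\<phi> \<le> pi" "cis \<phi> = z"
      using Arg_bounded[of z] z cis_Arg[OF \<open>z \<noteq> 0\<close>] by (auto simp: \<phi>_def sgn_eq)
    have pt: "indicator {0..2*pi} s * norm (cis s - z) powr (- p) \<le> K (s - \<phi>) + (K (s - (\<phi> + 2 * pi)) + K (s - (\<phi> - 2 * pi)))" for s
    proof (cases "s \<in> {0..2*pi}")
      case True
      have main: "norm (cis s - z) powr (- p) \<le> K (s - c)" if c: "cis c = z" "\<bar>s - c\<bar> \<le> pi" for c
      \<comment> \<open>At the singularity itself the left side is \<open>0 powr (- p)\<close>,
        which is 0.\<close>
      proof (cases "s = c")
        case True
        then show ?thesis using c K0 by simp
      next
        case False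
        have "cis s - z = cis c * (cis (s - c) - 1)"
          unfolding c(1)[symmetric] by (simp add: cis_mult algebra_simps)
        then have "norm (cis s - z) = norm (cis (s - c) - 1)" by (simp add: norm_mult)
        then have ge: "norm (cis s - z) \<ge> \<bar>s - c\<bar> / 8" using norm_cis_minus_one_ge[OF c(2)] by simp
        have "norm (cis s - z) powr (- p) \<le> (\<bar>s - c\<bar> / 8) powr (- p)"
          using False ge p by (intro powr_mono2') auto
        also have "\<dots> = 8 powr p * \<bar>s - c\<bar> powr (- p)" by (simp add: powr_divide powr_minus field_simps)
        also have "\<dots> = K (s - c)" using c(2) pi_gt_zero by (auto simp: K_def indicator_def)
        finally show ?thesis .
      qed
      have c2: "cis (\<phi> + 2 * pi) = z" "cis (\<phi> - 2 * pi) = z" using \<phi>(3) by (simp_all add: cis_mult[symmetric] cis_divide[symmetric])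
      consider "\<bar>s - \<phi>\<bar> \<le> pi" | "\<bar>s - (\<phi> + 2 * pi)\<bar> \<le> pi" | "\<bar>s - (\<phi> - 2 * pi)\<bar> \<le> pi"
        using True \<phi>(1,2) unfolding abs_le_iff by fastforce
      then show ?thesis
      proof cases
        case 1
        then show ?thesis using main[OF \<phi>(3) 1] True K0[of "s - (\<phi> + 2 * pi)"] K0[of "s - (\<phi> - 2 * pi)"] by simp
      next
        case 2
        then show ?thesis using main[OF c2(1) 2] True K0[of "s - \<phi>"] K0[of "s - (\<phi> - 2 * pi)"] by simp
      next
        case 3
        then show ?thesis using main[OF c2(2) 3] True K0[of "s - (\<phi> + 2 * pi)"] K0[of "s - \<phi>"] by simp
      qed
    next
      case False
      then show ?thesis using K0[of "s - \<phi>"] K0[of "s - (\<phi> + 2 * pi)"] K0[of "s - (\<phi> - 2 * pi)"] by simp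
    qed
    have "(\<integral>\<^sup>+s. ennreal (indicator {0..2*pi} s * norm (cis s - z) powr (- p)) \<partial>lborel)
       \<le> (\<integral>\<^sup>+s. ennreal (K (s - \<phi>)) + (ennreal (K (s - (\<phi> + 2 * pi))) + ennreal (K (s - (\<phi> - 2 * pi)))) \<partial>lborel)"
      using pt by (intro nn_integral_mono) (simp add: K0 ennreal_plus[symmetric] ennreal_leI del: ennreal_plus)
    also have "\<dots> = C + (C + C)"
      using Km by (simp add: nn_integral_add shift)
    finally show "(\<integral>\<^sup>+s. ennreal (indicator {0..2*pi} s * norm (cis s - z) powr (- p)) \<partial>lborel) \<le> C + (C + C)" .
  qed
qed

text \<open>Divide by the larger coefficient, after conjugation if that is a, to reach w + c with
  |c| <= 1. For z take the point of the circle nearest to - c: then |w - z| <= |w + c| + (1 - |c|)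
  <= 2 |w + c|.\<close>

lemma norm_affine_ge:
  assumes "norm a \<noteq> 0 \<or> norm b \<noteq> 0"
  obtains z :: complex where "norm z = 1" "\<And>w. norm w = 1 \<Longrightarrow> norm (a + b * w) \<ge> max (norm a) (norm b) / 2 * norm (w - z)"
proof -
  have near: "\<exists>z. norm z = 1 \<and> (\<forall>w. norm w = 1 \<longrightarrow> norm (w + c) \<ge> norm (w - z) / 2)" if c: "norm c \<le> 1" for c :: complex
  proof -
    define z where "z = (if c = 0 then 1 else - sgn c)"
    have nz: "norm z = 1" by (simp add: z_def norm_sgn)
    have "norm (c + z) = 1 - norm c"
    proof (cases "c = 0")
      case False
      then have "c + z = - of_real (1 - norm c) * sgn c"
        by (simp add: z_def sgn_eq field_simps)
      then show ?thesis using False c by (simp add: norm_mult norm_sgn del: of_real_diff)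
    qed (simp add: z_def)
    moreover have "norm (w - z) \<le> norm (w + c) + norm (c + z)" for w
      using norm_triangle_ineq4[of "w + c" "c + z"] by simp
    moreover have "1 - norm c \<le> norm (w + c)" if "norm w = 1" for w
      using norm_triangle_ineq2[of w "- c"] that by simp
    ultimately have "norm (w - z) / 2 \<le> norm (w + c)" if "norm w = 1" for w
      using that by (smt (verit) field_sum_of_halves)
    then show ?thesis using nz by (intro exI[of _ z]) blast
  qed
  show thesis
  proof (cases "norm a \<le> norm b")
    case True
    then have b: "b \<noteq> 0" using assms by auto
    have "norm (a / b) \<le> 1" using True b by (simp add: norm_divide)
    then obtain z where z: "norm z = 1" "\<And>w. norm w = 1 \<Longrightarrow> norm (w + a / b) \<ge> norm (w - z) / 2" using near by blast
    show thesis
    proof (rule that[OF z(1)])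
      fix w :: complex assume w: "norm w = 1"
      have "a + b * w = b * (w + a / b)" using b by (simp add: field_simps)
      then have "norm (a + b * w) = norm b * norm (w + a / b)" by (simp only: norm_mult)
      then show "norm (a + b * w) \<ge> max (norm a) (norm b) / 2 * norm (w - z)"
        using z(2)[OF w] True mult_left_mono[OF z(2)[OF w], of "norm b"] by (simp add: max_def)
    qed
  next
    case False
    then have a: "a \<noteq> 0" by auto
    have "norm (cnj (b / a)) \<le> 1" using False a by (simp add: norm_divide)
    then obtain z where z: "norm z = 1" "\<And>w. norm w = 1 \<Longrightarrow> norm (w + cnj (b / a)) \<ge> norm (w - z) / 2" using near by blast
    show thesis
    proof (rule that[OF z(1)])
      fix w :: complex assume w: "norm w = 1"
      have ww: "w * cnj w = 1" using w by (simp add: complex_norm_square[symmetric])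
      have "a + b * w = a * w * cnj (w + cnj (b / a))" using a ww by (simp add: field_simps)
      then have "norm (a + b * w) = norm a * norm (w + cnj (b / a))" using w by (simp only: norm_mult complex_mod_cnj mult_1_right)
      then show "norm (a + b * w) \<ge> max (norm a) (norm b) / 2 * norm (w - z)"
        using z(2)[OF w] False mult_left_mono[OF z(2)[OF w], of "norm a"] by (simp add: max_def)
    qed
  qed
qed

text \<open>In place of Cauchy's theorem the grid is used once more: the grid means of the resolvent
  tend to the circle mean by equidistribution and to the right side by
  \<open>resolvent_gap\<close>.\<close>

lemma circle_mean_resolvent:
  fixes a b :: complex
  assumes ne: "norm a \<noteq> norm b"
  shows "circle_mean (\<lambda>w. 1 / (a + b * w)) = (if norm a > norm b then 1 / a else 0)"
    and "circle_mean (\<lambda>w. w / (a + b * w)) = (if norm b > norm a then 1 / b else 0)"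
proof -
  have low: "norm (a + b * w) \<ge> \<bar>norm a - norm b\<bar>" if "norm w = 1" for w
    using norm_triangle_ineq3[of a "- (b * w)"] that by (simp add: norm_mult)
  have nz: "a + b * w \<noteq> 0" if "norm w = 1" for w using low[OF that] ne by auto
  have gap: "\<bar>norm a - norm b\<bar> > 0" using ne by simp
  have cont: "continuous_on UNIV (\<lambda>\<theta>. h (cis \<theta>) / (a + b * cis \<theta>))" if "h = (\<lambda>_. 1) \<or> h = (\<lambda>w. w)" for h
    using that by (auto intro!: continuous_intros simp: nz)
  have lim: "(\<lambda>n. (\<Sum>w\<in>torus.rts n 1. h w / (a + b * w)) / n) \<longlonglongrightarrow> circle_mean (\<lambda>w. h w / (a + b * w))"
    if h: "h = (\<lambda>_. 1) \<or> h = (\<lambda>w. w)" for h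
  \<comment> \<open>No cosine equals 2, so there is no exceptional angle.\<close>
  proof (rule grid_mean_tendsto[where c = 2 and C = "1 / \<bar>norm a - norm b\<bar>"])
    show "(\<lambda>\<theta>. h (cis \<theta>) / (a + b * cis \<theta>)) \<in> borel_measurable borel"
      using cont[OF h] by (rule borel_measurable_continuous_onI)
    show "norm (h w / (a + b * w)) \<le> 1 / \<bar>norm a - norm b\<bar>" if "norm w = 1" for w
      using h that low[OF that] gap by (auto simp: norm_divide intro!: frac_le)
    show "isCont (\<lambda>\<theta>. h (cis \<theta>) / (a + b * cis \<theta>)) \<theta>" for \<theta>
      using cont[OF h] by (simp add: continuous_on_eq_continuous_at)
  qed simp
  have small: "(\<lambda>n. 1 / (real n * \<bar>norm a - norm b\<bar>)) \<longlonglongrightarrow> 0"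
    using tendsto_divide[OF tendsto_const[of 1] tendsto_const[of "\<bar>norm a - norm b\<bar>"], of sequentially] gap
      lim_const_over_n[of "1 / \<bar>norm a - norm b\<bar>"] by (simp add: field_simps)
  have ev: "eventually (\<lambda>n. norm ((\<Sum>w\<in>torus.rts n 1. 1 / (a + b * w)) / n - (if norm a > norm b then 1 / a else 0)) \<le> 1 / (real n * \<bar>norm a - norm b\<bar>)
      \<and> norm ((\<Sum>w\<in>torus.rts n 1. w / (a + b * w)) / n - (if norm b > norm a then 1 / b else 0)) \<le> 1 / (real n * \<bar>norm a - norm b\<bar>)) sequentially"
    using eventually_ge_at_top[of 2]
  proof eventually_elim
    case (elim n)
    \<comment> \<open>\<open>resolvent_gap\<close> concerns arbitrary a and b; the weights 1, 1, 2
      satisfy 4 > 1 and so give access to it.\<close>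
    interpret s: sixv n 1 1 2 by unfold_locales (use elim in auto)
    have n0: "of_nat n \<noteq> (0 :: complex)" using elim by simp
    note g = s.resolvent_gap[OF norm_one ne]
    show ?case
      using s.resolvent_sum[OF one_neq_zero g(1)] g(2,3) n0 by simp
  qed
  have e1: "(\<lambda>n. (\<Sum>w\<in>torus.rts n 1. 1 / (a + b * w)) / n) \<longlonglongrightarrow> (if norm a > norm b then 1 / a else 0)"
    by (rule LIM_zero_cancel, rule Lim_null_comparison[OF _ small]) (use ev in \<open>auto elim: eventually_mono\<close>)
  have e2: "(\<lambda>n. (\<Sum>w\<in>torus.rts n 1. w / (a + b * w)) / n) \<longlonglongrightarrow> (if norm b > norm a then 1 / b else 0)"
    by (rule LIM_zero_cancel, rule Lim_null_comparison[OF _ small]) (use ev in \<open>auto elim: eventually_mono\<close>)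
  show "circle_mean (\<lambda>w. 1 / (a + b * w)) = (if norm a > norm b then 1 / a else 0)"
    using LIMSEQ_unique[OF lim[of "\<lambda>_. 1"] e1] by simp
  show "circle_mean (\<lambda>w. w / (a + b * w)) = (if norm b > norm a then 1 / b else 0)"
    using LIMSEQ_unique[OF lim[of "\<lambda>w. w"] e2] by simp
qed

section \<open>Integrals over two and four angles, and Fubini\<close>

definition iot :: "real \<Rightarrow> real" where "iot \<theta> = indicator {0..2*pi} \<theta> / (2 * pi)"

lemma iot_measurable [measurable]: "iot \<in> borel_measurable borel"
  unfolding iot_def by measurable

lemma iot_nonneg: "iot s \<ge> 0" by (simp add: iot_def)

lemma circle_mean_iot: "circle_mean f = (LINT \<theta>|lborel. iot \<theta> *\<^sub>R f (cis \<theta>))"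
proof -
  have "(LINT \<theta>|lborel. iot \<theta> *\<^sub>R f (cis \<theta>)) = (LINT \<theta>|lborel. (1 / (2 * pi)) *\<^sub>R (indicator {0..2*pi} \<theta> *\<^sub>R f (cis \<theta>)))"
    by (simp add: iot_def)
  also have "\<dots> = (1 / (2 * pi)) *\<^sub>R (LINT \<theta>|lborel. indicator {0..2*pi} \<theta> *\<^sub>R f (cis \<theta>))"
    by (rule integral_scaleR_right)
  also have "(LINT \<theta>|lborel. indicator {0..2*pi} \<theta> *\<^sub>R f (cis \<theta>)) = (LINT \<theta>|lborel. indicator {0..<2*pi} \<theta> *\<^sub>R f (cis \<theta>))"
  proof -
    have i: "(\<lambda>\<theta>. indicator {0..2*pi} \<theta> *\<^sub>R f (cis \<theta>)) = (\<lambda>\<theta>. indicator {0..<2*pi} \<theta> *\<^sub>R f (cis \<theta>) + indicator {2*pi} \<theta> *\<^sub>R f 1)"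
      by (auto simp: indicator_def fun_eq_iff)
    show ?thesis
    proof (cases "integrable lborel (\<lambda>\<theta>. indicator {0..<2*pi} \<theta> *\<^sub>R f (cis \<theta>))")
      case True
      then show ?thesis unfolding i by (subst Bochner_Integration.integral_add) auto
    next
      case False
      have "\<not> integrable lborel (\<lambda>\<theta>. indicator {0..2*pi} \<theta> *\<^sub>R f (cis \<theta>))"
      proof
        assume "integrable lborel (\<lambda>\<theta>. indicator {0..2*pi} \<theta> *\<^sub>R f (cis \<theta>))"
        then have "integrable lborel (\<lambda>\<theta>. indicator {0..2*pi} \<theta> *\<^sub>R f (cis \<theta>) - indicator {2*pi} \<theta> *\<^sub>R f 1)"
          by (intro Bochner_Integration.integrable_diff) auto
        moreover have "(\<lambda>\<theta>. indicator {0..2*pi} \<theta> *\<^sub>R f (cis \<theta>) - indicator {2*pi} \<theta> *\<^sub>R f 1) = (\<lambda>\<theta>. indicator {0..<2*pi} \<theta> *\<^sub>R f (cis \<theta>))"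
          using i by (metis (no_types, lifting) add_diff_cancel_right')
        ultimately show False using False by simp
      qed
      then show ?thesis using False by (simp add: not_integrable_integral_eq)
    qed
  qed
  finally show ?thesis by (simp add: circle_mean_def set_lebesgue_integral_def scaleR_conv_of_real)
qed

text \<open>In \<open>P2 X\<close> the second variable of \<open>X\<close> is the outer one, so that the inner integral is that of the resolvent.\<close>

definition P2 :: "(complex \<Rightarrow> complex \<Rightarrow> complex) \<Rightarrow> real \<times> real \<Rightarrow> complex" where
  "P2 X p = (iot (fst p) * iot (snd p)) *\<^sub>R X (cis (snd p)) (cis (fst p))"

text \<open>Integrability and value are kept together, since the integral of a non-integrable
  function is 0 by default and linearity needs both.\<close>

definition has2 :: "(complex \<Rightarrow> complex \<Rightarrow> complex) \<Rightarrow> complex \<Rightarrow> bool" where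
  "has2 X c \<longleftrightarrow> integrable lborel (P2 X) \<and> integral\<^sup>L lborel (P2 X) = c"

definition P4 :: "(complex \<Rightarrow> complex \<Rightarrow> complex \<Rightarrow> complex \<Rightarrow> complex) \<Rightarrow> (real \<times> real) \<times> (real \<times> real) \<Rightarrow> complex" where
  "P4 F p = (iot (fst (fst p)) * iot (snd (fst p)) * iot (fst (snd p)) * iot (snd (snd p))) *\<^sub>R
     F (cis (snd (fst p))) (cis (fst (fst p))) (cis (snd (snd p))) (cis (fst (snd p)))"

definition has4 :: "(complex \<Rightarrow> complex \<Rightarrow> complex \<Rightarrow> complex \<Rightarrow> complex) \<Rightarrow> complex \<Rightarrow> bool" where
  "has4 F c \<longleftrightarrow> integrable lborel (P4 F) \<and> integral\<^sup>L lborel (P4 F) = c"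

lemma has2_add: "has2 X a \<Longrightarrow> has2 Y b \<Longrightarrow> has2 (\<lambda>w1 w2. X w1 w2 + Y w1 w2) (a + b)"
proof -
  assume "has2 X a" "has2 Y b"
  moreover have "P2 (\<lambda>w1 w2. X w1 w2 + Y w1 w2) = (\<lambda>p. P2 X p + P2 Y p)"
    by (simp add: P2_def fun_eq_iff scaleR_add_right)
  ultimately show ?thesis by (simp add: has2_def)
qed

lemma has2_cmult: "has2 X a \<Longrightarrow> has2 (\<lambda>w1 w2. c * X w1 w2) (c * a)"
proof -
  assume "has2 X a"
  moreover have "P2 (\<lambda>w1 w2. c * X w1 w2) = (\<lambda>p. c * P2 X p)"
    by (simp add: P2_def fun_eq_iff)
  ultimately show ?thesis by (simp add: has2_def)
qed

lemma has4_diff: "has4 F a \<Longrightarrow> has4 G b \<Longrightarrow> has4 (\<lambda>w1 w2 v1 v2. F w1 w2 v1 v2 - G w1 w2 v1 v2) (a - b)"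
proof -
  assume "has4 F a" "has4 G b"
  moreover have "P4 (\<lambda>w1 w2 v1 v2. F w1 w2 v1 v2 - G w1 w2 v1 v2) = (\<lambda>p. P4 F p - P4 G p)"
    by (simp add: P4_def fun_eq_iff scaleR_diff_right)
  ultimately show ?thesis by (simp add: has4_def)
qed

lemma has4_cmult: "has4 F a \<Longrightarrow> has4 (\<lambda>w1 w2 v1 v2. c * F w1 w2 v1 v2) (c * a)"
proof -
  assume "has4 F a"
  moreover have "P4 (\<lambda>w1 w2 v1 v2. c * F w1 w2 v1 v2) = (\<lambda>p. c * P4 F p)"
    by (simp add: P4_def fun_eq_iff)
  ultimately show ?thesis by (simp add: has4_def)
qed

lemma has4_mult:
  assumes X: "has2 X a" and Y: "has2 Y b"
  shows "has4 (\<lambda>w1 w2 v1 v2. X w1 w2 * Y v1 v2) (a * b)"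
proof -
  have iX: "integrable lborel (P2 X)" and iY: "integrable lborel (P2 Y)" using X Y by (auto simp: has2_def)
  have P: "P4 (\<lambda>w1 w2 v1 v2. X w1 w2 * Y v1 v2) = (\<lambda>p. P2 X (fst p) * P2 Y (snd p))"
    by (simp add: P4_def P2_def fun_eq_iff scaleR_conv_of_real mult_ac)
  have [measurable]: "P2 X \<in> borel_measurable lborel" "P2 Y \<in> borel_measurable lborel" using iX iY by auto
  have int: "integrable (lborel \<Otimes>\<^sub>M lborel) (\<lambda>p. P2 X (fst p) * P2 Y (snd p))"
    by (rule lborel_pair.Fubini_integrable) (use iX iY in \<open>auto simp: norm_mult intro!: integrable_mult_left integrable_norm AE_I2\<close>)
  then have "integral\<^sup>L (lborel \<Otimes>\<^sub>M lborel) (\<lambda>p. P2 X (fst p) * P2 Y (snd p)) = a * b"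
    using lborel_pair.integral_fst'[OF int] X Y by (simp add: has2_def)
  then show ?thesis using int by (simp add: has4_def P lborel_prod)
qed

definition R4 :: "(real \<times> real) \<times> (real \<times> real) \<Rightarrow> real ^ 4" where
  "R4 p = (\<chi> k. if k = 1 then snd (fst p) else if k = 2 then fst (fst p) else if k = 3 then snd (snd p) else fst (snd p))"

lemma R4_nth [simp]: "R4 p $ 1 = snd (fst p)" "R4 p $ 2 = fst (fst p)" "R4 p $ 3 = snd (snd p)" "R4 p $ 4 = fst (snd p)"
  by (simp_all add: R4_def)

lemma continuous_R4: "continuous_on UNIV R4"
  unfolding R4_def
proof (rule continuous_on_vec_lambda)
  fix k :: 4
  show "continuous_on UNIV (\<lambda>p :: (real \<times> real) \<times> (real \<times> real). if k = 1 then snd (fst p) else if k = 2 then fst (fst p)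
    else if k = 3 then snd (snd p) else fst (snd p))"
    by (cases "k = 1"; cases "k = 2"; cases "k = 3") (simp_all add: continuous_on_fst continuous_on_snd)
qed

lemma prod_UNIV_4: "(\<Prod>k\<in>UNIV. f k) = f 1 * f 2 * f 3 * f (4 :: 4)" for f :: "4 \<Rightarrow> real"
  unfolding UNIV_4 by (simp add: mult.assoc)

text \<open>Fubini works on nested pairs while the statement integrates over
  \<open>real ^ 4\<close>. The two Lebesgue measures correspond under the coordinate map, as they
  agree on boxes.\<close>

lemma lborel_R4: "(lborel :: (real ^ 4) measure) = distr lborel borel R4"
proof (rule lborel_eqI)
  have m: "R4 \<in> borel_measurable borel" by (rule borel_measurable_continuous_onI[OF continuous_R4])
  fix l u :: "real ^ 4" assume lu: "\<And>b. b \<in> Basis \<Longrightarrow> l \<bullet> b \<le> u \<bullet> b"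
  have le: "l $ k \<le> u $ k" for k using lu[of "axis k 1"] by (simp add: inner_axis axis_in_Basis_iff)
  have "R4 -` box l u \<inter> space lborel = ({l $ 2<..<u $ 2} \<times> {l $ 1<..<u $ 1}) \<times> ({l $ 4<..<u $ 4} \<times> {l $ 3<..<u $ 3})"
    by (auto simp: forall_4 mem_box_cart)
  then have "emeasure (distr lborel borel R4) (box l u)
     = emeasure (lborel \<Otimes>\<^sub>M lborel) (({l $ 2<..<u $ 2} \<times> {l $ 1<..<u $ 1}) \<times> ({l $ 4<..<u $ 4} \<times> {l $ 3<..<u $ 3}))"
    using m by (simp add: emeasure_distr lborel_prod)
  also have "\<dots> = emeasure (lborel \<Otimes>\<^sub>M lborel) ({l $ 2<..<u $ 2} \<times> {l $ 1<..<u $ 1}) * emeasure (lborel \<Otimes>\<^sub>M lborel) ({l $ 4<..<u $ 4} \<times> {l $ 3<..<u $ 3})"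
    by (subst lborel.emeasure_pair_measure_Times) (auto simp: lborel_prod intro!: borel_open open_Times)
  also have "\<dots> = ennreal (u $ 2 - l $ 2) * ennreal (u $ 1 - l $ 1) * (ennreal (u $ 4 - l $ 4) * ennreal (u $ 3 - l $ 3))"
    by (simp add: lborel.emeasure_pair_measure_Times le)
  also have "\<dots> = ennreal ((u $ 1 - l $ 1) * (u $ 2 - l $ 2) * (u $ 3 - l $ 3) * (u $ 4 - l $ 4))"
  proof -
    have "ennreal b * ennreal a * (ennreal d * ennreal c) = ennreal (a * b * c * d)"
      if "0 \<le> a" "0 \<le> b" "0 \<le> c" "0 \<le> d" for a b c d :: real
    proof -
      have "a * b * c * d = (b * a) * (d * c)" by simp
      then show ?thesis using that by (simp only: ennreal_mult mult_nonneg_nonneg)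
    qed
    from this[of "u $ 1 - l $ 1" "u $ 2 - l $ 2" "u $ 3 - l $ 3" "u $ 4 - l $ 4"] show ?thesis
      using le[of 1] le[of 2] le[of 3] le[of 4] by (simp only: diff_ge_0_iff_ge)
  qed
  also have "(u $ 1 - l $ 1) * (u $ 2 - l $ 2) * (u $ 3 - l $ 3) * (u $ 4 - l $ 4) = (\<Prod>b\<in>Basis. (u - l) \<bullet> b)"
  proof -
    have B: "(Basis :: (real ^ 4) set) = (\<lambda>k. axis k 1) ` UNIV" by (auto simp: Basis_vec_def)
    have "(\<Prod>b\<in>Basis. (u - l) \<bullet> b) = (\<Prod>k\<in>UNIV. (u - l) $ k)"
      unfolding B by (subst prod.reindex) (auto simp: inj_on_def axis_eq_axis inner_axis)
    also have "\<dots> = (u - l) $ 1 * (u - l) $ 2 * (u - l) $ 3 * (u - l) $ 4" by (rule prod_UNIV_4)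
    finally show ?thesis by (simp only: vector_minus_component)
  qed
  finally show "emeasure (distr lborel borel R4) (box l u) = (\<Prod>b\<in>Basis. (u - l) \<bullet> b)" .
qed simp

lemma torus4_integral_eq:
  assumes "has4 F c"
  shows "torus4_integral F = c"
proof -
  define G where "G = (\<lambda>\<theta> :: real ^ 4. indicator (cbox 0 (\<chi> k. 2 * pi)) \<theta> *\<^sub>R (complex_of_real (1 / (2 * pi) ^ 4) *
        F (cis (\<theta> $ 1)) (cis (\<theta> $ 2)) (cis (\<theta> $ 3)) (cis (\<theta> $ 4))))"
  define inv4 where "inv4 = (\<lambda>\<theta> :: real ^ 4. ((\<theta> $ 2, \<theta> $ 1), (\<theta> $ 4, \<theta> $ 3)))"
  have G: "G \<theta> = P4 F (inv4 \<theta>)" for \<theta>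
    by (auto simp: G_def P4_def inv4_def iot_def indicator_def mem_box_cart forall_4 scaleR_conv_of_real power4_eq_xxxx)
  have "continuous_on UNIV inv4" unfolding inv4_def by (intro continuous_intros)
  then have [measurable]: "inv4 \<in> borel_measurable borel" by (rule borel_measurable_continuous_onI)
  have PF: "P4 F \<in> borel_measurable borel" using assms by (auto simp: has4_def)
  have Gm: "G \<in> borel_measurable borel"
    unfolding G[abs_def] using PF by measurable
  have m: "R4 \<in> borel_measurable lborel" using borel_measurable_continuous_onI[OF continuous_R4] by simp
  have "torus4_integral F = integral\<^sup>L lborel G"
    unfolding torus4_integral_def set_lebesgue_integral_def G_def ..
  also have "\<dots> = integral\<^sup>L lborel (\<lambda>p. G (R4 p))"
    unfolding lborel_R4 by (rule integral_distr[OF m]) (use Gm in simp)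
  also have "(\<lambda>p. G (R4 p)) = P4 F" by (simp add: G inv4_def)
  finally show ?thesis using assms by (simp add: has4_def)
qed

section \<open>Integrability of the resolvent and evaluation of the torus integral\<close>

context weights
begin

lemma gap_AE: "AE t in lborel. norm (w.Aw (cis t)) \<noteq> norm (w.Bw (cis t)) \<and> cis t \<noteq> w.zeta \<and> cis t \<noteq> cnj w.zeta"
proof -
  have "AE t in lborel. cos t \<noteq> w.c0 \<and> cos t \<noteq> Re w.zeta"
    using AE_cos_ne[of w.c0] AE_cos_ne[of "Re w.zeta"] by eventually_elim simp
  then show ?thesis
  proof eventually_elim
    case (elim t)
    then show ?case using norm_A_ne_B[of t] by (metis cis.sel(1) complex_cnj(1) complex.sel(1) cnj.sel(1))
  qed
qed

text \<open>Split 1 / q = q^(-1/4) q^(-3/4) for q = |A + B w1|. The first power is bounded through q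
  >= ||A| - |B||, the second through q >= cM / 2 times the distance of w1 to a point z of the
  circle. Then |w1 - z|^(-3/4) has a bounded integral uniformly in z, and ||A| - |B||^(-1/4) stays
  integrable in w2: even where the two balance points merge and the gap closes quadratically, its
  singularity has exponent 1/2.\<close>

lemma resolvent_integrable:
  assumes psi: "psi = (\<lambda>_. 1) \<or> psi = (\<lambda>w. w)" and h: "h = (\<lambda>_. 1) \<or> h = (\<lambda>w. w)"
  shows "integrable lborel (P2 (\<lambda>w1 w2. psi w2 * h w1 / (w.Aw w2 + w.Bw w2 * w1)))"
proof -
  define X where "X = (\<lambda>w1 w2. psi w2 * h w1 / (w.Aw w2 + w.Bw w2 * w1))"
  have [measurable]: "(\<lambda>p :: real \<times> real. psi (cis (fst p))) \<in> borel_measurable borel" "(\<lambda>p :: real \<times> real. h (cis (snd p))) \<in> borel_measurable borel"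
    using psi h by (auto intro!: borel_measurable_continuous_onI continuous_intros)
  have [measurable]: "(\<lambda>p :: real \<times> real. w.Aw (cis (fst p)) + w.Bw (cis (fst p)) * cis (snd p)) \<in> borel_measurable borel"
    unfolding w.Aw_def w.Bw_def by (intro borel_measurable_continuous_onI continuous_intros)
  have [measurable]: "(\<lambda>p :: real \<times> real. iot (fst p)) \<in> borel_measurable borel" "(\<lambda>p :: real \<times> real. iot (snd p)) \<in> borel_measurable borel"
    by (rule measurable_compose[OF borel_measurable_continuous_onI iot_measurable], intro continuous_intros)+
  have "P2 X \<in> borel_measurable borel" unfolding P2_def[abs_def] X_def by measurable
  then have [measurable]: "P2 X \<in> borel_measurable (lborel \<Otimes>\<^sub>M lborel)" by (simp add: lborel_prod)
  obtain C where C: "C < \<infinity>" "\<And>z. norm z = 1 \<Longrightarrow> (\<integral>\<^sup>+s. ennreal (indicator {0..2*pi} s * norm (cis s - z) powr (- (3 / 4))) \<partial>lborel) \<le> C"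
    using circle_kernel_bound[of "3 / 4"] by auto
  obtain C' where C': "C' < \<infinity>" "\<And>z. norm z = 1 \<Longrightarrow> (\<integral>\<^sup>+s. ennreal (indicator {0..2*pi} s * norm (cis s - z) powr (- (1 / 2))) \<partial>lborel) \<le> C'"
    using circle_kernel_bound[of "1 / 2"] by auto
  define k1 where "k1 = (w.cM / 2) powr (- (3 / 4))"
  define k2 where "k2 = (w.kap / (2 * w.C1)) powr (- (1 / 4))"
  define N where "N = (\<lambda>t. indicator {0..2*pi} t * (norm (cis t - w.zeta) powr (- (1 / 2)) + norm (cis t - cnj w.zeta) powr (- (1 / 2))))"
  have N0: "N t \<ge> 0" for t by (simp add: N_def)
  have "AE t in lborel. (\<integral>\<^sup>+s. ennreal (norm (P2 X (t, s))) \<partial>lborel) \<le> ennreal (k1 * k2 * N t) * C"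
    using gap_AE
  proof eventually_elim
    case (elim t)
    let ?A = "w.Aw (cis t)" and ?B = "w.Bw (cis t)"
    define D where "D = \<bar>norm ?A - norm ?B\<bar>"
    have D0: "D > 0" using elim by (simp add: D_def)
    have "norm ?A \<noteq> 0 \<or> norm ?B \<noteq> 0" using elim by auto
    then obtain z where z: "norm z = 1" "\<And>w. norm w = 1 \<Longrightarrow> norm (?A + ?B * w) \<ge> max (norm ?A) (norm ?B) / 2 * norm (w - z)"
      using norm_affine_ge by blast
    have DN: "indicator {0..2*pi} t * D powr (- (1 / 4)) \<le> k2 * N t"
    proof (cases "t \<in> {0..2*pi}")
      case True
      define x y where "x = norm (cis t - w.zeta)" and "y = norm (cis t - cnj w.zeta)"
      have xy: "x > 0" "y > 0" using elim by (simp_all add: x_def y_def)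
      have kc: "w.kap / (2 * w.C1) > 0" using w.kap_pos w.C1_pos by simp
      have "w.kap / (2 * w.C1) * (x * y) \<le> D" using w.gap_lower[of "cis t"] by (simp add: D_def x_def y_def)
      then have "D powr (- (1 / 4)) \<le> (w.kap / (2 * w.C1) * (x * y)) powr (- (1 / 4))"
        using mult_pos_pos[OF kc mult_pos_pos[OF xy]] by (intro powr_mono2') auto
      also have "\<dots> = k2 * (x powr (- (1 / 4)) * y powr (- (1 / 4)))"
        unfolding k2_def using kc xy by (subst powr_mult) (auto simp: powr_mult)
      \<comment> \<open>This decouples the two balance points; the exponent 1/2 < 1 remains
        integrable at each of them.\<close>
      also have "x powr (- (1 / 4)) * y powr (- (1 / 4)) \<le> x powr (- (1 / 2)) + y powr (- (1 / 2))"
      proof -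
        have "x powr (- (1 / 2)) = (x powr (- (1 / 4)))\<^sup>2" "y powr (- (1 / 2)) = (y powr (- (1 / 4)))\<^sup>2"
          by (simp_all add: power2_eq_square powr_add[symmetric])
        moreover have "a * b \<le> a\<^sup>2 + b\<^sup>2" if "a \<ge> 0" "b \<ge> 0" for a b :: real
        proof -
          have "0 \<le> (a - b)\<^sup>2" by simp
          then have "2 * (a * b) \<le> a\<^sup>2 + b\<^sup>2" by (simp add: power2_diff)
          moreover have "0 \<le> a * b" using that by simp
          ultimately show ?thesis by linarith
        qed
        ultimately show ?thesis by simp
      qed
      finally show ?thesis using True by (simp add: N_def x_def y_def k2_def mult_left_mono)
    next
      case False
      then show ?thesis using N0[of t] by (simp add: k2_def)
    qed
    have pt: "norm (P2 X (t, s)) \<le> (k1 * k2 * N t) * (indicator {0..2*pi} s * norm (cis s - z) powr (- (3 / 4)))"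
      if sz: "cis s \<noteq> z" for s
    proof (cases "s \<in> {0..2*pi} \<and> t \<in> {0..2*pi}")
      case True
      define q where "q = norm (?A + ?B * cis s)"
      have qD: "q \<ge> D"
        using norm_triangle_ineq3[of ?A "- (?B * cis s)"] by (simp add: q_def D_def norm_mult)
      have q0: "q > 0" using qD D0 by linarith
      have "norm (X (cis s) (cis t)) = q powr (- 1)"
        using psi h q0 by (auto simp: X_def norm_divide norm_mult q_def powr_minus_divide)
      also have "\<dots> = q powr (- (1 / 4)) * q powr (- (3 / 4))" by (simp add: powr_add[symmetric])
      also have "\<dots> \<le> D powr (- (1 / 4)) * (k1 * norm (cis s - z) powr (- (3 / 4)))"
      proof (intro mult_mono)
        show "q powr (- (1 / 4)) \<le> D powr (- (1 / 4))" using qD D0 by (intro powr_mono2') auto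
        show "q powr (- (3 / 4)) \<le> k1 * norm (cis s - z) powr (- (3 / 4))"
        proof -
          have "w.cM / 2 * norm (cis s - z) \<le> max (norm ?A) (norm ?B) / 2 * norm (cis s - z)"
            using w.Mw_ge[of "cis t"] by (intro mult_right_mono) (auto simp: w.Mw_def)
          also have "\<dots> \<le> q" unfolding q_def by (rule z(2)) simp
          finally have "q powr (- (3 / 4)) \<le> (w.cM / 2 * norm (cis s - z)) powr (- (3 / 4))"
            using w.cM_pos sz by (intro powr_mono2') auto
          then show ?thesis unfolding k1_def by (subst powr_mult[symmetric]) (use w.cM_pos in auto)
        qed
      qed auto
      also have "\<dots> \<le> (k2 * N t) * (k1 * norm (cis s - z) powr (- (3 / 4)))"
        using DN True by (intro mult_right_mono) (auto simp: k1_def)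
      finally have "norm (X (cis s) (cis t)) \<le> k1 * k2 * N t * norm (cis s - z) powr (- (3 / 4))" by (simp add: mult_ac)
      moreover have "norm (P2 X (t, s)) \<le> norm (X (cis s) (cis t))"
      proof -
        have "iot t \<le> 1" "iot s \<le> 1" using pi_gt3 by (auto simp: iot_def indicator_def)
        then have "iot t * iot s \<le> 1" using iot_nonneg by (simp add: mult_le_one)
        then show ?thesis using iot_nonneg by (simp add: P2_def mult_left_le_one_le)
      qed
      ultimately show ?thesis using True by simp
    next
      case False
      then have "P2 X (t, s) = 0" by (auto simp: P2_def iot_def)
      then show ?thesis using N0 by (simp add: k1_def k2_def)
    qed
    have "(\<integral>\<^sup>+s. ennreal (norm (P2 X (t, s))) \<partial>lborel)
       \<le> (\<integral>\<^sup>+s. ennreal (k1 * k2 * N t) * ennreal (indicator {0..2*pi} s * norm (cis s - z) powr (- (3 / 4))) \<partial>lborel)"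
    proof (rule nn_integral_mono_AE)
      show "AE s in lborel. ennreal (norm (P2 X (t, s))) \<le> ennreal (k1 * k2 * N t) * ennreal (indicator {0..2*pi} s * norm (cis s - z) powr (- (3 / 4)))"
        using AE_cos_ne[of "Re z"]
      proof eventually_elim
        case (elim s)
        then have "cis s \<noteq> z" by auto
        from ennreal_leI[OF pt[OF this]] show ?case using N0 by (simp add: ennreal_mult k1_def k2_def)
      qed
    qed
    also have "\<dots> = ennreal (k1 * k2 * N t) * (\<integral>\<^sup>+s. ennreal (indicator {0..2*pi} s * norm (cis s - z) powr (- (3 / 4))) \<partial>lborel)"
      by (rule nn_integral_cmult) measurable
    also have "\<dots> \<le> ennreal (k1 * k2 * N t) * C" by (intro mult_left_mono C(2) z(1)) simp
    finally show ?case .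
  qed
  then have "(\<integral>\<^sup>+t. (\<integral>\<^sup>+s. ennreal (norm (P2 X (t, s))) \<partial>lborel) \<partial>lborel) \<le> (\<integral>\<^sup>+t. ennreal (k1 * k2 * N t) * C \<partial>lborel)"
    by (rule nn_integral_mono_AE)
  also have "\<dots> = ennreal (k1 * k2) * (\<integral>\<^sup>+t. ennreal (N t) \<partial>lborel) * C"
  proof -
    have [measurable]: "N \<in> borel_measurable borel" unfolding N_def by measurable
    have "(\<integral>\<^sup>+t. ennreal (k1 * k2 * N t) * C \<partial>lborel) = (\<integral>\<^sup>+t. ennreal (k1 * k2) * ennreal (N t) \<partial>lborel) * C"
      by (subst nn_integral_multc) (auto simp: ennreal_mult[symmetric] N0 k1_def k2_def)
    then show ?thesis by (subst (asm) nn_integral_cmult) auto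
  qed
  also have "\<dots> < \<infinity>"
  proof -
    have "(\<integral>\<^sup>+t. ennreal (N t) \<partial>lborel) = (\<integral>\<^sup>+s. ennreal (indicator {0..2*pi} s * norm (cis s - w.zeta) powr (- (1 / 2))) \<partial>lborel)
        + (\<integral>\<^sup>+s. ennreal (indicator {0..2*pi} s * norm (cis s - cnj w.zeta) powr (- (1 / 2))) \<partial>lborel)"
      by (subst nn_integral_add[symmetric]) (auto simp: N_def distrib_left)
    also have "\<dots> \<le> C' + C'" by (intro add_mono C'(2) w.norm_zeta)
    also have "\<dots> < \<infinity>" using C'(1) by simp
    finally show ?thesis using C(1) by (simp add: ennreal_mult_less_top)
  qed
  finally have "(\<integral>\<^sup>+t. (\<integral>\<^sup>+s. ennreal (norm (P2 X (t, s))) \<partial>lborel) \<partial>lborel) < \<infinity>" .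
  moreover have "(\<integral>\<^sup>+t. (\<integral>\<^sup>+s. ennreal (norm (P2 X (t, s))) \<partial>lborel) \<partial>lborel) = (\<integral>\<^sup>+p. ennreal (norm (P2 X p)) \<partial>(lborel \<Otimes>\<^sub>M lborel))"
    by (rule lborel.nn_integral_fst) measurable
  ultimately have "integrable (lborel \<Otimes>\<^sub>M lborel) (P2 X)"
    by (intro integrableI_bounded) auto
  then show ?thesis by (simp add: lborel_prod X_def)
qed

text \<open>Integrate over w1 first: for almost every w2 the moduli of A and B differ, and the inner
  mean is given by \<open>circle_mean_resolvent\<close>.\<close>

lemma has2_resolvent:
  assumes psi: "psi = (\<lambda>_. 1) \<or> psi = (\<lambda>w. w)"
  shows "has2 (\<lambda>w1 w2. psi w2 / (w.Aw w2 + w.Bw w2 * w1)) (circle_mean (\<lambda>w. psi w * w.GA w))"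
    and "has2 (\<lambda>w1 w2. psi w2 * w1 / (w.Aw w2 + w.Bw w2 * w1)) (circle_mean (\<lambda>w. psi w * w.GB w))"
proof -
  have main: "has2 (\<lambda>w1 w2. psi w2 * h w1 / (w.Aw w2 + w.Bw w2 * w1)) (circle_mean (\<lambda>w. psi w * G w))"
    if h: "h = (\<lambda>_. 1) \<or> h = (\<lambda>w. w)"
      and G: "\<And>t. norm (w.Aw (cis t)) \<noteq> norm (w.Bw (cis t)) \<Longrightarrow> circle_mean (\<lambda>w1. h w1 / (w.Aw (cis t) + w.Bw (cis t) * w1)) = G (cis t)"
      and Gm: "(\<lambda>t. G (cis t)) \<in> borel_measurable borel" for h G
  proof -
    define X where "X = (\<lambda>w1 w2. psi w2 * h w1 / (w.Aw w2 + w.Bw w2 * w1))"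
    have int: "integrable (lborel \<Otimes>\<^sub>M lborel) (P2 X)"
      using resolvent_integrable[OF psi h] by (simp add: lborel_prod X_def)
    have "integral\<^sup>L (lborel \<Otimes>\<^sub>M lborel) (P2 X) = (LINT t|lborel. LINT s|lborel. P2 X (t, s))"
      by (rule lborel_pair.integral_fst'[OF int, symmetric])
    also have "\<dots> = (LINT t|lborel. iot t *\<^sub>R (psi (cis t) * G (cis t)))"
    proof (rule integral_cong_AE)
      show "(\<lambda>t. LINT s|lborel. P2 X (t, s)) \<in> borel_measurable lborel"
        using lborel_pair.integrable_fst'[OF int] by auto
      have "(\<lambda>t. psi (cis t)) \<in> borel_measurable borel" using psi by auto
      then show "(\<lambda>t. iot t *\<^sub>R (psi (cis t) * G (cis t))) \<in> borel_measurable lborel" using Gm by simp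
      show "AE t in lborel. (LINT s|lborel. P2 X (t, s)) = iot t *\<^sub>R (psi (cis t) * G (cis t))"
        using gap_AE
      proof eventually_elim
        case (elim t)
        have "(LINT s|lborel. P2 X (t, s)) = (LINT s|lborel. (of_real (iot t) * psi (cis t)) * (iot s *\<^sub>R (h (cis s) / (w.Aw (cis t) + w.Bw (cis t) * cis s))))"
          by (intro Bochner_Integration.integral_cong refl) (simp add: P2_def X_def scaleR_conv_of_real mult_ac)
        also have "\<dots> = of_real (iot t) * psi (cis t) * circle_mean (\<lambda>w1. h w1 / (w.Aw (cis t) + w.Bw (cis t) * w1))"
          unfolding circle_mean_iot by (rule integral_mult_right_zero)
        finally show ?case using elim G[of t] by (simp add: scaleR_conv_of_real)
      qed
    qed
    also have "\<dots> = circle_mean (\<lambda>w. psi w * G w)" by (simp add: circle_mean_iot)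
    finally show ?thesis using int by (simp add: has2_def lborel_prod X_def)
  qed
  show "has2 (\<lambda>w1 w2. psi w2 / (w.Aw w2 + w.Bw w2 * w1)) (circle_mean (\<lambda>w. psi w * w.GA w))"
    using main[of "\<lambda>_. 1" w.GA] circle_mean_resolvent(1) by (simp add: w.GA_def)
  show "has2 (\<lambda>w1 w2. psi w2 * w1 / (w.Aw w2 + w.Bw w2 * w1)) (circle_mean (\<lambda>w. psi w * w.GB w))"
    using main[of "\<lambda>w. w" w.GB] circle_mean_resolvent(2) by (simp add: w.GB_def)
qed

lemma Delta_eq: "Delta \<alpha> \<beta> \<gamma> w1 w2 = w.Aw w2 + w.Bw w2 * w1"
  using w.dl_eq[of w1 w2] by (simp add: Delta_def w.dl_def)

text \<open>Each f_t is a combination of two products of a function of (w1, w2) and one of (v1, v2),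
  so its integral over the product of the two Deltas is bilinear in the four moments and matches
  \<open>Ebil\<close>.\<close>

lemma has4_type:
  assumes t: "t \<in> {1..6}"
  shows "has4 (\<lambda>w1 w2 v1 v2. f_num \<alpha> \<beta> \<gamma> t w1 w2 v1 v2 / (Delta \<alpha> \<beta> \<gamma> w1 w2 * Delta \<alpha> \<beta> \<gamma> v1 v2))
    (w.Ebil \<alpha> \<beta> \<gamma> t I0 I1 I2 I12)"
proof -
  let ?D = "Delta \<alpha> \<beta> \<gamma>" and ?a = "complex_of_real \<alpha>" and ?b = "complex_of_real \<beta>" and ?g = "(complex_of_real \<gamma>)\<^sup>2"
  have h0: "has2 (\<lambda>w1 w2. 1 / ?D w1 w2) I0" and h2: "has2 (\<lambda>w1 w2. w2 / ?D w1 w2) I2"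
    and h1: "has2 (\<lambda>w1 w2. w1 / ?D w1 w2) I1" and h12: "has2 (\<lambda>w1 w2. w2 * w1 / ?D w1 w2) I12"
    using has2_resolvent[of "\<lambda>_. 1"] has2_resolvent[of "\<lambda>w. w"]
    by (simp_all add: Delta_eq I0_def I1_def I2_def I12_def)
  note a0 = has2_add[OF h0 has2_cmult[OF h1, of ?a]] and b0 = has2_add[OF h0 has2_cmult[OF h2, of ?b]]
    and a2 = has2_add[OF h2 has2_cmult[OF h12, of ?a]] and b1 = has2_add[OF h1 has2_cmult[OF h12, of ?b]]
  have tt: "t = 1 \<or> t = 2 \<or> t = 3 \<or> t = 4 \<or> t = 5 \<or> t = 6" using t by auto
  have 1: "has4 (\<lambda>w1 w2 v1 v2. f_num \<alpha> \<beta> \<gamma> 1 w1 w2 v1 v2 / (?D w1 w2 * ?D v1 v2)) ((I0 + ?b * I2) * (I0 + ?a * I1) - ?g * (I1 * I2))"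
    using has4_diff[OF has4_mult[OF b0 a0] has4_cmult[OF has4_mult[OF h1 h2], of ?g]]
    by (simp add: f_num_def Let_def diff_divide_distrib add_divide_distrib[symmetric] mult_ac)
  have 2: "has4 (\<lambda>w1 w2 v1 v2. f_num \<alpha> \<beta> \<gamma> 2 w1 w2 v1 v2 / (?D w1 w2 * ?D v1 v2))
      ((?g - ?a * ?b) * (?g * (I12 * I12) - (I1 + ?b * I12) * (I2 + ?a * I12)))"
    using has4_cmult[OF has4_diff[OF has4_cmult[OF has4_mult[OF h12 h12], of ?g] has4_mult[OF b1 a2]], of "?g - ?a * ?b"]
    by (rule back_subst[of "\<lambda>F. has4 F _"])
      (intro ext, simp add: f_num_def Let_def add_divide_distrib[symmetric] diff_divide_distrib[symmetric], simp add: algebra_simps)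
  have 3: "has4 (\<lambda>w1 w2 v1 v2. f_num \<alpha> \<beta> \<gamma> 3 w1 w2 v1 v2 / (?D w1 w2 * ?D v1 v2))
      (?b * ((I0 + ?b * I2) * (I2 + ?a * I12) - ?g * (I12 * I2)))"
    using has4_cmult[OF has4_diff[OF has4_mult[OF b0 a2] has4_cmult[OF has4_mult[OF h12 h2], of ?g]], of ?b]
    by (rule back_subst[of "\<lambda>F. has4 F _"])
      (intro ext, simp add: f_num_def Let_def add_divide_distrib[symmetric] diff_divide_distrib[symmetric], simp add: algebra_simps)
  have 4: "has4 (\<lambda>w1 w2 v1 v2. f_num \<alpha> \<beta> \<gamma> 4 w1 w2 v1 v2 / (?D w1 w2 * ?D v1 v2))
      (?a * ((I1 + ?b * I12) * (I0 + ?a * I1) - ?g * (I1 * I12)))"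
    using has4_cmult[OF has4_diff[OF has4_mult[OF b1 a0] has4_cmult[OF has4_mult[OF h1 h12], of ?g]], of ?a]
    by (rule back_subst[of "\<lambda>F. has4 F _"])
      (intro ext, simp add: f_num_def Let_def add_divide_distrib[symmetric] diff_divide_distrib[symmetric], simp add: algebra_simps)
  have 5: "has4 (\<lambda>w1 w2 v1 v2. f_num \<alpha> \<beta> \<gamma> 5 w1 w2 v1 v2 / (?D w1 w2 * ?D v1 v2))
      (?g * ((I1 + ?b * I12) * I2 - (I0 + ?b * I2) * I12))"
    using has4_cmult[OF has4_diff[OF has4_mult[OF b1 h2] has4_mult[OF b0 h12]], of ?g]
    by (rule back_subst[of "\<lambda>F. has4 F _"])
      (intro ext, simp add: f_num_def Let_def add_divide_distrib[symmetric] diff_divide_distrib[symmetric], simp add: algebra_simps)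
  have 6: "has4 (\<lambda>w1 w2 v1 v2. f_num \<alpha> \<beta> \<gamma> 6 w1 w2 v1 v2 / (?D w1 w2 * ?D v1 v2))
      (?g * (I1 * (I2 + ?a * I12) - I12 * (I0 + ?a * I1)))"
    using has4_cmult[OF has4_diff[OF has4_mult[OF h1 a2] has4_mult[OF h12 a0]], of ?g]
    by (rule back_subst[of "\<lambda>F. has4 F _"])
      (intro ext, simp add: f_num_def Let_def add_divide_distrib[symmetric] diff_divide_distrib[symmetric], simp add: algebra_simps)
  show ?thesis
    using tt 1 2 3 4 5 6 by (elim disjE) (simp_all add: w.Ebil_def algebra_simps)
qed

end

theorem theorem1p2:
  fixes \<alpha> \<beta> \<gamma> :: real and v :: "int \<times> int" and t :: nat
  assumes "\<alpha> > 0" and "\<beta> > 0" and "\<gamma> > 0" and "\<gamma>\<^sup>2 > \<alpha> * \<beta>"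
    and "t \<in> {1..6}"
  shows "(\<lambda>n. complex_of_real (torus_type_prob (sv_weights \<alpha> \<beta> \<gamma>) n v t))
           \<longlonglongrightarrow> torus4_integral (\<lambda>w1 w2 v1 v2.
                 f_num \<alpha> \<beta> \<gamma> t w1 w2 v1 v2 / (Delta \<alpha> \<beta> \<gamma> w1 w2 * Delta \<alpha> \<beta> \<gamma> v1 v2))"
proof -
  interpret weights \<alpha> \<beta> \<gamma> by standard (use assms in auto)
  show ?thesis
    unfolding torus4_integral_eq[OF has4_type[OF assms(5)]] by (rule type_prob_tendsto[OF assms(5)])
qed

end
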